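(* Let $T$ be (the surface of) a regular tetrahedron in $\mathbb{R}^3$, with its intrinsic path metric. Then $\operatorname{GC}(T)=3$ or $\operatorname{GC}(T)=4$.
   Context: For a metric space $X$, let $P(X)$ denote the space of paths in $X$. A geodesic motion-planning rule (GMPR) on a subset $E\subseteq X\times X$ is a continuous function $\phi:E\to P(X)$ such that for every $(x_0,x_1)\in E$, $\phi(x_0,x_1)$ is a minimal (shortest) geodesic from $x_0$ to $x_1$. The geodesic complexity $\operatorname{GC}(X)$ is the smallest integer $k$ such that there is a partition $X\times X=E_0\sqcup E_1\sqcup\cdots\sqcup E_k$ in which each $E_i$ is locally compact and admits a GMPR. *)

theory Defs
  imports "HOL-Analysis.Analysis"
begin

definition tetra_surface :: "real^3 \<Rightarrow> real^3 \<Rightarrow> real^3 \<Rightarrow> real^3 \<Rightarrow> (real^3) set" where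
  "tetra_surface a b c d =
     convex hull {a,b,c} \<union> convex hull {a,b,d} \<union> convex hull {a,c,d} \<union> convex hull {b,c,d}"

definition regular_tetra :: "real^3 \<Rightarrow> real^3 \<Rightarrow> real^3 \<Rightarrow> real^3 \<Rightarrow> bool" where
  "regular_tetra a b c d \<longleftrightarrow> (\<exists>s>0. dist a b = s \<and> dist a c = s \<and> dist a d = s \<and>
      dist b c = s \<and> dist b d = s \<and> dist c d = s)"

definition partition_sums :: "(real \<Rightarrow> 'a::metric_space) \<Rightarrow> real set" where
  "partition_sums g = {(\<Sum>i<n. dist (g (t i)) (g (t (Suc i)))) | n t.
       t 0 = 0 \<and> t n = 1 \<and> (\<forall>i<n. t i \<le> t (Suc i))}"

definition rectifiable :: "(real \<Rightarrow> 'a::metric_space) \<Rightarrow> bool" where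
  "rectifiable g \<longleftrightarrow> bdd_above (partition_sums g)"

definition plength :: "(real \<Rightarrow> 'a::metric_space) \<Rightarrow> real" where
  "plength g = Sup (partition_sums g)"

definition idist :: "'a::real_normed_vector set \<Rightarrow> 'a \<Rightarrow> 'a \<Rightarrow> real" where
  "idist S x y = Inf {plength g | g. path g \<and> path_image g \<subseteq> S \<and> pathstart g = x \<and>
                          pathfinish g = y \<and> rectifiable g}"

definition min_geodesic :: "'a::real_normed_vector set \<Rightarrow> 'a \<Rightarrow> 'a \<Rightarrow> (real \<Rightarrow> 'a) \<Rightarrow> bool" where
  "min_geodesic S x0 x1 \<gamma> \<longleftrightarrow> \<gamma> 0 = x0 \<and> \<gamma> 1 = x1 \<and> \<gamma> ` {0..1} \<subseteq> S \<and>
     (\<forall>s\<in>{0..1}. \<forall>t\<in>{0..1}. idist S (\<gamma> s) (\<gamma> t) = \<bar>s - t\<bar> * idist S x0 x1)"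

definition pdist :: "'a::real_normed_vector set \<Rightarrow> ('a \<times> 'a) \<Rightarrow> ('a \<times> 'a) \<Rightarrow> real" where
  "pdist S = prod_dist (idist S) (idist S)"

text \<open>Geodesic motion-planning rule on E: continuity into the path space P(S) with the
  compact-open topology, which for the compact domain [0,1] is the topology of uniform
  convergence w.r.t. idist S.\<close>
definition GMPR :: "'a::real_normed_vector set \<Rightarrow> ('a \<times> 'a) set \<Rightarrow> ('a \<times> 'a \<Rightarrow> real \<Rightarrow> 'a) \<Rightarrow> bool" where
  "GMPR S E \<phi> \<longleftrightarrow>
     (\<forall>p\<in>E. min_geodesic S (fst p) (snd p) (\<phi> p)) \<and>
     (\<forall>p\<in>E. \<forall>\<epsilon>>0. \<exists>\<delta>>0. \<forall>q\<in>E. pdist S q p < \<delta> \<longrightarrow>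
         (\<forall>t\<in>{0..1}. idist S (\<phi> q t) (\<phi> p t) < \<epsilon>))"

definition admits_GMPR :: "'a::real_normed_vector set \<Rightarrow> ('a \<times> 'a) set \<Rightarrow> bool" where
  "admits_GMPR S E \<longleftrightarrow> (\<exists>\<phi>. GMPR S E \<phi>)"

definition loc_compact_sub :: "'a::real_normed_vector set \<Rightarrow> ('a \<times> 'a) set \<Rightarrow> bool" where
  "loc_compact_sub S E \<longleftrightarrow>
     locally_compact_space (subtopology (Metric_space.mtopology (S \<times> S) (pdist S)) E)"

definition GC_partition :: "'a::real_normed_vector set \<Rightarrow> nat \<Rightarrow> bool" where
  "GC_partition S k \<longleftrightarrow> (\<exists>E :: nat \<Rightarrow> ('a \<times> 'a) set.
      (\<Union>i\<le>k. E i) = S \<times> S \<and> disjoint_family_on E {..k} \<and>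
      (\<forall>i\<le>k. loc_compact_sub S (E i) \<and> admits_GMPR S (E i)))"

definition GC :: "'a::real_normed_vector set \<Rightarrow> nat" where
  "GC S = (LEAST k. GC_partition S k)"

end

(* The tetrahedron is the quotient of the Euclidean plane by the group generated by the half-turns
   about the points of a triangular lattice.  For lifts x, y of two points put u = y - x and
   w = y + x; a minimal geodesic corresponds to a point of the doubled lattice nearest to u, or
   nearest to w, whichever of the two distances is smaller.

   Lower bound: near a suitable pair with exactly four minimal geodesics (two nearest points for u
   and two for w, at equal distance) the four lengths vary independently enough that any single
   minimal geodesic can be destroyed while the others stay minimal.  Starting from this pair, a
   motion-planning rule picks one geodesic; a nearby pair lacking this geodesic must lie in another
   set of the partition.  Repeating this three times exhibits four different sets.

   Upper bound: stratify by the number n of nearest lattice points, counted for u and w together,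
   off the finite set of pairs with coordinates in (1/6) of the lattice.  There n <= 4, the stratum
   of given n is locally closed, and the minimal geodesics over it vary in locally constant
   families, so it suffices to give a choice among them that is locally constant; together with the
   finite exceptional set this makes five sets. *)
theory Submission
  imports Defs
begin

text \<open>The obstacle is that labels belong to lifts. Moving x and y together by a translation or
  half-turn, or changing the lift of x alone, renames the nearest lattice points, and a half-turn of
  x alone even exchanges u and w up to sign. A choice among labels must survive all these changes,
  so the rules are built from data that transform predictably: signs, orientations and directions of
  labels. Over a vertex a half-turn fixes the point and identifies labels in pairs, so two different
  labels may name one geodesic there; uniqueness can only be required up to this coincidence. The
  sixths come from the covering radius 2/sqrt 3 of the doubled lattice. Three points nearest to u
  put the common minimum at this radius; the other of u, w is at least as far from the lattice, so
  both are corners of cells, with coordinates in thirds, and x = (w - u)/2, y = (w + u)/2 have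
  coordinates in sixths. For the lower bound, continuity is only exploited at the midpoints of the
  geodesics, which already tell the four candidates apart.\<close>

section \<open>The triangular lattice\<close>

text \<open>\<open>pc\<close> and \<open>qc\<close> are the coordinates with respect to the basis 1, exp(i pi / 3).\<close>
definition pc :: "complex \<Rightarrow> real" where "pc z = Re z - Im z / sqrt 3"
definition qc :: "complex \<Rightarrow> real" where "qc z = 2 * Im z / sqrt 3"
definition pt :: "real \<Rightarrow> real \<Rightarrow> complex" where "pt p q = Complex (p + q / 2) (q * sqrt 3 / 2)"

lemma pc_pt [simp]: "pc (pt p q) = p" and qc_pt [simp]: "qc (pt p q) = q"
  by (simp_all add: pc_def qc_def pt_def)

lemma coord_linear [simp]:
  "pc (x + y) = pc x + pc y" "qc (x + y) = qc x + qc y"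
  "pc (x - y) = pc x - pc y" "qc (x - y) = qc x - qc y"
  "pc (- x) = - pc x" "qc (- x) = - qc x" "pc 0 = 0" "qc 0 = 0"
  "pc (r *\<^sub>R x) = r * pc x" "qc (r *\<^sub>R x) = r * qc x"
  by (simp_all add: pc_def qc_def field_simps)

lemma coord_eqI: "pc x = pc y \<Longrightarrow> qc x = qc y \<Longrightarrow> x = y"
  by (auto simp: pc_def qc_def complex_eq_iff)

lemma norm_coord: "(norm z)\<^sup>2 = (pc z)\<^sup>2 + pc z * qc z + (qc z)\<^sup>2"
  unfolding cmod_power2 pc_def qc_def
  by (simp add: power2_eq_square field_simps)

text \<open>Completing the square: \<open>4 (p^2 + p q + q^2) - p^2 = (p + 2 q)^2 + 2 p^2\<close>,
  and likewise for q. The constant 2 is not sharp, but any bound serves.\<close>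

lemma coord_le_norm: "\<bar>pc z\<bar> \<le> 2 * norm z" "\<bar>qc z\<bar> \<le> 2 * norm z"
proof -
  have "(pc z)\<^sup>2 \<le> (2 * norm z)\<^sup>2"
    unfolding power_mult_distrib norm_coord
    using add_nonneg_nonneg[OF zero_le_power2[of "pc z + 2 * qc z"] zero_le_power2[of "sqrt 2 * pc z"]]
    by (simp add: power2_eq_square algebra_simps)
  then show "\<bar>pc z\<bar> \<le> 2 * norm z" using abs_le_square_iff[of "pc z" "2 * norm z"] by simp
  have "(qc z)\<^sup>2 \<le> (2 * norm z)\<^sup>2"
    unfolding power_mult_distrib norm_coord
    using add_nonneg_nonneg[OF zero_le_power2[of "qc z + 2 * pc z"] zero_le_power2[of "sqrt 2 * qc z"]]
    by (simp add: power2_eq_square algebra_simps)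
  then show "\<bar>qc z\<bar> \<le> 2 * norm z" using abs_le_square_iff[of "qc z" "2 * norm z"] by simp
qed

lemma continuous_coord [continuous_intros]:
  "continuous_on S f \<Longrightarrow> continuous_on S (\<lambda>x. pc (f x))"
  "continuous_on S f \<Longrightarrow> continuous_on S (\<lambda>x. qc (f x))"
  unfolding pc_def qc_def by (auto intro!: continuous_intros)

text \<open>The doubled lattice: these are the translations in the half-turn group.\<close>
definition lat :: "complex set" where "lat = {l. pc l / 2 \<in> \<int> \<and> qc l / 2 \<in> \<int>}"

lemma lat_0 [simp]: "0 \<in> lat" by (simp add: lat_def)

lemma lat_add: "l \<in> lat \<Longrightarrow> m \<in> lat \<Longrightarrow> l + m \<in> lat"
  and lat_minus: "l \<in> lat \<Longrightarrow> - l \<in> lat"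
  and lat_diff: "l \<in> lat \<Longrightarrow> m \<in> lat \<Longrightarrow> l - m \<in> lat"
  by (auto simp: lat_def add_divide_distrib diff_divide_distrib)

lemma lat_minus_iff [simp]: "- l \<in> lat \<longleftrightarrow> l \<in> lat"
  using lat_minus[of l] lat_minus[of "- l"] by auto

lemma pt_lat [simp]: "pt (2 * of_int m) (2 * of_int n) \<in> lat"
  by (simp add: lat_def)

lemma latE:
  assumes "l \<in> lat" obtains m n :: int where "pc l = 2 * of_int m" "qc l = 2 * of_int n"
proof -
  from assms obtain m n :: int where "pc l / 2 = of_int m" "qc l / 2 = of_int n"
    by (auto simp: lat_def elim!: Ints_cases)
  then show ?thesis using that[of m n] by (simp add: field_simps)
qed

lemma closed_lat: "closed lat"
proof -
  have "lat = (\<lambda>z. pc z / 2) -` \<int> \<inter> (\<lambda>z. qc z / 2) -` \<int>" by (auto simp: lat_def)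
  also have "closed \<dots>"
    by (intro closed_Int closed_vimage closed_Ints continuous_intros) auto
  finally show ?thesis .
qed

lemma finite_lat_ball: "finite {l \<in> lat. norm (v - l) \<le> r}"
proof -
  define B where "B = r + norm v"
  have "{l \<in> lat. norm (v - l) \<le> r} \<subseteq> (\<lambda>(m,n). pt (2 * of_int m) (2 * of_int n)) ` ({-\<lceil>B\<rceil>..\<lceil>B\<rceil>} \<times> {-\<lceil>B\<rceil>..\<lceil>B\<rceil>})"
  proof
    fix l assume l: "l \<in> {l \<in> lat. norm (v - l) \<le> r}"
    then obtain m n :: int where mn: "pc l = 2 * of_int m" "qc l = 2 * of_int n" by (auto elim: latE)
    have "norm l \<le> B" using l norm_triangle_ineq4[of v "v - l"] unfolding B_def by simp
    then have "\<bar>2 * real_of_int m\<bar> \<le> 2 * B" "\<bar>2 * real_of_int n\<bar> \<le> 2 * B"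
      using coord_le_norm[of l] mn by linarith+
    then have "- \<lceil>B\<rceil> \<le> m \<and> m \<le> \<lceil>B\<rceil>" "- \<lceil>B\<rceil> \<le> n \<and> n \<le> \<lceil>B\<rceil>"
      by linarith+
    moreover have "l = pt (2 * of_int m) (2 * of_int n)" by (rule coord_eqI) (simp_all add: mn)
    ultimately show "l \<in> (\<lambda>(m,n). pt (2 * of_int m) (2 * of_int n)) ` ({-\<lceil>B\<rceil>..\<lceil>B\<rceil>} \<times> {-\<lceil>B\<rceil>..\<lceil>B\<rceil>})"
      by (auto intro!: image_eqI[where x="(m,n)"])
  qed
  then show ?thesis by (rule finite_subset) auto
qed

text \<open>Finitely many lattice points lie within r + 1 of v, so distances beyond r cannot
  accumulate at r. The gap is what lets sets of nearest points shrink, but not grow, under small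
  perturbations.\<close>

lemma lat_gap: "\<exists>\<eta>>0. \<forall>l\<in>lat. norm (v - l) < r + \<eta> \<longrightarrow> norm (v - l) \<le> r"
proof -
  define S where "S = {l \<in> lat. norm (v - l) \<le> r + 1} \<inter> {l. norm (v - l) > r}"
  have fin: "finite S" unfolding S_def by (intro finite_Int disjI1 finite_lat_ball)
  \<comment> \<open>The inserted 1 keeps the minimum defined when \<open>S\<close> is empty and
    confines the argument to the ball of radius r + 1.\<close>
  define \<eta> where "\<eta> = Min (insert 1 ((\<lambda>l. norm (v - l) - r) ` S))"
  have "\<eta> > 0" unfolding \<eta>_def using fin by (subst Min_gr_iff) (auto simp: S_def)
  moreover have "norm (v - l) \<le> r" if "l \<in> lat" "norm (v - l) < r + \<eta>" for l
  proof (rule ccontr)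
    assume "\<not> norm (v - l) \<le> r"
    moreover have "\<eta> \<le> 1" unfolding \<eta>_def using fin by (intro Min_le) auto
    ultimately have "l \<in> S" using that by (auto simp: S_def)
    then have "\<eta> \<le> norm (v - l) - r" unfolding \<eta>_def using fin by (intro Min_le) auto
    then show False using that by simp
  qed
  ultimately show ?thesis by blast
qed

text \<open>The Voronoi cell of 0 in \<^const>\<open>lat\<close>, cut out by the six shortest vectors.\<close>
definition hex :: "complex \<Rightarrow> bool" where
  "hex v \<longleftrightarrow> \<bar>2 * pc v + qc v\<bar> \<le> 2 \<and> \<bar>pc v + 2 * qc v\<bar> \<le> 2 \<and> \<bar>pc v - qc v\<bar> \<le> 2"

text \<open>Half the difference between the squared distances of v from the lattice point with
  coordinates (2m, 2n) and from 0. It is affine in v, so comparing v with a lattice point is a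
  half-plane condition.\<close>

definition excess :: "int \<Rightarrow> int \<Rightarrow> complex \<Rightarrow> real" where
  "excess m n v = real_of_int (m\<^sup>2 + n\<^sup>2 + (m + n)\<^sup>2)
     - (m * (2 * pc v + qc v) + n * (pc v + 2 * qc v))"

lemma norm_diff_lat:
  assumes "pc l = 2 * of_int m" "qc l = 2 * of_int n"
  shows "(norm (v - l))\<^sup>2 - (norm v)\<^sup>2 = 2 * excess m n v"
  unfolding norm_coord excess_def using assms by (simp add: power2_eq_square algebra_simps)

lemma norm_le_lat_iff:
  assumes "pc l = 2 * of_int m" "qc l = 2 * of_int n"
  shows "norm v \<le> norm (v - l) \<longleftrightarrow> excess m n v \<ge> 0"
    and "norm (v - l) = norm v \<longleftrightarrow> excess m n v = 0"
proof -
  have "norm v \<le> norm (v - l) \<longleftrightarrow> (norm v)\<^sup>2 \<le> (norm (v - l))\<^sup>2"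
    using abs_le_square_iff[of "norm v" "norm (v - l)"] by simp
  then show "norm v \<le> norm (v - l) \<longleftrightarrow> excess m n v \<ge> 0"
    using norm_diff_lat[OF assms, of v] by (smt (verit))
  have "norm (v - l) = norm v \<longleftrightarrow> (norm (v - l))\<^sup>2 = (norm v)\<^sup>2" by simp
  then show "norm (v - l) = norm v \<longleftrightarrow> excess m n v = 0"
    using norm_diff_lat[OF assms, of v] by (smt (verit))
qed

text \<open>Let M be the largest of |m|, |n|, |m + n|. Once M is at least 2, the quadratic part is
  at least 3M, while on the hexagon the linear part is at most 2M.\<close>

lemma hex_excess_pos:
  assumes "hex v" and "\<not> (\<bar>m\<bar> \<le> 1 \<and> \<bar>n\<bar> \<le> 1 \<and> \<bar>m + n\<bar> \<le> 1)"
  shows "excess m n v > 0"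
proof -
  define A where "A = 2 * pc v + qc v"
  define B where "B = pc v + 2 * qc v"
  have AB: "\<bar>A\<bar> \<le> 2" "\<bar>B\<bar> \<le> 2" "\<bar>A - B\<bar> \<le> 2"
    using assms(1) by (auto simp: hex_def A_def B_def)
  define M where "M = max (max \<bar>m\<bar> \<bar>n\<bar>) \<bar>m + n\<bar>"
  define S where "S = m\<^sup>2 + n\<^sup>2 + (m + n)\<^sup>2"
  have M2: "M \<ge> 2" using assms(2) unfolding M_def by auto
  have sq: "3 * M\<^sup>2 \<le> 2 * S"
  proof -
    have "M\<^sup>2 = m\<^sup>2 \<or> M\<^sup>2 = n\<^sup>2 \<or> M\<^sup>2 = (m + n)\<^sup>2"
      unfolding M_def max_def by auto
    moreover have "0 \<le> (m + 2 * n)\<^sup>2" "0 \<le> (2 * m + n)\<^sup>2" "0 \<le> (m - n)\<^sup>2" by simp_all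
    ultimately show ?thesis unfolding S_def by (auto simp: power2_eq_square algebra_simps)
  qed
  have "6 * M \<le> 3 * M\<^sup>2" using M2 by (simp add: power2_eq_square)
  then have "3 * M \<le> S" using sq by linarith
  then have sq': "real_of_int (3 * M) \<le> real_of_int S" by (simp only: of_int_le_iff)
  have lin: "m * A + n * B \<le> 2 * real_of_int M"
  proof -
    have *: "x * y \<le> \<bar>x\<bar> * 2" if "\<bar>y\<bar> \<le> 2" for x y :: real
    proof -
      have "x * y \<le> \<bar>x\<bar> * \<bar>y\<bar>" by (metis abs_ge_self abs_mult)
      also have "\<dots> \<le> \<bar>x\<bar> * 2" using that by (intro mult_left_mono) auto
      finally show ?thesis .
    qed
    \<comment> \<open>The largest of |m|, |n|, |m + n| is the sum of the other two. The linear form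
      is therefore written in A and B, in A and A - B, and in B and A - B, one version for each
      case.\<close>
    have 1: "m * A + n * B \<le> real_of_int (\<bar>m\<bar> + \<bar>n\<bar>) * 2"
      using *[OF AB(1), of m] *[OF AB(2), of n] by (simp add: algebra_simps)
    have 2: "m * A + n * B \<le> real_of_int (\<bar>m + n\<bar> + \<bar>n\<bar>) * 2"
      using *[OF AB(1), of "m + n"] *[of "A - B" "- n"] AB(3) by (simp add: algebra_simps)
    have 3: "m * A + n * B \<le> real_of_int (\<bar>m + n\<bar> + \<bar>m\<bar>) * 2"
      using *[OF AB(2), of "m + n"] *[of "A - B" "m"] AB(3) by (simp add: algebra_simps)
    have "\<bar>m\<bar> + \<bar>n\<bar> = M \<or> \<bar>m + n\<bar> + \<bar>n\<bar> = M \<or> \<bar>m + n\<bar> + \<bar>m\<bar> = M"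
      unfolding M_def by linarith
    then show ?thesis using 1 2 3 by (metis mult.commute)
  qed
  have "2 * real_of_int M < real_of_int (3 * M)" using M2 by simp
  then show ?thesis using sq' lin unfolding excess_def A_def[symmetric] B_def[symmetric] S_def[symmetric] by linarith
qed

lemma six_vectors:
  fixes m n :: int
  assumes "\<bar>m\<bar> \<le> 1 \<and> \<bar>n\<bar> \<le> 1 \<and> \<bar>m + n\<bar> \<le> 1"
  shows "(m, n) \<in> {(0,0), (1,0), (-1,0), (0,1), (0,-1), (1,-1), (-1,1)}"
proof -
  have "m \<in> {-1,0,1}" "n \<in> {-1,0,1}" using assms by auto
  then show ?thesis using assms by auto
qed

lemma hex_nearest:
  assumes "hex v" "l \<in> lat"
  shows "norm v \<le> norm (v - l)"
proof -
  obtain m n :: int where mn: "pc l = 2 * of_int m" "qc l = 2 * of_int n" using assms by (auto elim: latE)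
  have "excess m n v \<ge> 0"
  proof (cases "\<bar>m\<bar> \<le> 1 \<and> \<bar>n\<bar> \<le> 1 \<and> \<bar>m + n\<bar> \<le> 1")
    case True
    then show ?thesis using six_vectors[OF True] assms by (auto simp: hex_def excess_def)
  next
    case False
    show ?thesis using hex_excess_pos[OF assms(1) False] by simp
  qed
  then show ?thesis using norm_le_lat_iff[OF mn] by simp
qed

lemma hex_nearest_eq:
  assumes "hex v" "l \<in> lat" "norm (v - l) = norm v" "l \<noteq> 0"
  shows "(pc l, qc l) \<in> {(2,0), (-2,0), (0,2), (0,-2), (2,-2), (-2,2)}"
proof -
  obtain m n :: int where mn: "pc l = 2 * of_int m" "qc l = 2 * of_int n" using assms by (auto elim: latE)
  have eq: "excess m n v = 0"
    using norm_le_lat_iff[OF mn] assms by simp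
  have "\<bar>m\<bar> \<le> 1 \<and> \<bar>n\<bar> \<le> 1 \<and> \<bar>m + n\<bar> \<le> 1"
    using hex_excess_pos[OF assms(1), of m n] eq by auto
  note six_vectors[OF this]
  moreover have "\<not> (m = 0 \<and> n = 0)" using assms(4) mn coord_eqI[of l 0] by auto
  ultimately show ?thesis using mn by auto
qed

lemma nearest_hex:
  assumes "\<And>l. l \<in> lat \<Longrightarrow> norm v \<le> norm (v - l)"
  shows "hex v"
proof -
  have *: "excess m n v \<ge> 0" for m n :: int
    using assms[OF pt_lat[of m n]] norm_le_lat_iff(1)[of "pt (2 * of_int m) (2 * of_int n)" m n v] by simp
  show ?thesis
    using *[of 1 0] *[of "-1" 0] *[of 0 1] *[of 0 "-1"] *[of 1 "-1"] *[of "-1" 1]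
    unfolding hex_def excess_def by (auto simp: abs_le_iff)
qed

lemma bisector_coord:
  assumes "norm (v - l) = norm v"
  shows "pc l * (2 * pc v + qc v) + qc l * (pc v + 2 * qc v) = (pc l)\<^sup>2 + pc l * qc l + (qc l)\<^sup>2"
proof -
  have "(norm (v - l))\<^sup>2 = (norm v)\<^sup>2" using assms by simp
  then show ?thesis unfolding norm_coord by (simp add: power2_eq_square algebra_simps)
qed

section \<open>Orbits of the half-turn group and nearest lattice points\<close>

text \<open>Being in the same orbit of the group generated by the half-turns about lattice points.\<close>
definition eqv :: "complex \<Rightarrow> complex \<Rightarrow> bool" where
  "eqv x y \<longleftrightarrow> y - x \<in> lat \<or> y + x \<in> lat"

lemma eqv_refl [simp]: "eqv x x" by (simp add: eqv_def)

lemma eqv_sym: "eqv x y \<Longrightarrow> eqv y x"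
  unfolding eqv_def using lat_minus_iff[of "y - x"] by (auto simp: add.commute)

lemma eqv_trans: "eqv x y \<Longrightarrow> eqv y z \<Longrightarrow> eqv x z"
  unfolding eqv_def
proof (elim disjE, goal_cases)
  case 1
  then show ?case using lat_add[of "y - x" "z - y"] by simp
next
  case 2
  then show ?case using lat_diff[of "z + y" "y - x"] by (simp add: algebra_simps)
next
  case 3
  then show ?case using lat_add[of "z - y" "y + x"] by (simp add: algebra_simps)
next
  case 4
  then show ?case using lat_diff[of "z + y" "y + x"] by (simp add: algebra_simps)
qed

section \<open>Distances between orbits and their nearest labels\<close>

lemma infdist_lat_le: "l \<in> lat \<Longrightarrow> infdist v lat \<le> norm (v - l)"
  by (metis infdist_le dist_norm)

lemma infdist_lat_attained:
  obtains l where "l \<in> lat" "infdist v lat = norm (v - l)"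
  using infdist_attains_inf[OF closed_lat, of v] lat_0 by (metis dist_norm empty_iff)

lemma infdist_lat_diff: assumes "m \<in> lat" shows "infdist (v - m) lat = infdist v lat"
proof -
  have *: "infdist (v - m) lat \<le> infdist v lat" if m: "m \<in> lat" for v m
  proof -
    obtain l where l: "l \<in> lat" "infdist v lat = norm (v - l)" by (rule infdist_lat_attained)
    then show ?thesis using infdist_lat_le[OF lat_diff[OF l(1) m], of "v - m"] by simp
  qed
  show ?thesis using *[OF assms, of v] *[OF lat_minus[OF assms], of "v - m"] by simp
qed

lemma infdist_lat_add: "m \<in> lat \<Longrightarrow> infdist (v + m) lat = infdist v lat"
  using infdist_lat_diff[of "- m" v] by simp

lemma infdist_lat_minus: "infdist (- v) lat = infdist v lat"
proof -
  have *: "infdist (- v) lat \<le> infdist v lat" for v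
  proof -
    obtain l where l: "l \<in> lat" "infdist v lat = norm (v - l)" by (rule infdist_lat_attained)
    then show ?thesis using infdist_lat_le[OF lat_minus[OF l(1)], of "- v"]
      by (simp add: norm_minus_commute)
  qed
  show ?thesis using *[of v] *[of "- v"] by simp
qed

text \<open>The distance from \<open>y\<close> to the orbit of \<open>x\<close>.  A point \<open>x + l\<close> of this orbit nearest to \<open>y\<close>
  corresponds to \<open>l \<in> nu x y\<close>, and a point \<open>l - x\<close> to \<open>l \<in> nw x y\<close>; when \<open>x\<close> is a vertex, two
  labels name the same point and \<open>ncount\<close> counts it twice, which keeps \<open>ncount\<close> upper
  semicontinuous.\<close>
definition odist :: "complex \<Rightarrow> complex \<Rightarrow> real" where
  "odist x y = min (infdist (y - x) lat) (infdist (y + x) lat)"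

text \<open>The radius is a parameter because u and w are measured against their common minimum: the
  one lying farther from the lattice then gets the empty set.\<close>

definition near :: "complex \<Rightarrow> real \<Rightarrow> complex set" where
  "near v r = {l \<in> lat. norm (v - l) = r}"

definition nu :: "complex \<Rightarrow> complex \<Rightarrow> complex set" where "nu x y = near (y - x) (odist x y)"
definition nw :: "complex \<Rightarrow> complex \<Rightarrow> complex set" where "nw x y = near (y + x) (odist x y)"
definition ncount :: "complex \<Rightarrow> complex \<Rightarrow> nat" where "ncount x y = card (nu x y) + card (nw x y)"

lemma odist_nonneg [simp]: "odist x y \<ge> 0" by (simp add: odist_def infdist_nonneg)

lemma odist_le_infdist: "odist x y \<le> infdist (y - x) lat" "odist x y \<le> infdist (y + x) lat"
  by (simp_all add: odist_def)

lemma odist_le: assumes "l \<in> lat" shows "odist x y \<le> norm (y - x - l)" "odist x y \<le> norm (y + x - l)"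
  using infdist_lat_le[OF assms, of "y - x"] infdist_lat_le[OF assms, of "y + x"] odist_le_infdist[of x y] by linarith+

lemma ties_nonempty: "nu x y \<noteq> {} \<or> nw x y \<noteq> {}"
proof -
  obtain l where l: "l \<in> lat" "infdist (y - x) lat = norm (y - x - l)" by (rule infdist_lat_attained)
  obtain m where m: "m \<in> lat" "infdist (y + x) lat = norm (y + x - m)" by (rule infdist_lat_attained)
  show ?thesis using l m unfolding nu_def nw_def near_def odist_def min_def by auto
qed

lemma finite_near: "finite (near v r)"
  by (rule finite_subset[OF _ finite_lat_ball[of v r]]) (auto simp: near_def)

lemma finite_ties [simp]: "finite (nu x y)" "finite (nw x y)"
  by (simp_all add: nu_def nw_def finite_near)

lemma ncount_pos: "ncount x y \<ge> 1"
  using ties_nonempty[of x y] by (simp add: ncount_def Suc_leI card_gt_0_iff)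

lemma odist_shift:
  assumes "m \<in> lat"
  shows "odist (x + m) y = odist x y" "odist (m - x) y = odist x y"
    "odist x (y + m) = odist x y" "odist x (m - y) = odist x y"
proof -
  have a: "y - (x + m) = (y - x) - m" "y + (x + m) = (y + x) + m"
    "y - (m - x) = (y + x) - m" "y + (m - x) = (y - x) + m"
    "y + m - x = (y - x) + m" "y + m + x = (y + x) + m"
    "m - y - x = - (y + x) + m" "m - y + x = - (y - x) + m" by simp_all
  show "odist (x + m) y = odist x y" "odist (m - x) y = odist x y"
    "odist x (y + m) = odist x y" "odist x (m - y) = odist x y"
    unfolding odist_def a infdist_lat_diff[OF assms] infdist_lat_add[OF assms] infdist_lat_minus
    by (simp_all add: min.commute)
qed

lemma odist_commute: "odist x y = odist y x"
  unfolding odist_def using infdist_lat_minus[of "x - y"] by (simp add: add.commute)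

lemma eqv_cases:
  assumes "eqv x x'" obtains m where "m \<in> lat" "x' = x + m" | m where "m \<in> lat" "x' = m - x"
  using assms unfolding eqv_def by (metis add_diff_cancel_left' add_diff_cancel_right' diff_add_cancel add.commute)

lemma odist_eqv: assumes "eqv x x'" "eqv y y'" shows "odist x' y' = odist x y"
  using assms by (elim eqv_cases) (simp_all add: odist_shift)

lemma odist_le_norm: "odist x y \<le> norm (y - x)" using odist_le[of 0 x y] by simp

lemma odist_lipschitz: "\<bar>odist x' y' - odist x y\<bar> \<le> dist x' x + dist y' y"
proof -
  have "\<bar>infdist (y' - x') lat - infdist (y - x) lat\<bar> \<le> dist (y' - x') (y - x)"
       "\<bar>infdist (y' + x') lat - infdist (y + x) lat\<bar> \<le> dist (y' + x') (y + x)"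
    by (rule infdist_triangle_abs)+
  moreover have "dist (y' - x') (y - x) \<le> dist x' x + dist y' y"
    using norm_triangle_ineq4[of "y' - y" "x' - x"] by (simp add: dist_norm algebra_simps)
  moreover have "dist (y' + x') (y + x) \<le> dist x' x + dist y' y"
    using norm_triangle_ineq[of "y' - y" "x' - x"] by (simp add: dist_norm algebra_simps)
  ultimately show ?thesis unfolding odist_def min_def by (auto split: if_splits)
qed

text \<open>Translating x or y shifts u and w by lattice vectors, and a half-turn of one point
  exchanges u and w up to sign and shift. The labels follow, so \<open>nu\<close> and
  \<open>nw\<close> make sense on orbits only up to exchange and relabelling.\<close>

lemma ties_shift:
  assumes "m \<in> lat"
  shows "l \<in> nu (x + m) y \<longleftrightarrow> l + m \<in> nu x y" "l \<in> nw (x + m) y \<longleftrightarrow> l - m \<in> nw x y"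
    "l \<in> nu (m - x) y \<longleftrightarrow> l + m \<in> nw x y" "l \<in> nw (m - x) y \<longleftrightarrow> l - m \<in> nu x y"
    "l \<in> nu x (y + m) \<longleftrightarrow> l - m \<in> nu x y" "l \<in> nw x (y + m) \<longleftrightarrow> l - m \<in> nw x y"
    "l \<in> nu x (m - y) \<longleftrightarrow> m - l \<in> nw x y" "l \<in> nw x (m - y) \<longleftrightarrow> m - l \<in> nu x y"
proof -
  have a: "l + m \<in> lat \<longleftrightarrow> l \<in> lat" "l - m \<in> lat \<longleftrightarrow> l \<in> lat" "m - l \<in> lat \<longleftrightarrow> l \<in> lat" for l
    using assms by (metis add_diff_cancel_right' lat_add lat_diff)
      (metis assms diff_add_cancel lat_add lat_diff, metis assms diff_diff_eq2 add_diff_cancel_left' lat_diff)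
  have b: "norm (m - y - x - l) = norm (y + x - (m - l))" "norm (m - y + x - l) = norm (y - x - (m - l))"
    by (metis diff_diff_eq2 norm_minus_commute diff_diff_eq add.commute diff_add_eq_diff_diff_swap)+
  have c: "y - (x + m) - l = y - x - (l + m)" "y + (x + m) - l = y + x - (l - m)"
    "y - (m - x) - l = y + x - (l + m)" "y + (m - x) - l = y - x - (l - m)"
    "y + m - x - l = y - x - (l - m)" "y + m + x - l = y + x - (l - m)" by simp_all
  show "l \<in> nu (x + m) y \<longleftrightarrow> l + m \<in> nu x y" "l \<in> nw (x + m) y \<longleftrightarrow> l - m \<in> nw x y"
    "l \<in> nu (m - x) y \<longleftrightarrow> l + m \<in> nw x y" "l \<in> nw (m - x) y \<longleftrightarrow> l - m \<in> nu x y"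
    "l \<in> nu x (y + m) \<longleftrightarrow> l - m \<in> nu x y" "l \<in> nw x (y + m) \<longleftrightarrow> l - m \<in> nw x y"
    "l \<in> nu x (m - y) \<longleftrightarrow> m - l \<in> nw x y" "l \<in> nw x (m - y) \<longleftrightarrow> m - l \<in> nu x y"
    unfolding nu_def nw_def near_def mem_Collect_eq odist_shift[OF assms] a b c by (rule refl)+
qed

lemma card_ties_shift:
  assumes "m \<in> lat"
  shows "card (nu (x + m) y) = card (nu x y)" "card (nw (x + m) y) = card (nw x y)"
    "card (nu (m - x) y) = card (nw x y)" "card (nw (m - x) y) = card (nu x y)"
    "card (nu x (y + m)) = card (nu x y)" "card (nw x (y + m)) = card (nw x y)"
    "card (nu x (m - y)) = card (nw x y)" "card (nw x (m - y)) = card (nu x y)"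
proof -
  have p: "card S = card T" if *: "\<And>l. l \<in> S \<longleftrightarrow> l + c \<in> T" for S T and c :: complex
  proof -
    have "S = (\<lambda>l. l - c) ` T" unfolding set_eq_iff * image_iff by (metis add_diff_cancel diff_add_cancel)
    then show ?thesis by (simp add: card_image inj_on_def)
  qed
  have q: "card S = card T" if *: "\<And>l. l \<in> S \<longleftrightarrow> m - l \<in> T" for S T and m :: complex
  proof -
    have "S = (\<lambda>l. m - l) ` T" unfolding set_eq_iff * image_iff by (metis diff_diff_eq2 add_diff_cancel_left')
    then show ?thesis by (simp add: card_image inj_on_def)
  qed
  show "card (nu (x + m) y) = card (nu x y)" "card (nw (x + m) y) = card (nw x y)"
    "card (nu (m - x) y) = card (nw x y)" "card (nw (m - x) y) = card (nu x y)"
    "card (nu x (y + m)) = card (nu x y)" "card (nw x (y + m)) = card (nw x y)"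
    "card (nu x (m - y)) = card (nw x y)" "card (nw x (m - y)) = card (nu x y)"
    by (rule p[where c = m], simp add: ties_shift[OF assms])
      (rule p[where c = "- m"], simp add: ties_shift[OF assms],
       rule p[where c = m], simp add: ties_shift[OF assms],
       rule p[where c = "- m"], simp add: ties_shift[OF assms],
       rule p[where c = "- m"], simp add: ties_shift[OF assms],
       rule p[where c = "- m"], simp add: ties_shift[OF assms],
       rule q[where m = m], simp add: ties_shift[OF assms],
       rule q[where m = m], simp add: ties_shift[OF assms])
qed

lemma ncount_eqv: assumes "eqv x x'" "eqv y y'" shows "ncount x' y' = ncount x y"
  using assms by (elim eqv_cases) (simp_all add: ncount_def card_ties_shift)

lemma ties_usc:
  "\<exists>\<delta>>0. \<forall>x' y'. dist x' x < \<delta> \<longrightarrow> dist y' y < \<delta> \<longrightarrow> nu x' y' \<subseteq> nu x y \<and> nw x' y' \<subseteq> nw x y"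
proof -
  obtain \<eta>1 where e1: "\<eta>1 > 0" "\<And>l. l \<in> lat \<Longrightarrow> norm (y - x - l) < odist x y + \<eta>1 \<Longrightarrow> norm (y - x - l) \<le> odist x y"
    using lat_gap by metis
  obtain \<eta>2 where e2: "\<eta>2 > 0" "\<And>l. l \<in> lat \<Longrightarrow> norm (y + x - l) < odist x y + \<eta>2 \<Longrightarrow> norm (y + x - l) \<le> odist x y"
    using lat_gap by metis
  \<comment> \<open>Moving both points by less than \<delta> changes \<open>odist\<close>, and each
    distance to a label, by less than 2 \<delta>; together these 4 \<delta> have to fit into the
    gap.\<close>
  define \<delta> where "\<delta> = min \<eta>1 \<eta>2 / 4"
  have "\<delta> > 0" using e1 e2 by (simp add: \<delta>_def)
  moreover have "nu x' y' \<subseteq> nu x y \<and> nw x' y' \<subseteq> nw x y" if d: "dist x' x < \<delta>" "dist y' y < \<delta>" for x' y'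
  proof -
    have D: "odist x' y' < odist x y + 2 * \<delta>" using odist_lipschitz[of x' y' x y] d by linarith
    have a: "norm (y - x - l) < norm (y' - x' - l) + 2 * \<delta>" for l
      using norm_triangle_ineq[of "y' - x' - l" "(y - y') - (x - x')"] norm_triangle_ineq4[of "y - y'" "x - x'"] d
      by (simp add: dist_norm norm_minus_commute algebra_simps)
    have b: "norm (y + x - l) < norm (y' + x' - l) + 2 * \<delta>" for l
      using norm_triangle_ineq[of "y' + x' - l" "(y - y') + (x - x')"] norm_triangle_ineq[of "y - y'" "x - x'"] d
      by (simp add: dist_norm norm_minus_commute algebra_simps)
    have "4 * \<delta> \<le> \<eta>1" "4 * \<delta> \<le> \<eta>2" by (simp_all add: \<delta>_def)
    then have d4: "odist x' y' + 2 * \<delta> < odist x y + \<eta>1" "odist x' y' + 2 * \<delta> < odist x y + \<eta>2"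
      using D by linarith+
    have "norm (y - x - l) = odist x y" if "l \<in> lat" "norm (y' - x' - l) = odist x' y'" for l
      using e1(2)[OF that(1)] a[of l] d4 that odist_le(1)[OF that(1), of x y] by linarith
    moreover have "norm (y + x - l) = odist x y" if "l \<in> lat" "norm (y' + x' - l) = odist x' y'" for l
      using e2(2)[OF that(1)] b[of l] d4 that odist_le(2)[OF that(1), of x y] by linarith
    ultimately show ?thesis unfolding nu_def nw_def near_def by blast
  qed
  ultimately show ?thesis by blast
qed

text \<open>An inclusion of finite sets of equal cardinality is an equality. Hence the labels
  themselves, and not only their number, are locally constant on a set of constant count.\<close>

lemma ties_locally_eq:
  "\<exists>\<delta>>0. \<forall>x' y'. dist x' x < \<delta> \<longrightarrow> dist y' y < \<delta> \<longrightarrow>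
     ncount x' y' \<le> ncount x y \<and> (ncount x' y' = ncount x y \<longrightarrow> nu x' y' = nu x y \<and> nw x' y' = nw x y)"
proof -
  have "ncount x' y' \<le> ncount x y \<and> (ncount x' y' = ncount x y \<longrightarrow> nu x' y' = nu x y \<and> nw x' y' = nw x y)"
    if s: "nu x' y' \<subseteq> nu x y" "nw x' y' \<subseteq> nw x y" for x' y'
  proof -
    have c: "card (nu x' y') \<le> card (nu x y)" "card (nw x' y') \<le> card (nw x y)"
      by (rule card_mono[OF finite_ties(1) s(1)], rule card_mono[OF finite_ties(2) s(2)])
    moreover have "nu x' y' = nu x y \<and> nw x' y' = nw x y" if "ncount x' y' = ncount x y"
    proof -
      have "card (nu x' y') = card (nu x y)" "card (nw x' y') = card (nw x y)"
        using that c unfolding ncount_def by linarith+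
      then show ?thesis using s by (simp add: card_subset_eq)
    qed
    moreover have "ncount x' y' \<le> ncount x y" unfolding ncount_def using c by (intro add_mono)
    ultimately show ?thesis by (intro conjI impI) simp_all
  qed
  note * = this
  obtain \<delta> where d: "\<delta> > 0" "\<forall>x' y'. dist x' x < \<delta> \<longrightarrow> dist y' y < \<delta> \<longrightarrow> nu x' y' \<subseteq> nu x y \<and> nw x' y' \<subseteq> nw x y"
    using ties_usc[of x y] by (elim exE conjE)
  show ?thesis
  proof (intro exI[of _ \<delta>] conjI[OF d(1)] allI impI)
    fix x' y' assume "dist x' x < \<delta>" "dist y' y < \<delta>"
    then have "nu x' y' \<subseteq> nu x y \<and> nw x' y' \<subseteq> nw x y" by (rule d(2)[rule_format])
    then show "ncount x' y' \<le> ncount x y \<and> (ncount x' y' = ncount x y \<longrightarrow> nu x' y' = nu x y \<and> nw x' y' = nw x y)"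
      using *[of x' y'] by (elim conjE) simp
  qed
qed

text \<open>2/sqrt 3 is the circumradius of the cell, reached only at the six corners, whose
  coordinates are thirds. In the variables A, B the cell is |A|, |B|, |A - B| \<le> 2 and the
  squared norm is \<open>(A^2 - A B + B^2) / 3\<close>.\<close>

lemma hex_norm_le:
  assumes "hex v"
  shows "(norm v)\<^sup>2 \<le> 4 / 3" and "(norm v)\<^sup>2 = 4 / 3 \<Longrightarrow> 3 * pc v \<in> \<int> \<and> 3 * qc v \<in> \<int>"
proof -
  define A where "A = 2 * pc v + qc v"
  define B where "B = pc v + 2 * qc v"
  have AB: "\<bar>A\<bar> \<le> 2" "\<bar>B\<bar> \<le> 2" "\<bar>A - B\<bar> \<le> 2"
    using assms(1) by (auto simp: hex_def A_def B_def)
  have n: "3 * (norm v)\<^sup>2 = A * A - A * B + B * B"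
    unfolding norm_coord A_def B_def by (simp add: power2_eq_square algebra_simps)
  have pq: "3 * pc v = 2 * A - B" "3 * qc v = 2 * B - A" by (simp_all add: A_def B_def)
  have key: "a * a - a * b + b * b \<le> 4 \<and> (a * a - a * b + b * b = 4 \<longrightarrow> a = 2 \<and> (b = 0 \<or> b = 2))"
    if "0 \<le> b" "b \<le> a" "a \<le> 2" for a b :: real
  proof -
    have e: "a * a - a * b + b * b = a * a - b * (a - b)" by (simp add: algebra_simps)
    have 1: "a * a \<le> a * 2" "a * 2 \<le> 4" using that by (auto intro: mult_left_mono)
    have 2: "b * (a - b) \<ge> 0" using that by auto
    show ?thesis
    proof (intro conjI impI)
      show "a * a - a * b + b * b \<le> 4" using e 1 2 by linarith
      assume *: "a * a - a * b + b * b = 4"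
      then show a2: "a = 2" using e 1 2 by linarith
      have "b * (a - b) = 0" using e 1 2 * by linarith
      then show "b = 0 \<or> b = 2" using a2 by auto
    qed
  qed
  \<comment> \<open>These six sectors are permuted by linear symmetries of
    \<open>A^2 - A B + B^2\<close>, and each is carried to the sector of \<open>key\<close>.\<close>
  consider "0 \<le> B" "B \<le> A" | "0 \<le> A" "A \<le> B" | "0 \<le> -B" "-B \<le> -A" | "0 \<le> -A" "-A \<le> -B"
    | "A \<ge> 0" "B \<le> 0" | "A \<le> 0" "B \<ge> 0" by linarith
  then have "A * A - A * B + B * B \<le> 4 \<and> (A * A - A * B + B * B = 4 \<longrightarrow>
      (A,B) \<in> {(2,0),(2,2),(0,2),(-2,0),(-2,-2),(0,-2)})"
  proof cases
    case 1 then show ?thesis using key[of B A] AB by auto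
  next
    case 2 then show ?thesis using key[of A B] AB by (auto simp: algebra_simps)
  next
    case 3 then show ?thesis using key[of "-B" "-A"] AB by auto
  next
    case 4 then show ?thesis using key[of "-A" "-B"] AB by (auto simp: algebra_simps)
  next
    case 5
    then show ?thesis using key[of A "A - B"] AB by (auto simp: algebra_simps)
  next
    case 6
    then show ?thesis using key[of "-A" "B - A"] AB by (auto simp: algebra_simps)
  qed
  note m = this
  show "(norm v)\<^sup>2 \<le> 4 / 3" using m n by linarith
  assume "(norm v)\<^sup>2 = 4 / 3"
  then have "A * A - A * B + B * B = 4" using n by linarith
  then show "3 * pc v \<in> \<int> \<and> 3 * qc v \<in> \<int>" using m unfolding pq by auto
qed

text \<open>Each nonzero nearest point turns one of the inequalities defining \<open>hex\<close>
  into an equality. Two distinct points give two equalities, which leaves only the corners.\<close>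

lemma hex_vertex:
  assumes "hex v" "l \<in> lat" "norm (v - l) = norm v" "l \<noteq> 0"
    "m \<in> lat" "norm (v - m) = norm v" "m \<noteq> 0" "l \<noteq> m"
  shows "(norm v)\<^sup>2 = 4 / 3"
proof -
  define A where "A = 2 * pc v + qc v"
  define B where "B = pc v + 2 * qc v"
  have AB: "\<bar>A\<bar> \<le> 2" "\<bar>B\<bar> \<le> 2" "\<bar>A - B\<bar> \<le> 2"
    using assms(1) by (auto simp: hex_def A_def B_def)
  have n: "3 * (norm v)\<^sup>2 = A * A - A * B + B * B"
    unfolding norm_coord A_def B_def by (simp add: power2_eq_square algebra_simps)
  have six: "(pc k, qc k, A) = (2,0,2) \<or> (pc k, qc k, A) = (-2,0,-2) \<or> (pc k, qc k, B) = (0,2,2)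
      \<or> (pc k, qc k, B) = (0,-2,-2) \<or> (pc k, qc k, A) = (2,-2,B+2) \<or> (pc k, qc k, A) = (-2,2,B-2)"
    if k: "k \<in> lat" "norm (v - k) = norm v" "k \<noteq> 0" for k
    using hex_nearest_eq[OF assms(1) k] bisector_coord[OF k(2)] unfolding A_def B_def
    by (elim insertE emptyE) (simp_all add: power2_eq_square)
  have lm: "\<not> (pc l = pc m \<and> qc l = qc m)" using assms(8) coord_eqI by blast
  have "(A, B) \<in> {(2,0),(2,2),(0,2),(-2,0),(-2,-2),(0,-2)}"
    using six[OF assms(2-4)]
  proof (elim disjE)
  qed (use six[OF assms(5-7)] in \<open>elim disjE; use lm AB in force\<close>)+
  then have "3 * (norm v)\<^sup>2 = 4" unfolding n by auto
  then show ?thesis by simp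
qed

section \<open>Three nearest labels and the exceptional grid\<close>

lemma near_hex:
  assumes "r \<le> infdist v lat" "l \<in> near v r"
  shows "hex (v - l)"
proof (rule nearest_hex)
  fix m assume "m \<in> lat"
  then show "norm (v - l) \<le> norm (v - l - m)"
    using assms infdist_lat_le[OF lat_add[of l m], of v] by (auto simp: near_def algebra_simps)
qed

lemma int_lat: "l \<in> lat \<Longrightarrow> pc l \<in> \<int> \<and> qc l \<in> \<int>"
  by (erule latE) (metis Ints_of_int of_int_mult of_int_numeral)

lemma near_card3:
  assumes "r \<le> infdist v lat" "card (near v r) \<ge> 3"
  shows "r\<^sup>2 = 4 / 3"
proof -
  obtain S where S: "S \<subseteq> near v r" "card S = 3" using assms(2) by (meson obtain_subset_with_card_n)
  then obtain a b c where abc: "a \<in> near v r" "b \<in> near v r" "c \<in> near v r" "a \<noteq> b" "a \<noteq> c" "b \<noteq> c"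
    by (auto simp: card_3_iff)
  have "(norm (v - a))\<^sup>2 = 4 / 3"
    by (rule hex_vertex[of _ "b - a" "c - a"])
      (use abc near_hex[OF assms(1) abc(1)] lat_diff in \<open>auto simp: near_def\<close>)
  then show ?thesis using abc by (auto simp: near_def)
qed

text \<open>No point is farther than 2/sqrt 3 from the lattice, so the bound is attained and v is a
  corner of a cell. This covers the one of u, w for which r is only known to be a lower
  bound.\<close>

lemma infdist_lat_sq_le: 
  assumes "r \<le> infdist v lat" "r\<^sup>2 = 4 / 3" "r \<ge> 0"
  shows "3 * pc v \<in> \<int> \<and> 3 * qc v \<in> \<int>"
proof -
  obtain l where l: "l \<in> lat" "infdist v lat = norm (v - l)" by (rule infdist_lat_attained)
  then have h: "hex (v - l)" using near_hex[of "infdist v lat" v l] by (auto simp: near_def)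
  have "r\<^sup>2 \<le> (norm (v - l))\<^sup>2" using assms l by (intro power_mono) auto
  then have "(norm (v - l))\<^sup>2 = 4 / 3" using hex_norm_le(1)[OF h] assms by linarith
  then have "3 * pc (v - l) \<in> \<int>" "3 * qc (v - l) \<in> \<int>" using hex_norm_le(2)[OF h] by auto
  then have "3 * pc (v - l) + 3 * pc l \<in> \<int>" "3 * qc (v - l) + 3 * qc l \<in> \<int>"
    using int_lat[OF l(1)] by (auto intro!: Ints_add Ints_mult)
  then show ?thesis by (simp add: algebra_simps)
qed

text \<open>If three lattice points are nearest to \<open>u\<close>, or \<open>u\<close> and \<open>w\<close> are centres of cell edges, then \<open>x\<close> and \<open>y\<close>
  are grid points.\<close>
definition grid :: "complex \<Rightarrow> bool" where "grid x \<longleftrightarrow> 6 * pc x \<in> \<int> \<and> 6 * qc x \<in> \<int>"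

lemma grid_of_sum_diff:
  assumes "3 * pc (y - x) \<in> \<int>" "3 * qc (y - x) \<in> \<int>" "3 * pc (y + x) \<in> \<int>" "3 * qc (y + x) \<in> \<int>"
  shows "grid x \<and> grid y"
proof -
  have "6 * pc x = 3 * pc (y + x) - 3 * pc (y - x)" "6 * qc x = 3 * qc (y + x) - 3 * qc (y - x)"
    "6 * pc y = 3 * pc (y + x) + 3 * pc (y - x)" "6 * qc y = 3 * qc (y + x) + 3 * qc (y - x)" by simp_all
  then show ?thesis unfolding grid_def using assms by (metis Ints_add Ints_diff)
qed

text \<open>A third label puts \<open>odist\<close> at the covering radius. Then u and w are both at
  least that far from the lattice, hence both are corners of cells, and x and y are grid
  points.\<close>

lemma card_le_2:
  assumes "\<not> (grid x \<and> grid y)" shows "card (nu x y) \<le> 2" "card (nw x y) \<le> 2"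
proof -
  have "grid x \<and> grid y" if "(odist x y)\<^sup>2 = 4 / 3"
    using infdist_lat_sq_le[OF odist_le_infdist(1) that] infdist_lat_sq_le[OF odist_le_infdist(2) that]
    by (intro grid_of_sum_diff) auto
  then show "card (nu x y) \<le> 2" "card (nw x y) \<le> 2"
    using near_card3[OF odist_le_infdist(1)[of x y]] near_card3[OF odist_le_infdist(2)[of x y]] assms
    unfolding nu_def nw_def by force+
qed

lemma grid_eqv: assumes "eqv x x'" "grid x" shows "grid x'"
  using assms(1)
proof (cases rule: eqv_cases)
  case (1 m)
  then show ?thesis using int_lat[of m] assms(2) by (auto simp: grid_def distrib_left intro!: Ints_add Ints_mult)
next
  case (2 m)
  then show ?thesis using int_lat[of m] assms(2) by (auto simp: grid_def right_diff_distrib intro!: Ints_diff Ints_mult)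
qed

lemma closed_grid: "closed {x. grid x}"
proof -
  have e: "{x. grid x} = (\<lambda>z. 6 * pc z) -` \<int> \<inter> (\<lambda>z. 6 * qc z) -` \<int>" by (auto simp: grid_def)
  show ?thesis unfolding e
    by (intro closed_Int closed_vimage closed_Ints continuous_intros)
qed
lemma grid_discrete: assumes "grid x" "grid x'" "dist x x' < 1 / 12" shows "x = x'"
proof -
  have *: "a = b" if "6 * a \<in> \<int>" "6 * b \<in> \<int>" "\<bar>a - b\<bar> < 1 / 6" for a b :: real
  proof -
    have "6 * a - 6 * b \<in> \<int>" using that by (auto intro: Ints_diff)
    moreover have "\<bar>6 * a - 6 * b\<bar> < 1" using that(3) by linarith
    ultimately
    show ?thesis using Ints_nonzero_abs_less1[of "6 * a - 6 * b"] by auto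
  qed
  show ?thesis
    \<comment> \<open>A distance below 1/12 changes each coordinate by less than 1/6, the spacing of
      the grid.\<close>
    by (rule coord_eqI; rule *)
      (use assms coord_le_norm[of "x - x'"] in \<open>auto simp: grid_def dist_norm\<close>)
qed

section \<open>Folding the plane onto the tetrahedron\<close>

text \<open>The triangle wave of period 2 with value 1 at even and -1 at odd integers.\<close>
definition tw :: "real \<Rightarrow> real" where "tw t = 1 - 2 * \<bar>t - 2 * of_int (round (t / 2))\<bar>"

lemma tw_nearest: "\<bar>t - 2 * of_int (round (t / 2))\<bar> \<le> \<bar>t - 2 * of_int k\<bar>"
proof -
  have "\<bar>t / 2 - of_int (round (t / 2))\<bar> \<le> \<bar>t / 2 - of_int k\<bar>" by (rule round_diff_minimal)
  moreover have "\<bar>t - 2 * of_int j\<bar> = 2 * \<bar>t / 2 - of_int j\<bar>" for j :: int by (simp add: abs_if field_simps)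
  ultimately show ?thesis by simp
qed

text \<open>The wave is the upper envelope of the tents 1 - 2|t - 2k|. Its symmetries and estimates
  follow by testing one suitable tent.\<close>

lemma tw_ge: "1 - 2 * \<bar>t - 2 * of_int k\<bar> \<le> tw t"
  using tw_nearest[of t k] by (simp add: tw_def)

lemma tw_lipschitz: "\<bar>tw t - tw u\<bar> \<le> 2 * \<bar>t - u\<bar>"
proof -
  have *: "tw u - tw t \<le> 2 * \<bar>t - u\<bar>" for t u :: real
  proof -
    have "1 - 2 * \<bar>t - 2 * of_int (round (u / 2))\<bar> \<le> tw t" by (rule tw_ge)
    moreover have "\<bar>t - 2 * of_int (round (u / 2))\<bar> \<le> \<bar>t - u\<bar> + \<bar>u - 2 * of_int (round (u / 2))\<bar>" by linarith
    moreover have "1 - 2 * W - x \<le> 2 * D" if "1 - 2 * V \<le> x" "V \<le> D + W" for V W D x :: real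
      using that by linarith
    ultimately show ?thesis unfolding tw_def[of u] by blast
  qed
  show ?thesis using *[of t u] *[of u t] by (simp add: abs_le_iff abs_minus_commute)
qed

lemma tw_base: assumes "\<bar>t\<bar> \<le> 1" shows "tw t = 1 - 2 * \<bar>t\<bar>"
proof (rule antisym)
  show "1 - 2 * \<bar>t\<bar> \<le> tw t" using tw_ge[of t 0] by simp
  have "\<bar>t\<bar> \<le> \<bar>t - 2 * of_int k\<bar>" for k :: int
  proof (cases "k = 0")
    case False
    then have "k \<ge> 1 \<or> k \<le> -1" by auto
    then have "real_of_int k \<ge> 1 \<or> real_of_int k \<le> -1" by linarith
    then show ?thesis using assms by linarith
  qed auto
  from this[of "round (t / 2)"] show "tw t \<le> 1 - 2 * \<bar>t\<bar>" by (simp add: tw_def)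
qed

lemma tw_minus [simp]: "tw (- t) = tw t"
proof -
  have *: "tw t \<le> tw (- t)" for t
    using tw_ge[of "- t" "- round (t / 2)"] unfolding tw_def[of t] by (simp add: abs_if split: if_splits)
  show ?thesis using *[of t] *[of "- t"] by simp
qed

lemma tw_shift [simp]: "tw (t + 2 * of_int k) = tw t"
proof -
  have *: "tw t \<le> tw (t + 2 * of_int k)" for t k
    using tw_ge[of "t + 2 * of_int k" "round (t / 2) + k"] unfolding tw_def[of t] by (simp add: algebra_simps)
  show ?thesis using *[of t k] *[of "t + 2 * of_int k" "- k"] by simp
qed

lemma tw_reduce:
  fixes t :: real obtains k :: int where "\<bar>t - 2 * of_int k\<bar> \<le> 1"
  using of_int_round_abs_le[of "t / 2"] that[of "round (t / 2)"] by (simp add: abs_if field_simps split: if_splits)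

lemma tw_eqE:
  assumes "tw t = tw u"
  obtains k :: int where "u - t = 2 * of_int k" | k :: int where "u + t = 2 * of_int k"
proof -
  obtain i :: int where i: "\<bar>t - 2 * of_int i\<bar> \<le> 1" by (rule tw_reduce)
  obtain j :: int where j: "\<bar>u - 2 * of_int j\<bar> \<le> 1" by (rule tw_reduce)
  have "tw t = 1 - 2 * \<bar>t - 2 * of_int i\<bar>" "tw u = 1 - 2 * \<bar>u - 2 * of_int j\<bar>"
    using tw_base[OF i] tw_base[OF j] tw_shift[of "t - 2 * of_int i" i] tw_shift[of "u - 2 * of_int j" j] by simp_all
  then have "\<bar>t - 2 * of_int i\<bar> = \<bar>u - 2 * of_int j\<bar>" using assms by simp
  then have "u - t = 2 * of_int (j - i) \<or> u + t = 2 * of_int (j + i)" by (auto simp: abs_if split: if_splits)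
  then show ?thesis using that by blast
qed

lemma tw_affine:
  assumes "real_of_int k \<le> t" "t \<le> of_int k + 1" "real_of_int k \<le> u" "u \<le> of_int k + 1"
  shows "\<bar>tw t - tw u\<bar> = 2 * \<bar>t - u\<bar>"
proof -
  have *: "\<bar>tw t - tw u\<bar> = 2 * \<bar>t - u\<bar>" if "0 \<le> t" "t \<le> 1" "0 \<le> u" "u \<le> 1" for t u
    using that by (simp add: tw_base abs_if)
  have **: "\<bar>tw t - tw u\<bar> = 2 * \<bar>t - u\<bar>" if "-1 \<le> t" "t \<le> 0" "-1 \<le> u" "u \<le> 0" for t u
    using that by (simp add: tw_base abs_if)
  show ?thesis
  proof (cases "even k")
    case True
    then obtain i where i: "k = 2 * i" by blast
    then show ?thesis
      using *[of "t + 2 * of_int (- i)" "u + 2 * of_int (- i)"] assms tw_shift[of t "- i"] tw_shift[of u "- i"] by simp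
  next
    case False
    then obtain i where i: "k = 2 * i + 1" by (rule oddE)
    then show ?thesis
      using **[of "t + 2 * of_int (- i - 1)" "u + 2 * of_int (- i - 1)"] assms
        tw_shift[of t "- i - 1"] tw_shift[of u "- i - 1"] by simp
  qed
qed

lemma tw_eqv:
  assumes "eqv x y"
  shows "tw (pc y) = tw (pc x)" "tw (qc y) = tw (qc x)" "tw (pc y + qc y) = tw (pc x + qc x)"
proof -
  have *: "tw (pc (x + m)) = tw (pc x) \<and> tw (qc (x + m)) = tw (qc x) \<and> tw (pc (x + m) + qc (x + m)) = tw (pc x + qc x)"
    if "m \<in> lat" for x m
  proof -
    from that obtain a b :: int where ab: "pc m = 2 * of_int a" "qc m = 2 * of_int b" by (auto elim: latE)
    show ?thesis using tw_shift[of "pc x" a] tw_shift[of "qc x" b] tw_shift[of "pc x + qc x" "a + b"]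
      by (simp add: ab algebra_simps)
  qed
  have "tw (pc y) = tw (pc x) \<and> tw (qc y) = tw (qc x) \<and> tw (pc y + qc y) = tw (pc x + qc x)"
    using assms
  proof (cases rule: eqv_cases)
    case (1 m)
    then show ?thesis using *[of m x] by simp
  next
    case (2 m)
    then have "y = - x + m" by simp
    then show ?thesis using *[OF 2(1), of "- x"] tw_minus[of "pc x + qc x"] by simp
  qed
  then show "tw (pc y) = tw (pc x)" "tw (qc y) = tw (qc x)" "tw (pc y + qc y) = tw (pc x + qc x)" by auto
qed

text \<open>The waves in p and q allow the signs of p and q to change independently, while a
  half-turn changes them together. The third wave, in p + q, excludes a single change except where
  the two points are in one orbit anyway.\<close>

lemma eqv_of_tw:
  assumes tw: "tw (pc x) = tw (pc y)" "tw (qc x) = tw (qc y)" "tw (pc x + qc x) = tw (pc y + qc y)"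
  shows "eqv x y"
proof -
  have *: "eqv x y" if t: "tw (qc x) = tw (qc y)" "tw (pc x + qc x) = tw (pc y + qc y)"
    and a: "pc y - pc x = 2 * of_int m" for y m
  proof -
    have latI: "z \<in> lat" if "pc z = 2 * of_int m" "qc z = 2 * of_int n" for z m n
      using that by (simp add: lat_def)
    consider (c) n :: int where "qc y - qc x = 2 * of_int n" | (d) n :: int where "qc y + qc x = 2 * of_int n"
      using tw_eqE[OF t(1)] by metis
    then show ?thesis
    proof cases
      case (c n)
      then show ?thesis using a latI[of "y - x" m n] by (auto simp: eqv_def)
    next
      case (d n)
      consider (e) k :: int where "(pc y + qc y) - (pc x + qc x) = 2 * of_int k"
        | (f) k :: int where "(pc y + qc y) + (pc x + qc x) = 2 * of_int k"
        using tw_eqE[OF t(2)] by metis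
      then show ?thesis
      proof cases
        case (e k)
        then have "qc y - qc x = 2 * of_int (k - m)" using a by simp
        then show ?thesis using a latI[of "y - x" m "k - m"] by (auto simp: eqv_def)
      next
        case (f k)
        then have "pc y + pc x = 2 * of_int (k - n)" using d by simp
        then show ?thesis using d latI[of "y + x" "k - n" n] by (auto simp: eqv_def)
      qed
    qed
  qed
  consider m :: int where "pc y - pc x = 2 * of_int m" | m :: int where "pc y + pc x = 2 * of_int m"
    using tw_eqE[OF tw(1)] by metis
  then show ?thesis
  proof cases
    case (1 m)
    show ?thesis by (rule *[OF tw(2,3) 1])
  next
    case (2 m)
    have "eqv x (- y)"
      by (rule *[where m = "- m"]) (use tw 2 tw_minus[of "pc y + qc y"] in simp_all)
    then show ?thesis by (rule eqv_trans) (simp add: eqv_def)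
  qed
qed

text \<open>Translations bring both coordinates into [-1, 1], and the half-turn about 0 then makes p
  nonnegative. What remains is four unit triangles, one for each face.\<close>

lemma eqv_fundamental:
  obtains y where "eqv x y" "0 \<le> pc y" "pc y \<le> 1" "\<bar>qc y\<bar> \<le> 1"
proof -
  obtain i :: int where i: "\<bar>pc x - 2 * of_int i\<bar> \<le> 1" by (rule tw_reduce)
  obtain j :: int where j: "\<bar>qc x - 2 * of_int j\<bar> \<le> 1" by (rule tw_reduce)
  define m where "m = pt (2 * of_int i) (2 * of_int j)"
  define y where "y = x - m"
  have m: "m \<in> lat" by (simp add: m_def)
  have y: "\<bar>pc y\<bar> \<le> 1" "\<bar>qc y\<bar> \<le> 1" using i j by (simp_all add: y_def m_def)
  have e: "eqv x y" "eqv x (- y)" using m by (auto simp: eqv_def y_def)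
  show ?thesis
  proof (cases "pc y \<ge> 0")
    case True
    then show ?thesis using that[OF e(1)] y by auto
  next
    case False
    then show ?thesis using that[OF e(2)] y by auto
  qed
qed

lemma convex_hull_3I:
  assumes "0 \<le> u" "0 \<le> v" "0 \<le> w" "u + v + w = 1" "x = u *\<^sub>R a + v *\<^sub>R b + w *\<^sub>R c"
  shows "x \<in> convex hull {a, b, c}"
  unfolding convex_hull_3 using assms by blast

section \<open>The surrounding cube and the map F\<close>

locale tetra =
  fixes a b c d :: "real^3" and s :: real
  assumes s_pos: "s > 0"
    and edges: "dist a b = s" "dist a c = s" "dist a d = s" "dist b c = s" "dist b d = s" "dist c d = s"
begin

definition "T = tetra_surface a b c d"
definition "e1 = (1/4) *\<^sub>R (a + b - c - d)"
definition "e2 = (1/4) *\<^sub>R (a + c - b - d)"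
definition "e3 = (1/4) *\<^sub>R (a + d - b - c)"
definition "ctr = (1/4) *\<^sub>R (a + b + c + d)"

text \<open>In the cube whose alternate vertices are \<open>a, b, c, d\<close>, with axes \<open>e1, e2, e3\<close>, each cube
  coordinate of the folded plane is a triangle wave in one lattice coordinate.\<close>
definition F :: "complex \<Rightarrow> real^3" where
  "F z = ctr + tw (qc z) *\<^sub>R e1 + tw (pc z) *\<^sub>R e2 + tw (pc z + qc z) *\<^sub>R e3"

lemma inner_edges: 
  "(a - d) \<bullet> (a - d) = s\<^sup>2" "(b - d) \<bullet> (b - d) = s\<^sup>2" "(c - d) \<bullet> (c - d) = s\<^sup>2"
  "(a - d) \<bullet> (b - d) = s\<^sup>2 / 2" "(a - d) \<bullet> (c - d) = s\<^sup>2 / 2" "(b - d) \<bullet> (c - d) = s\<^sup>2 / 2"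
proof -
  show 1: "(a - d) \<bullet> (a - d) = s\<^sup>2" "(b - d) \<bullet> (b - d) = s\<^sup>2" "(c - d) \<bullet> (c - d) = s\<^sup>2"
    using edges by (simp_all add: dist_norm power2_norm_eq_inner[symmetric])
  have *: "u \<bullet> v = s\<^sup>2 / 2" if "u \<bullet> u = s\<^sup>2" "v \<bullet> v = s\<^sup>2" "norm (u - v) = s" for u v :: "real^3"
    using that(1,2) dot_norm_neg[of u v] that(3) by (simp add: power2_norm_eq_inner)
  show "(a - d) \<bullet> (b - d) = s\<^sup>2 / 2" "(a - d) \<bullet> (c - d) = s\<^sup>2 / 2" "(b - d) \<bullet> (c - d) = s\<^sup>2 / 2"
    by (rule *[OF 1(1,2)], use edges in \<open>simp add: dist_norm\<close>)
      (rule *[OF 1(1,3)], use edges in \<open>simp add: dist_norm\<close>,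
       rule *[OF 1(2,3)], use edges in \<open>simp add: dist_norm\<close>)
qed

text \<open>The edges of the tetrahedron are face diagonals of the cube, so e1, e2, e3 are pairwise
  orthogonal of length s/(2 sqrt 2). The proof expands in the three edges at d, whose Gram matrix is
  \<open>inner_edges\<close>.\<close>

lemma norm_e: "(norm (\<alpha> *\<^sub>R e1 + \<beta> *\<^sub>R e2 + \<gamma> *\<^sub>R e3))\<^sup>2 = (\<alpha>\<^sup>2 + \<beta>\<^sup>2 + \<gamma>\<^sup>2) * s\<^sup>2 / 8"
proof -
  define A where "A = \<alpha> + \<beta> + \<gamma>"
  define B where "B = \<alpha> - \<beta> - \<gamma>"
  define C where "C = \<beta> - \<alpha> - \<gamma>"
  have e: "\<alpha> *\<^sub>R e1 + \<beta> *\<^sub>R e2 + \<gamma> *\<^sub>R e3 = (1 / 4) *\<^sub>R (A *\<^sub>R (a - d) + B *\<^sub>R (b - d) + C *\<^sub>R (c - d))"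
    unfolding e1_def e2_def e3_def A_def B_def C_def by (simp add: vec_eq_iff field_simps)
  have g: "(x *\<^sub>R u + y *\<^sub>R v + z *\<^sub>R w) \<bullet> (x *\<^sub>R u + y *\<^sub>R v + z *\<^sub>R w)
      = x\<^sup>2 * (u \<bullet> u) + y\<^sup>2 * (v \<bullet> v) + z\<^sup>2 * (w \<bullet> w)
        + 2 * (x * y * (u \<bullet> v) + x * z * (u \<bullet> w) + y * z * (v \<bullet> w))"
    for x y z :: real and u v w :: "real^3"
    by (simp add: inner_add_left inner_add_right inner_commute[of v u] inner_commute[of w u] inner_commute[of w v]
        power2_eq_square algebra_simps)
  have "(norm (A *\<^sub>R (a - d) + B *\<^sub>R (b - d) + C *\<^sub>R (c - d)))\<^sup>2 = (A\<^sup>2 + B\<^sup>2 + C\<^sup>2 + A * B + A * C + B * C) * s\<^sup>2"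
    unfolding power2_norm_eq_inner g inner_edges by (simp add: algebra_simps)
  also have "A\<^sup>2 + B\<^sup>2 + C\<^sup>2 + A * B + A * C + B * C = 2 * (\<alpha>\<^sup>2 + \<beta>\<^sup>2 + \<gamma>\<^sup>2)"
    unfolding A_def B_def C_def by (simp add: power2_eq_square algebra_simps)
  finally show ?thesis
    unfolding e norm_scaleR power_mult_distrib by (simp add: power2_eq_square)
qed

lemma dist_F_sq:
  "(dist (F x) (F y))\<^sup>2 = ((tw (qc x) - tw (qc y))\<^sup>2 + (tw (pc x) - tw (pc y))\<^sup>2
     + (tw (pc x + qc x) - tw (pc y + qc y))\<^sup>2) * s\<^sup>2 / 8"
proof -
  have "F x - F y = (tw (qc x) - tw (qc y)) *\<^sub>R e1 + (tw (pc x) - tw (pc y)) *\<^sub>R e2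
     + (tw (pc x + qc x) - tw (pc y + qc y)) *\<^sub>R e3"
    unfolding F_def by (simp add: algebra_simps)
  then show ?thesis unfolding dist_norm by (simp only: norm_e)
qed

lemma F_eq_iff: "F x = F y \<longleftrightarrow> eqv x y"
proof
  assume "F x = F y"
  then have "((tw (qc x) - tw (qc y))\<^sup>2 + (tw (pc x) - tw (pc y))\<^sup>2
     + (tw (pc x + qc x) - tw (pc y + qc y))\<^sup>2) = 0" (is "?a + ?b + ?c = 0")
    using dist_F_sq[of x y] s_pos by simp
  moreover have "?a \<ge> 0" "?b \<ge> 0" "?c \<ge> 0" by simp_all
  ultimately have "?a = 0" "?b = 0" "?c = 0" by linarith+
  then show "eqv x y" by (intro eqv_of_tw) auto
next
  assume "eqv x y"
  then show "F x = F y" unfolding F_def by (simp add: tw_eqv)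
qed

text \<open>\<open>p^2 + p q + q^2\<close> is half of \<open>p^2 + q^2 + (p + q)^2\<close>. As the
  waves have slopes 2 and -2, folding multiplies lengths by exactly s wherever no wave turns, and by
  at most s in general.\<close>

lemma norm_sq_sym: "8 * (dist x y)\<^sup>2 = (2 * (qc x - qc y))\<^sup>2 + (2 * (pc x - pc y))\<^sup>2 + (2 * (pc x + qc x - (pc y + qc y)))\<^sup>2"
  unfolding dist_norm norm_coord by (simp add: power2_eq_square algebra_simps)

lemma F_lipschitz: "dist (F x) (F y) \<le> s * dist x y"
proof -
  have *: "(tw t - tw u)\<^sup>2 \<le> (2 * (t - u))\<^sup>2" for t u
    using tw_lipschitz[of t u] abs_mult[of 2 "t - u"] abs_le_square_iff[of "tw t - tw u" "2 * (t - u)"] by simp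
  have "(dist (F x) (F y))\<^sup>2 \<le> (8 * (dist x y)\<^sup>2) * s\<^sup>2 / 8"
    unfolding dist_F_sq norm_sq_sym by (intro divide_right_mono mult_right_mono add_mono *) auto
  then have "(dist (F x) (F y))\<^sup>2 \<le> (s * dist x y)\<^sup>2" by (simp add: power_mult_distrib mult.commute)
  then show ?thesis by (rule power2_le_imp_le) (use s_pos in auto)
qed

lemma F_isometry:
  assumes "real_of_int i \<le> pc x" "pc x \<le> of_int i + 1" "real_of_int i \<le> pc y" "pc y \<le> of_int i + 1"
    "real_of_int j \<le> qc x" "qc x \<le> of_int j + 1" "real_of_int j \<le> qc y" "qc y \<le> of_int j + 1"
    "real_of_int k \<le> pc x + qc x" "pc x + qc x \<le> of_int k + 1" "real_of_int k \<le> pc y + qc y" "pc y + qc y \<le> of_int k + 1"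
  shows "dist (F x) (F y) = s * dist x y"
proof -
  have *: "(tw t - tw u)\<^sup>2 = (2 * (t - u))\<^sup>2" if "\<bar>tw t - tw u\<bar> = 2 * \<bar>t - u\<bar>" for t u
    using that by (metis abs_mult abs_numeral power2_abs)
  have "(dist (F x) (F y))\<^sup>2 = (8 * (dist x y)\<^sup>2) * s\<^sup>2 / 8"
    unfolding dist_F_sq norm_sq_sym
    using *[OF tw_affine[OF assms(1-4)]] *[OF tw_affine[OF assms(5-8)]] *[OF tw_affine[OF assms(9-12)]] by simp
  then have "(dist (F x) (F y))\<^sup>2 = (s * dist x y)\<^sup>2" by (simp add: power_mult_distrib)
  then show ?thesis by (rule power2_eq_imp_eq) (use s_pos in auto)
qed

text \<open>On lattice points, (0,0) folds to a, (1,0) to b, (0,1) and (0,-1) to c, (1,1) and (1,-1)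
  to d. The four triangles with these corners fill the parallelogram of
  \<open>eqv_fundamental\<close>.\<close>

lemma faces:
  "\<lbrakk>0 \<le> p; 0 \<le> q; p + q \<le> 1\<rbrakk> \<Longrightarrow> F (pt p q) = (1 - p - q) *\<^sub>R a + p *\<^sub>R b + q *\<^sub>R c"
  "\<lbrakk>0 \<le> p; q \<le> 0; 0 \<le> p + q; p \<le> 1\<rbrakk> \<Longrightarrow> F (pt p q) = (1 - p) *\<^sub>R a + (p + q) *\<^sub>R b + (- q) *\<^sub>R d"
  "\<lbrakk>0 \<le> p; - 1 \<le> q; p + q \<le> 0\<rbrakk> \<Longrightarrow> F (pt p q) = (1 + q) *\<^sub>R a + (- p - q) *\<^sub>R c + p *\<^sub>R d"
  "\<lbrakk>p \<le> 1; q \<le> 1; 1 \<le> p + q\<rbrakk> \<Longrightarrow> F (pt p q) = (1 - q) *\<^sub>R b + (1 - p) *\<^sub>R c + (p + q - 1) *\<^sub>R d"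
proof -
  have F: "F (pt p q) = ctr + tw q *\<^sub>R e1 + tw p *\<^sub>R e2 + tw (p + q) *\<^sub>R e3" by (simp add: F_def)
  {
    assume "0 \<le> p" "0 \<le> q" "p + q \<le> 1"
    then have t: "tw q = 1 - 2 * q" "tw p = 1 - 2 * p" "tw (p + q) = 1 - 2 * (p + q)" by (simp_all add: tw_base)
    then show "F (pt p q) = (1 - p - q) *\<^sub>R a + p *\<^sub>R b + q *\<^sub>R c"
      unfolding F t ctr_def e1_def e2_def e3_def by (simp add: vec_eq_iff field_simps)
  next
    assume "0 \<le> p" "q \<le> 0" "0 \<le> p + q" "p \<le> 1"
    then have t: "tw q = 1 + 2 * q" "tw p = 1 - 2 * p" "tw (p + q) = 1 - 2 * (p + q)" by (simp_all add: tw_base)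
    then show "F (pt p q) = (1 - p) *\<^sub>R a + (p + q) *\<^sub>R b + (- q) *\<^sub>R d"
      unfolding F t ctr_def e1_def e2_def e3_def by (simp add: vec_eq_iff field_simps)
  next
    assume "0 \<le> p" "- 1 \<le> q" "p + q \<le> 0"
    then have t: "tw q = 1 + 2 * q" "tw p = 1 - 2 * p" "tw (p + q) = 1 + 2 * (p + q)" by (simp_all add: tw_base)
    then show "F (pt p q) = (1 + q) *\<^sub>R a + (- p - q) *\<^sub>R c + p *\<^sub>R d"
      unfolding F t ctr_def e1_def e2_def e3_def by (simp add: vec_eq_iff field_simps)
  next
    assume h: "p \<le> 1" "q \<le> 1" "1 \<le> p + q"
    then have t: "tw q = 1 - 2 * q" "tw p = 1 - 2 * p" by (simp_all add: tw_base)
    have t': "tw (p + q) = 2 * (p + q) - 3"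
      using h tw_shift[of "p + q - 2" 1] tw_base[of "p + q - 2"] by simp
    show "F (pt p q) = (1 - q) *\<^sub>R b + (1 - p) *\<^sub>R c + (p + q - 1) *\<^sub>R d"
      unfolding F t t' ctr_def e1_def e2_def e3_def by (simp add: vec_eq_iff field_simps)
  }
qed

definition faces_set :: "(real^3) set set" where
  "faces_set = {convex hull {a,b,c}, convex hull {a,b,d}, convex hull {a,c,d}, convex hull {b,c,d}}"

lemma T_faces: "T = \<Union> faces_set" by (auto simp: T_def tetra_surface_def faces_set_def)

lemma finite_faces: "finite faces_set" by (simp add: faces_set_def)

lemma closed_face: "f \<in> faces_set \<Longrightarrow> closed f"
  by (auto simp: faces_set_def intro!: compact_imp_closed finite_imp_compact_convex_hull)

text \<open>Isolates what the four faces share: \<open>g\<close> turns barycentric weights into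
  points of a plane triangle on which \<open>F\<close> is affine and scales distances by s.\<close>

lemma hull_isometry:
  assumes "\<And>u v w. \<lbrakk>0 \<le> u; 0 \<le> v; 0 \<le> w; u + v + w = 1\<rbrakk> \<Longrightarrow> F (g u v w) = u *\<^sub>R p + v *\<^sub>R q + w *\<^sub>R r"
    and "\<And>u v w u' v' w'. \<lbrakk>0 \<le> u; 0 \<le> v; 0 \<le> w; u + v + w = 1; 0 \<le> u'; 0 \<le> v'; 0 \<le> w'; u' + v' + w' = 1\<rbrakk>
      \<Longrightarrow> dist (F (g u v w)) (F (g u' v' w')) = s * dist (g u v w) (g u' v' w')"
    and "P \<in> convex hull {p, q, r}" "Q \<in> convex hull {p, q, r}"
  shows "\<exists>x y. F x = P \<and> F y = Q \<and> s * dist x y = dist P Q"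
proof -
  obtain u v w where P: "0 \<le> u" "0 \<le> v" "0 \<le> w" "u + v + w = 1" "P = u *\<^sub>R p + v *\<^sub>R q + w *\<^sub>R r"
    using assms(3) unfolding convex_hull_3 by auto
  obtain u' v' w' where Q: "0 \<le> u'" "0 \<le> v'" "0 \<le> w'" "u' + v' + w' = 1" "Q = u' *\<^sub>R p + v' *\<^sub>R q + w' *\<^sub>R r"
    using assms(4) unfolding convex_hull_3 by auto
  show ?thesis using assms(1)[OF P(1-4)] assms(1)[OF Q(1-4)] assms(2)[OF P(1-4) Q(1-4)] P(5) Q(5) by metis
qed

lemma face_isometry:
  assumes "f \<in> faces_set" "P \<in> f" "Q \<in> f"
  shows "\<exists>x y. F x = P \<and> F y = Q \<and> s * dist x y = dist P Q"
proof -
  consider "f = convex hull {a,b,c}" | "f = convex hull {a,b,d}" | "f = convex hull {a,c,d}" | "f = convex hull {b,c,d}"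
    using assms(1) by (auto simp: faces_set_def)
  then show ?thesis
  proof cases
    case 1
    show ?thesis
    proof (rule hull_isometry[OF _ _ assms(2,3)[unfolded 1]])
      show "F (pt v w) = u *\<^sub>R a + v *\<^sub>R b + w *\<^sub>R c" if "0 \<le> u" "0 \<le> v" "0 \<le> w" "u + v + w = 1" for u v w
      proof -
        have e: "u = 1 - v - w" using that by simp
        show ?thesis unfolding e using faces(1)[of v w] that by simp
      qed
    qed (rule F_isometry[where i=0 and j=0 and k=0]; simp)
  next
    case 2
    show ?thesis
    proof (rule hull_isometry[OF _ _ assms(2,3)[unfolded 2]])
      show "F (pt (v + w) (- w)) = u *\<^sub>R a + v *\<^sub>R b + w *\<^sub>R d" if "0 \<le> u" "0 \<le> v" "0 \<le> w" "u + v + w = 1" for u v w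
      proof -
        have e: "u = 1 - (v + w)" using that by simp
        show ?thesis unfolding e using faces(2)[of "v + w" "- w"] that by simp
      qed
    qed (rule F_isometry[where i=0 and j="-1" and k=0]; simp)
  next
    case 3
    show ?thesis
    proof (rule hull_isometry[OF _ _ assms(2,3)[unfolded 3]])
      show "F (pt w (- v - w)) = u *\<^sub>R a + v *\<^sub>R c + w *\<^sub>R d" if "0 \<le> u" "0 \<le> v" "0 \<le> w" "u + v + w = 1" for u v w
      proof -
        have e: "u = 1 + (- v - w)" using that by simp
        show ?thesis unfolding e using faces(3)[of w "- v - w"] that by simp
      qed
    qed (rule F_isometry[where i=0 and j="-1" and k="-1"]; simp)
  next
    case 4
    show ?thesis
    proof (rule hull_isometry[OF _ _ assms(2,3)[unfolded 4]])
      show "F (pt (1 - v) (1 - u)) = u *\<^sub>R b + v *\<^sub>R c + w *\<^sub>R d" if "0 \<le> u" "0 \<le> v" "0 \<le> w" "u + v + w = 1" for u v w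
      proof -
        have e: "w = (1 - v) + (1 - u) - 1" using that by simp
        show ?thesis unfolding e using faces(4)[of "1 - v" "1 - u"] that by simp
      qed
    qed (rule F_isometry[where i=0 and j=0 and k=1]; simp)
  qed
qed

lemma range_F: "range F = T"
proof
  show "T \<subseteq> range F" unfolding T_faces using face_isometry by (metis UnionE rangeI subsetI)
  show "range F \<subseteq> T"
  proof (rule image_subsetI)
    fix x
    obtain y where y: "eqv x y" "0 \<le> pc y" "pc y \<le> 1" "\<bar>qc y\<bar> \<le> 1" by (rule eqv_fundamental)
    define p where "p = pc y"
    define q where "q = qc y"
    have "F x = F (pt p q)" 
    proof -
      have "y = pt p q" by (rule coord_eqI) (simp_all add: p_def q_def)
      then show ?thesis using y(1) by (simp add: F_eq_iff)
    qed
    moreover have "F (pt p q) \<in> T"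
    proof -
      have h: "0 \<le> p" "p \<le> 1" "q \<le> 1" "- 1 \<le> q" using y unfolding p_def q_def by auto
      have hull: "P \<in> T" if "P \<in> f" "f \<in> faces_set" for P f using that unfolding T_faces by blast
      consider "0 \<le> q" "p + q \<le> 1" | "q \<le> 0" "0 \<le> p + q" | "p + q \<le> 0" | "0 \<le> q" "1 \<le> p + q"
        by linarith
      then show ?thesis
      proof cases
        case 1
        then show ?thesis
          by (intro hull[of _ "convex hull {a,b,c}"] convex_hull_3I[OF _ _ _ _ faces(1)])
            (use h in \<open>auto simp: faces_set_def\<close>)
      next
        case 2
        then show ?thesis
          by (intro hull[of _ "convex hull {a,b,d}"] convex_hull_3I[OF _ _ _ _ faces(2)])
            (use h in \<open>auto simp: faces_set_def\<close>)
      next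
        case 3
        then show ?thesis
          by (intro hull[of _ "convex hull {a,c,d}"] convex_hull_3I[OF _ _ _ _ faces(3)])
            (use h in \<open>auto simp: faces_set_def\<close>)
      next
        case 4
        then show ?thesis
          by (intro hull[of _ "convex hull {b,c,d}"] convex_hull_3I[OF _ _ _ _ faces(4)])
            (use h in \<open>auto simp: faces_set_def\<close>)
      qed
    qed
    ultimately show "F x \<in> T" by simp
  qed
qed

end

section \<open>The intrinsic metric and lifts of geodesics\<close>

lemma dist_linepath: "dist (linepath x y t) (linepath x y u) = \<bar>t - u\<bar> * dist x y"
proof -
  have "linepath x y t - linepath x y u = (u - t) *\<^sub>R (x - y)"
    by (simp add: linepath_def algebra_simps)
  then show ?thesis unfolding dist_norm by (simp add: abs_minus_commute)
qed

text \<open>The group element carrying x to x' is an isometry and takes the whole segment along.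
  Thus one endpoint of a lifted segment may be prescribed.\<close>

lemma eqv_transport:
  assumes "eqv x x'"
  obtains y' where "eqv y y'" "dist x' y' = dist x y" "\<And>t. eqv (linepath x y t) (linepath x' y' t)"
  using assms
proof (cases rule: eqv_cases)
  case (1 m)
  have "linepath x' (y + m) t - linepath x y t = m" for t by (simp add: 1 linepath_def algebra_simps)
  then have "eqv (linepath x y t) (linepath x' (y + m) t)" for t by (simp add: eqv_def 1)
  then show ?thesis using that[of "y + m"] 1 by (simp add: eqv_def dist_norm)
next
  case (2 m)
  have "linepath x' (m - y) t + linepath x y t = m" for t by (simp add: 2 linepath_def algebra_simps)
  then have "eqv (linepath x y t) (linepath x' (m - y) t)" for t by (simp add: eqv_def 2)
  then show ?thesis using that[of "m - y"] 2 by (simp add: eqv_def dist_norm norm_minus_commute)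
qed

lemma odist_attained: obtains x' where "eqv x x'" "dist x' y = odist x y"
proof -
  consider l where "l \<in> nu x y" | l where "l \<in> nw x y" using ties_nonempty[of x y] by blast
  then show ?thesis
  proof cases
    case 1
    then have "eqv x (x + l)" "dist (x + l) y = odist x y"
      by (simp_all add: nu_def near_def eqv_def dist_norm norm_minus_commute[of _ y] diff_diff_eq)
    then show ?thesis by (rule that)
  next
    case 2
    have "(l - x) - y = - (y + x - l)" by simp
    then have "dist (l - x) y = norm (y + x - l)" unfolding dist_norm by (simp only: norm_minus_cancel)
    then have "eqv x (l - x)" "dist (l - x) y = odist x y" using 2 by (simp_all add: nw_def near_def eqv_def)
    then show ?thesis by (rule that)
  qed
qed

lemma odist_le_dist: "odist x y \<le> dist x y" using odist_le_norm[of x y] by (simp add: dist_norm norm_minus_commute)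

lemma odist_zero_iff: "odist x y = 0 \<longleftrightarrow> eqv x y"
proof
  assume "odist x y = 0"
  moreover obtain x' where "eqv x x'" "dist x' y = odist x y" by (rule odist_attained)
  ultimately show "eqv x y" by simp
next
  assume "eqv x y"
  then have "odist x y = odist y y" using odist_eqv[of x y y y] by simp
  then show "odist x y = 0" using odist_le_dist[of y y] odist_nonneg[of y y] by simp
qed

text \<open>With y fixed, x and z may both be replaced by the points of their orbits nearest to y,
  and the Euclidean triangle inequality applies.\<close>

lemma odist_triangle: "odist x z \<le> odist x y + odist y z"
proof -
  obtain x' where x': "eqv x x'" "dist x' y = odist x y" by (rule odist_attained)
  obtain z' where z': "eqv z z'" "dist z' y = odist z y" by (rule odist_attained)
  have "odist x z = odist x' z'" using odist_eqv[OF x'(1) z'(1)] by simp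
  also have "\<dots> \<le> dist x' z'" by (rule odist_le_dist)
  also have "\<dots> \<le> dist x' y + dist z' y" by (metis dist_triangle2)
  finally show ?thesis using x' z' by (simp add: odist_commute)
qed

section \<open>Unfolding paths and computing the intrinsic metric\<close>

context tetra
begin

lemma face_lift:
  assumes "f \<in> faces_set" "F x \<in> f" "Q \<in> f"
  obtains y where "F y = Q" "s * dist x y = dist (F x) Q"
proof -
  obtain x' y' where xy: "F x' = F x" "F y' = Q" "s * dist x' y' = dist (F x) Q"
    using face_isometry[OF assms] by auto
  obtain y where "eqv y' y" "dist x y = dist x' y'"
    using eqv_transport[of x' x y'] xy(1) F_eq_iff by metis
  then show ?thesis using that[of y] xy F_eq_iff by metis
qed

text \<open>Leaving each face at the last time it is visited cuts a path into boundedly many steps, each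
  with both ends in one face; such steps lift to the plane without stretching.\<close>
lemma path_chain:
  fixes u :: real
  assumes "finite \<F>" "\<F> \<subseteq> faces_set" "continuous_on {u..1} g" "u \<le> 1" "g ` {u..1} \<subseteq> \<Union>\<F>" "F x = g u"
  shows "\<exists>n t y. t 0 = u \<and> t n = 1 \<and> (\<forall>i<n. t i \<le> t (Suc i)) \<and> F y = g 1 \<and>
    s * dist x y \<le> (\<Sum>i<n. dist (g (t i)) (g (t (Suc i))))"
  using assms
proof (induction \<F> arbitrary: u x rule: finite_psubset_induct)
  case (psubset \<F>)
  have "u \<in> {u..1}" using psubset.prems(3) by simp
  then have "g u \<in> \<Union>\<F>" using psubset.prems(4) by blast
  then obtain f where f: "f \<in> \<F>" "g u \<in> f" by blast
  then have cf: "closed f" using closed_face psubset.prems by auto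
  define K where "K = {u..1} \<inter> g -` f"
  have "closed K" unfolding K_def
    by (rule continuous_closed_preimage[OF psubset.prems(2) _ cf]) simp
  moreover have "bounded K" by (rule bounded_subset[OF bounded_closed_interval[of u 1]]) (auto simp: K_def)
  ultimately have "compact K" by (simp add: compact_eq_bounded_closed)
  moreover have "u \<in> K" using f psubset.prems by (auto simp: K_def)
  ultimately obtain v where v: "v \<in> K" "\<And>w. w \<in> K \<Longrightarrow> w \<le> v"
    using compact_attains_sup[of K] by auto
  obtain y1 where y1: "F y1 = g v" "s * dist x y1 = dist (g u) (g v)"
    using face_lift[of f x "g v"] f v(1) psubset.prems by (auto simp: K_def)
  have uv: "u \<le> v" "v \<le> 1" using v(1) by (auto simp: K_def)
  show ?case
  proof (cases "v = 1")
    case True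
    then show ?thesis
      by (intro exI[of _ 1] exI[of _ "\<lambda>i. if i = 0 then u else 1"] exI[of _ y1])
        (use y1 uv in auto)
  next
    case False
    have rest: "g w \<in> \<Union>(\<F> - {f})" if "w \<in> {v<..1}" for w
    proof -
      have "w \<notin> K" using v(2)[of w] that by auto
      moreover have "w \<in> {u..1}" using that uv by auto
      ultimately have "g w \<notin> f" by (auto simp: K_def)
      moreover have "g w \<in> \<Union>\<F>" using psubset.prems(4) \<open>w \<in> {u..1}\<close> by blast
      ultimately show ?thesis by auto
    qed
    have cv: "continuous_on {v..1} g" by (rule continuous_on_subset[OF psubset.prems(2)]) (use uv in auto)
    \<comment> \<open>After time v the path stays in the other faces. Their union is closed, so the
      point at time v lies in it as well, and the induction hypothesis applies on all of
      [v, 1].\<close>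
    have "closed (\<Union>(\<F> - {f}))"
      using psubset.hyps psubset.prems(1) closed_face by (intro closed_Union) auto
    then have "closed ({v..1} \<inter> g -` \<Union>(\<F> - {f}))"
      by (intro continuous_closed_preimage[OF cv]) auto
    moreover have "{v<..1} \<subseteq> {v..1} \<inter> g -` \<Union>(\<F> - {f})" using rest by auto
    ultimately have "closure {v<..1} \<subseteq> {v..1} \<inter> g -` \<Union>(\<F> - {f})" by (rule closure_minimal[rotated])
    moreover have "closure {v<..1} = {v..1}" using False uv by (intro closure_greaterThanAtMost) auto
    ultimately have im: "g ` {v..1} \<subseteq> \<Union>(\<F> - {f})" by auto
    have sub: "\<F> - {f} \<subset> \<F>" "\<F> - {f} \<subseteq> faces_set" using f(1) psubset.prems(1) by auto
    obtain n t y where IH: "t 0 = v" "t n = 1" "\<forall>i<n. t i \<le> t (Suc i)" "F y = g 1"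
      "s * dist y1 y \<le> (\<Sum>i<n. dist (g (t i)) (g (t (Suc i))))"
      using psubset.IH[OF sub(1) sub(2) cv uv(2) im y1(1)] by blast
    define t' where "t' = (\<lambda>i. case i of 0 \<Rightarrow> u | Suc j \<Rightarrow> t j)"
    have t': "t' 0 = u" "\<And>j. t' (Suc j) = t j" by (simp_all add: t'_def)
    have "s * dist x y \<le> s * dist x y1 + s * dist y1 y"
      using s_pos dist_triangle[of x y y1] by (simp flip: distrib_left)
    also have "\<dots> \<le> (\<Sum>i<Suc n. dist (g (t' i)) (g (t' (Suc i))))"
      unfolding sum.lessThan_Suc_shift using IH y1 by (simp add: t')
    finally have "s * dist x y \<le> (\<Sum>i<Suc n. dist (g (t' i)) (g (t' (Suc i))))" .
    moreover have "\<forall>i<Suc n. t' i \<le> t' (Suc i)"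
    proof (intro allI impI)
      fix i assume "i < Suc n"
      then show "t' i \<le> t' (Suc i)" using IH(1,3) uv by (cases i) (auto simp: t')
    qed
    ultimately show ?thesis using IH t' by (intro exI[of _ "Suc n"] exI[of _ t'] exI[of _ y]) auto
  qed
qed

lemma continuous_on_F: "continuous_on A F"
proof (rule continuous_onI)
  fix x e assume "(e::real) > 0"
  have "dist (F x') (F x) \<le> e" if "dist x' x < e / s" for x'
  proof -
    have "s * dist x' x \<le> e" using that s_pos by (simp add: field_simps)
    then show ?thesis using F_lipschitz[of x' x] by linarith
  qed
  moreover have "e / s > 0" using \<open>e > 0\<close> s_pos by simp
  ultimately show "\<exists>d>0. \<forall>x'\<in>A. dist x' x < d \<longrightarrow> dist (F x') (F x) \<le> e" by blast
qed

lemma F_linepath_sums: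
  assumes "S \<in> partition_sums (F \<circ> linepath x y)" shows "S \<le> s * dist x y"
proof -
  obtain n t where t: "S = (\<Sum>i<n. dist (F (linepath x y (t i))) (F (linepath x y (t (Suc i)))))"
    "t 0 = 0" "t n = 1" "\<forall>i<n. t i \<le> t (Suc i)"
    using assms unfolding partition_sums_def by auto
  have "S \<le> (\<Sum>i<n. (t (Suc i) - t i) * (s * dist x y))"
    unfolding t(1)
  proof (rule sum_mono)
    fix i assume "i \<in> {..<n}"
    then have "t i \<le> t (Suc i)" using t(4) by auto
    then show "dist (F (linepath x y (t i))) (F (linepath x y (t (Suc i)))) \<le> (t (Suc i) - t i) * (s * dist x y)"
      using F_lipschitz[of "linepath x y (t i)" "linepath x y (t (Suc i))"] by (simp add: dist_linepath mult_ac)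
  qed
  also have "\<dots> = (\<Sum>i<n. t (Suc i) - t i) * (s * dist x y)" by (simp add: sum_distrib_right)
  also have "(\<Sum>i<n. t (Suc i) - t i) = 1" by (simp add: sum_lessThan_telescope t)
  finally show ?thesis by simp
qed

lemma partition_sum_chord: "dist (g 0) (g 1) \<in> partition_sums g"
  unfolding partition_sums_def
  by (rule CollectI, intro exI[of _ 1] exI[of _ "\<lambda>i. if i = 0 then 0 else 1"]) auto

text \<open>The chain given by \<open>path_chain\<close> uses a partition of [0, 1], so its length
  is bounded by a partition sum of g. Its end is merely some lift of F y, which is all that
  \<open>odist\<close> sees.\<close>

lemma plength_ge:
  assumes "path g" "path_image g \<subseteq> T" "pathstart g = F x" "pathfinish g = F y" "rectifiable g"
  shows "s * odist x y \<le> plength g"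
proof -
  obtain n t y' where h: "t 0 = 0" "t n = 1" "\<forall>i<n. t i \<le> t (Suc i)" "F y' = g 1"
    "s * dist x y' \<le> (\<Sum>i<n. dist (g (t i)) (g (t (Suc i))))"
    using path_chain[of faces_set 0 g x] assms finite_faces
    by (auto simp: path_def path_image_def pathstart_def T_faces)
  have "F y' = F y" using assms(4) h(4) by (simp add: pathfinish_def)
  then have "odist x y = odist x y'" using odist_eqv[of x x y' y] by (simp add: F_eq_iff)
  then have "s * odist x y \<le> s * dist x y'" using s_pos odist_le_dist[of x y'] by simp
  also have "\<dots> \<le> (\<Sum>i<n. dist (g (t i)) (g (t (Suc i))))" by (rule h)
  also have "\<dots> \<le> plength g" unfolding plength_def
    by (rule cSup_upper) (use h assms(5) in \<open>auto simp: partition_sums_def rectifiable_def\<close>)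
  finally show ?thesis .
qed

text \<open>Unfolding shows that no path beats the orbit distance; folding the straight segment from
  the nearest lift attains it.\<close>

lemma idist_F: "idist T (F x) (F y) = s * odist x y"
proof (rule antisym)
  let ?L = "\<lambda>x y. {plength g | g. path g \<and> path_image g \<subseteq> T \<and> pathstart g = F x \<and> pathfinish g = F y \<and> rectifiable g}"
  have lower: "\<And>L. L \<in> ?L x y \<Longrightarrow> s * odist x y \<le> L" for x y using plength_ge by auto
  have mem: "plength (F \<circ> linepath x y) \<in> ?L x y \<and> plength (F \<circ> linepath x y) \<le> s * dist x y" for x y
  proof -
    have ne: "partition_sums (F \<circ> linepath x y) \<noteq> {}" using partition_sum_chord by blast
    have "rectifiable (F \<circ> linepath x y)" unfolding rectifiable_def
      by (rule bdd_aboveI[of _ "s * dist x y"]) (rule F_linepath_sums)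
    moreover have "path (F \<circ> linepath x y)" by (rule path_continuous_image) (auto intro: continuous_on_F)
    moreover have "path_image (F \<circ> linepath x y) \<subseteq> T" using range_F by (auto simp: path_image_compose)
    moreover have "plength (F \<circ> linepath x y) \<le> s * dist x y"
      unfolding plength_def by (rule cSup_least[OF ne]) (rule F_linepath_sums)
    ultimately show ?thesis by (auto simp: pathstart_compose pathfinish_compose)
  qed
  obtain x' where x': "eqv x x'" "dist x' y = odist x y" by (rule odist_attained)
  have "?L x y = ?L x' y" using x'(1) by (simp add: F_eq_iff[THEN iffD2])
  then have "idist T (F x) (F y) = Inf (?L x' y)" unfolding idist_def by simp
  also have "\<dots> \<le> plength (F \<circ> linepath x' y)"
  proof (rule cInf_lower)
    show "plength (F \<circ> linepath x' y) \<in> ?L x' y" using mem by blast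
    show "bdd_below (?L x' y)" by (rule bdd_belowI[of _ "s * odist x' y"]) (rule lower)
  qed
  also have "\<dots> \<le> s * odist x y" using mem[of x' y] x' by simp
  finally show "idist T (F x) (F y) \<le> s * odist x y" .
  show "s * odist x y \<le> idist T (F x) (F y)"
    unfolding idist_def
  proof (rule cInf_greatest)
    show "?L x y \<noteq> {}" using mem by blast
  qed (rule lower)
qed

lemma TE: assumes "P \<in> T" obtains x where "P = F x" using assms range_F by auto

lemma F_in_T [simp]: "F x \<in> T" using range_F by auto

text \<open>\<open>Metric_space\<close> demands symmetry at all points. Outside T both sides are the
  infimum of the empty set, hence equal.\<close>

lemma idist_commute: "idist T P Q = idist T Q P"
proof (cases "P \<in> T \<and> Q \<in> T")
  case True
  then obtain x y where "P = F x" "Q = F y" by (metis TE)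
  then show ?thesis by (simp add: idist_F odist_commute)
next
  case False
  have "\<not> (path_image g \<subseteq> T \<and> pathstart g = P \<and> pathfinish g = Q)"
       "\<not> (path_image g \<subseteq> T \<and> pathstart g = Q \<and> pathfinish g = P)" for g
    using False pathstart_in_path_image[of g] pathfinish_in_path_image[of g] by blast+
  then show ?thesis unfolding idist_def by (intro arg_cong[of _ _ Inf]) blast
qed

lemma near_lift:
  assumes "idist T (F x') (F x) < s * \<delta>"
  obtains x'' where "eqv x' x''" "dist x'' x < \<delta>"
proof -
  obtain x'' where "eqv x' x''" "dist x'' x = odist x' x" by (rule odist_attained)
  then show ?thesis using that[of x''] assms s_pos by (simp add: idist_F)
qed

lemma idist_le: "idist T (F x) (F y) \<le> s * dist x y"
  using odist_le_dist[of x y] s_pos by (simp add: idist_F)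

text \<open>No part of the segment can be shortened: by the triangle inequality, a shortcut between
  two of its points would make x and y closer than \<open>odist x y\<close>.\<close>

lemma geodesic_lift:
  assumes "dist x y = odist x y" shows "min_geodesic T (F x) (F y) (\<lambda>t. F (linepath x y t))"
proof -
  let ?l = "linepath x y"
  have le: "odist (?l t) (?l u) = \<bar>t - u\<bar> * odist x y" if "t \<in> {0..1}" "u \<in> {0..1}" "t \<le> u" for t u
  proof (rule antisym)
    show "odist (?l t) (?l u) \<le> \<bar>t - u\<bar> * odist x y"
      using odist_le_dist[of "?l t" "?l u"] by (simp add: dist_linepath assms)
    have "odist x y \<le> odist x (?l t) + odist (?l t) (?l u) + odist (?l u) y"
      using odist_triangle[of x y "?l u"] odist_triangle[of x "?l u" "?l t"] by simp
    moreover have "odist x (?l t) \<le> t * odist x y"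
      using odist_le_dist[of x "?l t"] dist_linepath[of x y 0 t] that assms by (simp add: linepath_0')
    moreover have "odist (?l u) y \<le> (1 - u) * odist x y"
      using odist_le_dist[of "?l u" y] dist_linepath[of x y u 1] that assms by (simp add: linepath_1')
    ultimately show "\<bar>t - u\<bar> * odist x y \<le> odist (?l t) (?l u)" using that by (simp add: algebra_simps)
  qed
  have "odist (?l t) (?l u) = \<bar>t - u\<bar> * odist x y" if "t \<in> {0..1}" "u \<in> {0..1}" for t u
    using le[of t u] le[of u t] that by (metis odist_commute abs_minus_commute linear)
  then show ?thesis unfolding min_geodesic_def using range_F
    by (auto simp: idist_F linepath_0' linepath_1')
qed

text \<open>A rule is given by a relation R selecting lifts, possibly many for one pair. By
  \<open>uniq\<close> all of them fold to the same geodesic. By \<open>cont\<close> lifts near a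
  selected one are selected too, so the geodesic of a nearby pair is the fold of a nearby
  segment.\<close>

lemma GMPR_from_lifts:
  assumes ex: "\<And>P Q. (P, Q) \<in> E \<Longrightarrow> \<exists>x y. F x = P \<and> F y = Q \<and> R x y"
    and min: "\<And>x y. R x y \<Longrightarrow> dist x y = odist x y"
    and uniq: "\<And>x y x' y' t. R x y \<Longrightarrow> R x' y' \<Longrightarrow> eqv x x' \<Longrightarrow> eqv y y' \<Longrightarrow> eqv (linepath x y t) (linepath x' y' t)"
    and cont: "\<And>x y. R x y \<Longrightarrow> (F x, F y) \<in> E \<Longrightarrow>
      \<exists>\<delta>>0. \<forall>x' y'. dist x' x < \<delta> \<longrightarrow> dist y' y < \<delta> \<longrightarrow> (F x', F y') \<in> E \<longrightarrow> R x' y'"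
  shows "admits_GMPR T E"
proof -
  have "\<forall>p\<in>E. \<exists>xy. F (fst xy) = fst p \<and> F (snd xy) = snd p \<and> R (fst xy) (snd xy)"
    using ex by (metis fst_conv prod.collapse snd_conv)
  then obtain X where X: "\<And>p. p \<in> E \<Longrightarrow> F (fst (X p)) = fst p \<and> F (snd (X p)) = snd p \<and> R (fst (X p)) (snd (X p))"
    by metis
  define \<phi> where "\<phi> p t = F (linepath (fst (X p)) (snd (X p)) t)" for p t
  have "min_geodesic T (fst p) (snd p) (\<phi> p)" if "p \<in> E" for p
    using geodesic_lift[OF min[of "fst (X p)" "snd (X p)"]] X[OF that] unfolding \<phi>_def by simp
  moreover have "\<exists>\<delta>>0. \<forall>q\<in>E. pdist T q p < \<delta> \<longrightarrow> (\<forall>t\<in>{0..1}. idist T (\<phi> q t) (\<phi> p t) < \<epsilon>)"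
    if p: "p \<in> E" and e: "\<epsilon> > 0" for p \<epsilon>
  proof -
    define x where "x = fst (X p)"
    define y where "y = snd (X p)"
    have xy: "F x = fst p" "F y = snd p" "R x y" using X[OF p] by (auto simp: x_def y_def)
    obtain d0 where d0: "d0 > 0" "\<And>x' y'. dist x' x < d0 \<Longrightarrow> dist y' y < d0 \<Longrightarrow> (F x', F y') \<in> E \<Longrightarrow> R x' y'"
      using cont[OF xy(3)] xy p by auto
    define d where "d = min d0 (\<epsilon> / s)"
    have d: "d > 0" "d \<le> d0" "s * d \<le> \<epsilon>" using d0(1) e s_pos by (auto simp: d_def min_def field_simps)
    have "idist T (\<phi> q t) (\<phi> p t) < \<epsilon>" if q: "q \<in> E" "pdist T q p < s * d" and t: "t \<in> {0..1}" for q t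
    proof -
      obtain x0 y0 where q0: "F x0 = fst q" "F y0 = snd q" using X[OF q(1)] by metis
      have "idist T (fst q) (fst p) \<le> pdist T q p" "idist T (snd q) (snd p) \<le> pdist T q p"
        unfolding pdist_def prod_dist_def by (auto simp: case_prod_unfold)
      then have "idist T (F x0) (F x) < s * d" "idist T (F y0) (F y) < s * d" using q q0 xy by auto
      then obtain x' y' where l: "eqv x0 x'" "dist x' x < d" "eqv y0 y'" "dist y' y < d" using near_lift by metis
      have Fq: "F x' = fst q" "F y' = snd q" using l q0 F_eq_iff by metis+
      \<comment> \<open>The nearby lifts need not be those picked for q; \<open>uniq\<close>
        identifies the two geodesics.\<close>
      have "R x' y'" using d0(2)[of x' y'] l d q Fq by simp
      moreover have "eqv (fst (X q)) x'" "eqv (snd (X q)) y'" using X[OF q(1)] Fq by (simp_all flip: F_eq_iff)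
      ultimately have "\<phi> q t = F (linepath x' y' t)"
        using uniq[of "fst (X q)" "snd (X q)" x' y' t] X[OF q(1)] by (simp add: \<phi>_def F_eq_iff)
      moreover have "\<phi> p t = F (linepath x y t)" by (simp add: \<phi>_def x_def y_def)
      moreover have "dist (linepath x' y' t) (linepath x y t) < d"
      proof -
        have "linepath x' y' t - linepath x y t = (1 - t) *\<^sub>R (x' - x) + t *\<^sub>R (y' - y)"
          by (simp add: linepath_def algebra_simps)
        then have "dist (linepath x' y' t) (linepath x y t) \<le> (1 - t) * dist x' x + t * dist y' y"
          unfolding dist_norm using norm_triangle_ineq[of "(1 - t) *\<^sub>R (x' - x)" "t *\<^sub>R (y' - y)"] t by simp
        also have "\<dots> < d"
        proof (rule convex_bound_lt)
        qed (use l t in auto)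
        finally show ?thesis .
      qed
      then have "s * dist (linepath x' y' t) (linepath x y t) < s * d" using s_pos by simp
      ultimately show ?thesis using idist_le[of "linepath x' y' t" "linepath x y t"] d(3) by simp
    qed
    then show ?thesis using d s_pos by (intro exI[of _ "s * d"]) auto
  qed
  ultimately show ?thesis unfolding admits_GMPR_def GMPR_def by blast
qed

section \<open>Topology on pairs of surface points\<close>

abbreviation "PT \<equiv> Metric_space.mtopology (T \<times> T) (pdist T)"

definition lifts :: "((real^3) \<times> (real^3)) set \<Rightarrow> (complex \<times> complex) set" where
  "lifts V = {(x, y). (F x, F y) \<in> V}"

text \<open>Outside \<^term>\<open>T\<close> the value of \<^const>\<open>idist\<close> is the infimum of the empty set and
  need not be non-negative, so \<^const>\<open>idist\<close> itself is no instance of \<^locale>\<open>Metric_space\<close>.\<close>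
lemma metric_TT: "Metric_space (T \<times> T) (pdist T)"
proof -
  define D where "D P Q = (if P \<in> T \<and> Q \<in> T then idist T P Q else 0)" for P Q
  have D: "D (F x) (F y) = s * odist x y" for x y by (simp add: D_def idist_F)
  interpret M: Metric_space T D
  proof
    show "0 \<le> D P Q" for P Q
    proof (cases "P \<in> T \<and> Q \<in> T")
      case True
      then obtain x y where "P = F x" "Q = F y" by (metis TE)
      then show ?thesis using s_pos by (simp add: D)
    qed (auto simp: D_def)
    show "D P Q = D Q P" for P Q by (simp add: D_def idist_commute)
    show "D P Q = 0 \<longleftrightarrow> P = Q" if "P \<in> T" "Q \<in> T" for P Q
      using that s_pos by (elim TE) (simp add: D odist_zero_iff F_eq_iff)
    show "D P R \<le> D P Q + D Q R" if "P \<in> T" "Q \<in> T" "R \<in> T" for P Q R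
      using that s_pos odist_triangle by (elim TE) (simp add: D flip: distrib_left)
  qed
  interpret MM: Metric_space12 T D T D ..
  have eq: "pdist T p q = prod_dist D D p q" if "p \<in> T \<times> T" "q \<in> T \<times> T" for p q
    using that by (auto simp: pdist_def prod_dist_def D_def)
  show ?thesis
  proof
    show "0 \<le> pdist T p q" for p q by (simp add: pdist_def prod_dist_def case_prod_unfold)
    show "pdist T p q = pdist T q p" for p q
      by (simp add: pdist_def prod_dist_def case_prod_unfold idist_commute)
    show "pdist T p q = 0 \<longleftrightarrow> p = q" if "p \<in> T \<times> T" "q \<in> T \<times> T" for p q
      using MM.Prod_metric.zero[OF that] eq[OF that] by simp
    show "pdist T p r \<le> pdist T p q + pdist T q r" if "p \<in> T \<times> T" "q \<in> T \<times> T" "r \<in> T \<times> T" for p q r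
      using MM.Prod_metric.triangle[OF that] eq that by simp
  qed
qed

text \<open>The topology on pairs is the quotient topology from the plane: F is Lipschitz, and by
  \<open>near_lift\<close> nearby points of the surface have nearby lifts.\<close>

lemma openin_PT_iff:
  assumes "V \<subseteq> T \<times> T" shows "openin PT V \<longleftrightarrow> open (lifts V)"
proof -
  interpret Metric_space "T \<times> T" "pdist T" by (rule metric_TT)
  show ?thesis
  proof
    assume o: "openin PT V"
    show "open (lifts V)" unfolding open_dist
    proof
      fix p assume p: "p \<in> lifts V"
      obtain x y where xy: "p = (x, y)" by (cases p)
      then have "(F x, F y) \<in> V" using p by (simp add: lifts_def)
      then obtain r where r: "r > 0" "mball (F x, F y) r \<subseteq> V" using o unfolding openin_mtopology by blast
      have "q \<in> lifts V" if q: "dist q p < r / (2 * s)" for q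
      proof -
        obtain x' y' where q': "q = (x', y')" by (cases q)
        have d: "dist x x' \<le> dist q p" "dist y y' \<le> dist q p"
          using dist_fst_le[of q p] dist_snd_le[of q p] by (simp_all add: xy q' dist_commute)
        have "pdist T (F x, F y) (F x', F y') \<le> idist T (F x) (F x') + idist T (F y) (F y')"
          unfolding pdist_def prod_dist_def by (simp add: sqrt_sum_squares_le_sum idist_F s_pos less_imp_le)
        also have "\<dots> \<le> s * dist x x' + s * dist y y'" by (intro add_mono idist_le)
        also have "\<dots> \<le> s * dist q p + s * dist q p" using d s_pos by (intro add_mono mult_left_mono) auto
        also have "\<dots> < r" using q s_pos by (simp add: field_simps)
        finally have "(F x', F y') \<in> mball (F x, F y) r" by simp
        then show ?thesis using r q' by (auto simp: lifts_def)
      qed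
      then show "\<exists>e>0. \<forall>q. dist q p < e \<longrightarrow> q \<in> lifts V"
        using r s_pos by (intro exI[of _ "r / (2 * s)"]) auto
    qed
  next
    assume o: "open (lifts V)"
    show "openin PT V" unfolding openin_mtopology
    proof (intro conjI assms allI impI)
      fix p assume p: "p \<in> V"
      then have "fst p \<in> T" "snd p \<in> T" using assms by auto
      then obtain x y where "fst p = F x" "snd p = F y" by (elim TE)
      then have xy: "p = (F x, F y)" by (simp add: prod_eq_iff)
      then have "(x, y) \<in> lifts V" using p by (simp add: lifts_def)
      then obtain e where e: "e > 0" "\<forall>q. dist q (x, y) < e \<longrightarrow> q \<in> lifts V" using o unfolding open_dist by blast
      have "q \<in> V" if q: "q \<in> mball p (s * (e / 2))" for q
      proof -
        have "fst q \<in> T" "snd q \<in> T" using q by (simp_all add: in_mball mem_Times_iff)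
        then obtain x0 y0 where "fst q = F x0" "snd q = F y0" by (elim TE)
        then have q0: "q = (F x0, F y0)" by (simp add: prod_eq_iff)
        have "idist T (F x) (F x0) \<le> pdist T p q" "idist T (F y) (F y0) \<le> pdist T p q"
          unfolding pdist_def prod_dist_def xy q0 by simp_all
        moreover have "pdist T p q < s * (e / 2)" using q by (simp add: in_mball)
        ultimately have n: "idist T (F x0) (F x) < s * (e / 2)" "idist T (F y0) (F y) < s * (e / 2)"
          unfolding idist_commute[of "F x0"] idist_commute[of "F y0"] by linarith+
        obtain x' where l1: "eqv x0 x'" "dist x' x < e / 2" using near_lift[OF n(1)] .
        obtain y' where l2: "eqv y0 y'" "dist y' y < e / 2" using near_lift[OF n(2)] .
        have "dist (x', y') (x, y) \<le> dist x' x + dist y' y"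
          unfolding dist_Pair_Pair by (rule sqrt_sum_squares_le_sum) auto
        then have "(x', y') \<in> lifts V" using e(2) l1 l2 by simp
        moreover have "F x' = F x0" "F y' = F y0" using l1 l2 eqv_sym by (simp_all add: F_eq_iff)
        ultimately show ?thesis by (simp add: lifts_def q0)
      qed
      then show "\<exists>r>0. mball p r \<subseteq> V" using e s_pos by (intro exI[of _ "s * (e / 2)"]) auto
    qed
  qed
qed

lemma compact_PT: "compact_space PT"
proof -
  interpret Metric_space "T \<times> T" "pdist T" by (rule metric_TT)
  let ?f = "\<lambda>(x, y). (F x, F y)"
  have "continuous_map euclidean PT ?f"
    unfolding continuous_map_def
  proof (intro conjI allI impI)
    fix U assume U: "openin PT U"
    then have "U \<subseteq> T \<times> T" using openin_subset by fastforce
    then have "open (lifts U)" using U openin_PT_iff by simp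
    moreover have "lifts U = {p \<in> topspace euclidean. ?f p \<in> U}" by (auto simp: lifts_def)
    ultimately show "openin euclidean {p \<in> topspace euclidean. ?f p \<in> U}" by simp
  qed auto
  moreover have "compactin euclidean (cball (0::complex) 2 \<times> cball (0::complex) 2)"
    by (simp add: compact_Times)
  ultimately have "compactin PT (?f ` (cball 0 2 \<times> cball 0 2))" by (rule image_compactin[rotated])
  moreover have "?f ` (cball 0 2 \<times> cball 0 2) = topspace PT"
  proof -
    have "\<exists>y\<in>cball 0 2. F x = F y" for x
    proof -
      obtain y where y: "eqv x y" "0 \<le> pc y" "pc y \<le> 1" "\<bar>qc y\<bar> \<le> 1" by (rule eqv_fundamental)
      have "(pc y)\<^sup>2 \<le> 1" "(qc y)\<^sup>2 \<le> 1" using y by (simp_all add: abs_square_le_1)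
      moreover have "pc y * qc y \<le> 1 * 1"
        using mult_mono[of "\<bar>pc y\<bar>" 1 "\<bar>qc y\<bar>" 1] y abs_ge_self[of "pc y * qc y"] by (simp add: abs_mult)
      ultimately have "(norm y)\<^sup>2 \<le> 2\<^sup>2" unfolding norm_coord by simp
      then have "norm y \<le> 2" by (rule power2_le_imp_le) simp
      then show ?thesis using y(1) F_eq_iff by (intro bexI[of _ y]) auto
    qed
    then have "range F \<subseteq> F ` cball 0 2" by blast
    then have "F ` cball 0 2 = T" using range_F by blast
    moreover have "?f ` (A \<times> B) = F ` A \<times> F ` B" for A B by auto
    ultimately have "T \<times> T = ?f ` (cball 0 2 \<times> cball 0 2)" by (simp only:)
    then show ?thesis unfolding topspace_mtopology by (rule sym)
  qed
  ultimately show ?thesis by (simp add: compact_space_def)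
qed

text \<open>A locally closed subset of a compact Hausdorff space is locally compact: the closed part
  is compact, and the open part is then open in it.\<close>

lemma loc_compact_lifts:
  assumes "V \<subseteq> T \<times> T" "W \<subseteq> T \<times> T" "open (lifts V)" "closed (lifts W)"
  shows "loc_compact_sub T (V \<inter> W)"
proof -
  interpret Metric_space "T \<times> T" "pdist T" by (rule metric_TT)
  have "lifts (T \<times> T - W) = - lifts W" by (auto simp: lifts_def)
  then have "openin PT (T \<times> T - W)" using assms(4) openin_PT_iff[of "T \<times> T - W"] by auto
  then have W: "closedin PT W" using assms(2) by (simp add: closedin_def)
  have V: "openin PT V" using assms openin_PT_iff by simp
  have "locally_compact_space (subtopology PT W)"
    by (rule locally_compact_space_closed_subset[OF compact_imp_locally_compact_space[OF compact_PT] W])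
  then have "locally_compact_space (subtopology (subtopology PT W) (V \<inter> W))"
  proof (rule locally_compact_space_open_subset[rotated])
    show "openin (subtopology PT W) (V \<inter> W)" using V by (auto simp: openin_subtopology)
  qed (simp add: Hausdorff_space_subtopology Hausdorff_space_mtopology)
  then show ?thesis unfolding loc_compact_sub_def subtopology_subtopology
    by (simp add: inf_left_commute inf_commute)
qed

end

section \<open>A pair of points with four minimal geodesics\<close>

text \<open>At a tie, rotate u about l: the distance to l is kept exactly, and since u is not
  collinear with l, its norm changes to first order. Without a tie there is slack, and u can be
  stretched radially.\<close>

lemma escape:
  fixes u l :: complex
  assumes "norm u \<le> norm (u - l)" "Im (cnj l * u) \<noteq> 0" "\<delta> > 0"
  obtains u' where "dist u' u < \<delta>" "norm u < norm u'" "norm u \<le> norm (u' - l)"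
    "norm (u' - l) = norm u \<longleftrightarrow> norm (u - l) = norm u"
proof (cases "norm (u - l) = norm u")
  case True
  define v where "v = u - l"
  have u: "u = l + v" by (simp add: v_def)
  have nz: "Im (cnj l * v) \<noteq> 0" using assms(2) unfolding u by (simp add: algebra_simps)
  have R: "Re l * Re v + Im l * Im v < 0"
  proof -
    have "(norm v)\<^sup>2 = (norm (l + v))\<^sup>2" using True by (simp add: u)
    then have "2 * (Re l * Re v + Im l * Im v) = - ((Re l)\<^sup>2 + (Im l)\<^sup>2)"
      unfolding cmod_power2 by (simp add: power2_eq_square algebra_simps)
    moreover have "(Re l)\<^sup>2 + (Im l)\<^sup>2 > 0" using nz by (auto simp: sum_power2_gt_zero_iff)
    ultimately have "2 * (Re l * Re v + Im l * Im v) < 0" by (simp only: neg_less_0_iff_less)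
    then show ?thesis by (simp only: mult_less_0_iff) simp
  qed
  have "((\<lambda>\<theta>. l + cis \<theta> * v) \<longlongrightarrow> l + cis 0 * v) (at 0)"
    unfolding cis_conv_exp by (intro tendsto_intros)
  then obtain e where e: "e > 0" "\<And>\<theta>. \<theta> \<noteq> 0 \<Longrightarrow> \<bar>\<theta>\<bar> < e \<Longrightarrow> dist (l + cis \<theta> * v) u < \<delta>"
    using assms(3) unfolding tendsto_iff eventually_at by (auto simp: u dist_real_def)
  define t where "t = min (e / 2) 1"
  have t: "0 < t" "t < e" "t \<le> 1" using e(1) by (auto simp: t_def)
  have sin_t: "sin t > 0" using t pi_gt3 by (intro sin_gt_zero) auto
  \<comment> \<open>The derivative of \<open>(norm u')^2\<close> at angle 0 is
    \<open>- 2 * Im (cnj l * v)\<close>, and the sign of \<theta> is chosen to make the norm grow.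
    The remaining term, with factor \<open>cos \<theta> - 1\<close>, helps because of
    \<open>R\<close>.\<close>
  define \<theta> where "\<theta> = (if Im (cnj l * v) < 0 then t else - t)"
  have \<theta>: "\<theta> \<noteq> 0" "\<bar>\<theta>\<bar> < e" using t by (auto simp: \<theta>_def)
  have s: "sin \<theta> * Im (cnj l * v) < 0" using sin_t nz by (auto simp: \<theta>_def mult_pos_neg mult_neg_pos)
  define u' where "u' = l + cis \<theta> * v"
  have "(norm u')\<^sup>2 - (norm u)\<^sup>2 = 2 * ((cos \<theta> - 1) * (Re l * Re v + Im l * Im v) - sin \<theta> * Im (cnj l * v))
      + ((sin \<theta>)\<^sup>2 + (cos \<theta>)\<^sup>2 - 1) * ((Re v)\<^sup>2 + (Im v)\<^sup>2)"
  proof -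
    have "(norm (l + Complex \<alpha> \<beta> * v))\<^sup>2 - (norm (l + v))\<^sup>2
        = 2 * ((\<alpha> - 1) * (Re l * Re v + Im l * Im v) - \<beta> * Im (cnj l * v))
          + (\<beta>\<^sup>2 + \<alpha>\<^sup>2 - 1) * ((Re v)\<^sup>2 + (Im v)\<^sup>2)" for \<alpha> \<beta>
      unfolding cmod_power2 by (simp add: power2_eq_square algebra_simps)
    then show ?thesis unfolding u'_def u cis.code .
  qed
  moreover have "(cos \<theta> - 1) * (Re l * Re v + Im l * Im v) \<ge> 0"
    using R by (intro mult_nonpos_nonpos) auto
  ultimately have "(norm u')\<^sup>2 > (norm u)\<^sup>2" using s by simp
  then have "norm u < norm u'" by (rule power2_less_imp_less) simp
  moreover have "norm (u' - l) = norm u" using True by (simp add: u'_def v_def norm_mult)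
  moreover have "dist u' u < \<delta>" using e(2)[OF \<theta>] by (simp add: u'_def)
  ultimately show ?thesis using True by (intro that[of u']) auto
next
  case False
  have u0: "norm u > 0" using assms(2) by auto
  define g where "g = min \<delta> (norm (u - l) - norm u) / 2"
  have g: "g > 0" "g < \<delta>" "g < norm (u - l) - norm u" using False assms by (auto simp: g_def)
  define u' where "u' = (1 + g / norm u) *\<^sub>R u"
  have d: "u' - u = (g / norm u) *\<^sub>R u" by (simp add: u'_def algebra_simps)
  then have n: "norm (u' - u) = g" using u0 g by simp
  have "norm u' = (1 + g / norm u) * norm u" unfolding u'_def norm_scaleR using u0 g by simp
  then have "norm u' > norm u" using u0 g by (simp add: field_simps)
  moreover have "norm (u' - l) > norm u"
    using norm_triangle_ineq2[of "u - l" "u - u'"] n g by (simp add: norm_minus_commute)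
  ultimately show ?thesis using that[of u'] n g False by (simp add: dist_norm)
qed

text \<open>Equality in the triangle inequality puts m on the segment, by strict convexity of the
  Euclidean norm.\<close>

lemma midpoint_of_dist:
  fixes x m y :: complex
  assumes "dist x m = d / 2" "dist m y = d / 2" "dist x y = d" shows "m = midpoint x y"
proof (cases "d = 0")
  case True
  then show ?thesis using assms by simp
next
  case False
  have "dist x y = dist x m + dist m y" using assms by simp
  then have "norm (x - m) *\<^sub>R (m - y) = norm (m - y) *\<^sub>R (x - m)" by (simp add: dist_triangle_eq)
  moreover have "norm (x - m) = norm (m - y)" "norm (m - y) \<noteq> 0" using assms False by (auto simp: dist_norm)
  ultimately have "m - y = x - m" by simp
  then have "2 *\<^sub>R m = x + y" by (simp add: scaleR_2 algebra_simps)
  then have "m = (1 / 2) *\<^sub>R (x + y)" by (metis scaleR_half_double scaleR_2 scaleR_right_distrib)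
  then show ?thesis by (simp add: midpoint_def)
qed

lemma dist_midpoint_le:
  fixes x y :: complex
  shows "dist (midpoint x y) (midpoint x' y') \<le> (dist x x' + dist y y') / 2"
proof -
  have "midpoint x y - midpoint x' y' = (1 / 2) *\<^sub>R ((x - x') + (y - y'))"
    by (simp add: midpoint_def algebra_simps)
  then show ?thesis unfolding dist_norm using norm_triangle_ineq[of "x - x'" "y - y'"] by simp
qed

text \<open>Recovers \<open>(x, y)\<close> from \<open>(u, w) = (y - x, y + x)\<close>.\<close>
definition chx :: "complex \<times> complex \<Rightarrow> complex" where "chx p = (1/2) *\<^sub>R (snd p - fst p)"
definition chy :: "complex \<times> complex \<Rightarrow> complex" where "chy p = (1/2) *\<^sub>R (snd p + fst p)"

lemma ch_sum_diff [simp]: "chy p - chx p = fst p" "chy p + chx p = snd p"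
proof -
  have "(1/2) *\<^sub>R z + (1/2) *\<^sub>R z = z" for z :: complex by (metis scaleR_half_double scaleR_right_distrib scaleR_2)
  then show "chy p - chx p = fst p" "chy p + chx p = snd p" by (simp_all add: chx_def chy_def algebra_simps)
qed

lemma ch_lipschitz: "dist (chx p) (chx q) \<le> dist p q" "dist (chy p) (chy q) \<le> dist p q"
proof -
  have "dist (fst p) (fst q) \<le> dist p q" "dist (snd p) (snd q) \<le> dist p q" by (rule dist_fst_le, rule dist_snd_le)
  moreover have "chx p - chx q = (1/2) *\<^sub>R ((snd p - snd q) - (fst p - fst q))"
    "chy p - chy q = (1/2) *\<^sub>R ((snd p - snd q) + (fst p - fst q))"
    by (simp_all add: chx_def chy_def algebra_simps)
  ultimately show "dist (chx p) (chx q) \<le> dist p q" "dist (chy p) (chy q) \<le> dist p q"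
    unfolding dist_norm[of "chx p"] dist_norm[of "chy p"]
    using norm_triangle_ineq4[of "snd p - snd q" "fst p - fst q"] norm_triangle_ineq[of "snd p - snd q" "fst p - fst q"]
    by (simp_all add: dist_norm[of "fst p"] dist_norm[of "snd p"])
qed

definition L1 :: complex where "L1 = pt 2 0"
definition L2 :: complex where "L2 = pt 0 2"

lemma L_lat [simp]: "L1 \<in> lat" "L2 \<in> lat"
  using pt_lat[of 1 0] pt_lat[of 0 1] by (simp_all add: L1_def L2_def)

text \<open>The four candidate starting points for minimal geodesics of pairs close to the pair \<open>base\<close>.\<close>
definition start :: "nat \<Rightarrow> complex \<times> complex \<Rightarrow> complex" where
  "start i p = (if i = 0 then chx p else if i = 1 then chx p + L1 else if i = 2 then - chx p else L2 - chx p)"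

definition len :: "nat \<Rightarrow> complex \<times> complex \<Rightarrow> real" where "len i p = dist (start i p) (chy p)"

definition pair_dist :: "complex \<times> complex \<Rightarrow> real" where "pair_dist p = odist (chx p) (chy p)"

definition ties :: "complex \<times> complex \<Rightarrow> nat set" where "ties p = {i \<in> {..<4}. len i p = pair_dist p}"

text \<open>Here \<open>u\<close> and \<open>w\<close> have equal length and lie on different edges of the cell \<^const>\<open>hex\<close>, away from
  the midpoints and ends of these edges.\<close>
definition base :: "complex \<times> complex" where "base = (pt (5/6) (1/3), pt (1/3) (5/6))"

lemma len_simps:
  "len 0 p = norm (fst p)" "len 1 p = norm (fst p - L1)" "len 2 p = norm (snd p)" "len 3 p = norm (snd p - L2)"
proof -
  have a: "chx p = chy p - fst p" and b: "chx p = snd p - chy p"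
    unfolding ch_sum_diff[of p, symmetric] by (simp_all del: ch_sum_diff)
  have "chx p - chy p = - fst p" "chx p + L1 - chy p = - (fst p - L1)" "- chx p - chy p = - snd p"
    "L2 - chx p - chy p = - (snd p - L2)"
    by (simp add: a, simp add: a, simp add: b, simp add: b)
  moreover have st: "start 0 p = chx p" "start 1 p = chx p + L1" "start 2 p = - chx p" "start 3 p = L2 - chx p"
    by (simp_all add: start_def)
  ultimately show "len 0 p = norm (fst p)" "len 1 p = norm (fst p - L1)" "len 2 p = norm (snd p)" "len 3 p = norm (snd p - L2)"
    unfolding len_def dist_norm st by (simp_all only: norm_minus_cancel)
qed

lemma eqv_start: "eqv (chx p) (start i p)"
  by (simp add: start_def eqv_def)

lemma pair_dist_le_len: "pair_dist p \<le> len i p"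
  using odist_le_dist[of "start i p" "chy p"] odist_eqv[OF eqv_start[of p i] eqv_refl[of "chy p"]] by (simp add: pair_dist_def len_def)

lemma start_lipschitz: "dist (start i p) (start i q) \<le> dist p q"
proof -
  have "dist (start i p) (start i q) = dist (chx p) (chx q)"
    by (simp add: start_def dist_norm norm_minus_commute)
  then show ?thesis using ch_lipschitz(1)[of p q] by simp
qed

lemma base_ties: "nu (chx base) (chy base) \<subseteq> {0, L1}" "nw (chx base) (chy base) \<subseteq> {0, L2}" "pair_dist base = len 0 base"
proof -
  let ?u = "pt (5/6) (1/3)" let ?w = "pt (1/3) (5/6)"
  have h: "hex ?u" "hex ?w" by (simp_all add: hex_def)
  have nu: "(norm ?u)\<^sup>2 = (norm ?w)\<^sup>2" unfolding norm_coord by (simp add: power2_eq_square)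
  then have n: "norm ?u = norm ?w" by simp
  have "norm ?u \<le> infdist ?u lat" "norm ?w \<le> infdist ?w lat"
    using infdist_lat_attained[of ?u] infdist_lat_attained[of ?w] hex_nearest[OF h(1)] hex_nearest[OF h(2)] by metis+
  then have "odist (chx base) (chy base) \<ge> norm ?u" unfolding odist_def ch_sum_diff by (simp add: base_def n)
  then have D: "pair_dist base = norm ?u" using pair_dist_le_len[of base 0] by (simp add: pair_dist_def len_simps base_def)
  then show "pair_dist base = len 0 base" by (simp add: len_simps base_def)
  show "nu (chx base) (chy base) \<subseteq> {0, L1}"
  proof
    fix l assume "l \<in> nu (chx base) (chy base)"
    then have l: "l \<in> lat" "norm (?u - l) = norm ?u"
      using D by (auto simp: nu_def near_def pair_dist_def base_def)
    show "l \<in> {0, L1}"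
    proof (cases "l = 0")
      case False
      then have "(pc l, qc l) = (2, 0)" using hex_nearest_eq[OF h(1) l False] bisector_coord[OF l(2)] by auto
      then show ?thesis using coord_eqI[of l L1] by (simp add: L1_def)
    qed simp
  qed
  show "nw (chx base) (chy base) \<subseteq> {0, L2}"
  proof
    fix l assume "l \<in> nw (chx base) (chy base)"
    then have l: "l \<in> lat" "norm (?w - l) = norm ?w"
      using D n by (auto simp: nw_def near_def pair_dist_def base_def)
    show "l \<in> {0, L2}"
    proof (cases "l = 0")
      case False
      then have "(pc l, qc l) = (0, 2)" using hex_nearest_eq[OF h(2) l False] bisector_coord[OF l(2)] by auto
      then show ?thesis using coord_eqI[of l L2] by (simp add: L2_def)
    qed simp
  qed
qed

lemma norm_eq_coord: "norm x = norm y \<longleftrightarrow> (pc x)\<^sup>2 + pc x * qc x + (qc x)\<^sup>2 = (pc y)\<^sup>2 + pc y * qc y + (qc y)\<^sup>2"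
  by (metis norm_coord norm_ge_zero power2_eq_imp_eq)

lemma ties_base: "ties base = {..<4}"
proof -
  have "len 1 base = len 0 base" "len 2 base = len 0 base" "len 3 base = len 0 base"
    unfolding len_simps norm_eq_coord by (simp_all add: base_def L1_def L2_def power2_eq_square)
  moreover have "i < 4 \<Longrightarrow> i = 0 \<or> i = 1 \<or> i = 2 \<or> i = (3::nat)" for i by auto
  ultimately show ?thesis unfolding ties_def base_ties(3) by force
qed

text \<open>The four geodesics differ already at time 1/2, so a rule's choice can be read off from
  the midpoint alone.\<close>

lemma base_midpoints:
  assumes "i < 4" "j < 4" "i \<noteq> j"
  shows "\<not> eqv (midpoint (start i base) (chy base)) (midpoint (start j base) (chy base))"
proof -
  have ne: "\<not> eqv x y" if "(pc y - pc x) / 2 \<notin> \<int> \<or> (qc y - qc x) / 2 \<notin> \<int>" "(pc y + pc x) / 2 \<notin> \<int> \<or> (qc y + qc x) / 2 \<notin> \<int>" for x y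
    using that by (auto simp: eqv_def lat_def)
  have nint: "r \<notin> \<int>" if "0 < r" "r < 1" for r :: real
    using that by (auto elim!: Ints_cases)
  have nint': "r \<notin> \<int>" if "-1 < r" "r < 0" for r :: real
    using nint[of "- r"] that by simp
  have c: "pc (midpoint x y) = (pc x + pc y) / 2" "qc (midpoint x y) = (qc x + qc y) / 2" for x y
    by (simp_all add: midpoint_def)
  have "i \<in> {0,1,2,3}" "j \<in> {0,1,2,3}" using assms by auto
  then show ?thesis using assms(3)
    by (elim insertE emptyE; simp only: refl not_True_eq_False simp_thms)
      (rule ne; simp add: c start_def chx_def chy_def base_def L1_def L2_def nint nint')+
qed

section \<open>The lower bound\<close>

text \<open>Under the two inclusions the four labels are the only possible ones, so every minimal
  lift is one of the four starting points.\<close>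

lemma ties_nonempty_near:
  assumes "nu (chx p) (chy p) \<subseteq> {0, L1}" "nw (chx p) (chy p) \<subseteq> {0, L2}"
    and "eqv (chx p) x'" "dist x' (chy p) = pair_dist p"
  shows "\<exists>i\<in>ties p. x' = start i p"
proof -
  have mem: "x' = start i p \<Longrightarrow> i < 4 \<Longrightarrow> \<exists>i\<in>ties p. x' = start i p" for i
    using assms(4) by (auto simp: ties_def len_def)
  show ?thesis using assms(3)
  proof (cases rule: eqv_cases)
    case (1 l)
    have "(chx p + l) - chy p = - (chy p - chx p - l)" by (simp del: ch_sum_diff)
    then have "dist x' (chy p) = norm (chy p - chx p - l)" unfolding 1 dist_norm by (simp only: norm_minus_cancel)
    then have "l \<in> nu (chx p) (chy p)" using assms(4) 1 by (simp add: nu_def near_def pair_dist_def)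
    then have "l = 0 \<or> l = L1" using assms(1) by auto
    then have "x' = start 0 p \<or> x' = start 1 p" using 1 by (auto simp: start_def)
    then show ?thesis using mem[of 0] mem[of 1] by auto
  next
    case (2 l)
    have "(l - chx p) - chy p = - (chy p + chx p - l)" by (simp del: ch_sum_diff)
    then have "dist x' (chy p) = norm (chy p + chx p - l)" unfolding 2 dist_norm by (simp only: norm_minus_cancel)
    then have "l \<in> nw (chx p) (chy p)" using assms(4) 2 by (simp add: nw_def near_def pair_dist_def)
    then have "l = 0 \<or> l = L2" using assms(2) by auto
    then have "x' = start 2 p \<or> x' = start 3 p" using 2 by (auto simp: start_def)
    then show ?thesis using mem[of 2] mem[of 3] by auto
  qed
qed

definition mid :: "nat \<Rightarrow> complex \<times> complex \<Rightarrow> complex" where "mid i p = midpoint (start i p) (chy p)"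

lemma mid_lipschitz: "dist (mid i p) (mid i q) \<le> dist p q"
  using dist_midpoint_le[of "start i p" "chy p" "start i q" "chy q"] start_lipschitz[of i p q] ch_lipschitz(2)[of p q]
  unfolding mid_def by (simp add: field_simps)

text \<open>The two inequations say that u is not on the line of \<open>L1\<close> and w not on the
  line of \<open>L2\<close>, as \<open>escape\<close> requires.\<close>

definition good :: "complex \<times> complex \<Rightarrow> bool" where
  "good p \<longleftrightarrow> nu (chx p) (chy p) \<subseteq> {0, L1} \<and> nw (chx p) (chy p) \<subseteq> {0, L2} \<and> qc (fst p) \<noteq> 0 \<and> pc (snd p) \<noteq> 0"

lemma good_near_base: "\<exists>\<delta>>0. \<forall>p. dist p base < \<delta> \<longrightarrow> good p"
proof -
  obtain d where d: "d > 0" "\<forall>x' y'. dist x' (chx base) < d \<longrightarrow> dist y' (chy base) < d \<longrightarrow>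
      nu x' y' \<subseteq> nu (chx base) (chy base) \<and> nw x' y' \<subseteq> nw (chx base) (chy base)"
    using ties_usc by blast
  \<comment> \<open>Within distance 1/6 coordinates change by less than 1/3, which is their value at
    \<open>base\<close>.\<close>
  have "good p" if p: "dist p base < min d (1/6)" for p
  proof -
    have "dist (chx p) (chx base) < d" "dist (chy p) (chy base) < d"
      using ch_lipschitz[of p base] p by linarith+
    then have "nu (chx p) (chy p) \<subseteq> {0, L1} \<and> nw (chx p) (chy p) \<subseteq> {0, L2}"
      using d(2) base_ties by blast
    moreover have "norm (fst p - fst base) < 1/6" "norm (snd p - snd base) < 1/6"
      using dist_fst_le[of p base] dist_snd_le[of p base] p unfolding dist_norm[of "fst p"] dist_norm[of "snd p"] by linarith+
    then have "\<bar>qc (fst p) - 1/3\<bar> < 1/3" "\<bar>pc (snd p) - 1/3\<bar> < 1/3"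
      using coord_le_norm(2)[of "fst p - fst base"] coord_le_norm(1)[of "snd p - snd base"] by (simp_all add: base_def)
    then have "qc (fst p) \<noteq> 0" "pc (snd p) \<noteq> 0" by auto
    ultimately show ?thesis by (simp add: good_def)
  qed
  then show ?thesis using d(1) by (intro exI[of _ "min d (1/6)"]) auto
qed

lemma pair_dist_attained: assumes "good p" shows "\<exists>i\<in>ties p. True"
proof -
  obtain x' where "eqv (chx p) x'" "dist x' (chy p) = odist (chx p) (chy p)" by (rule odist_attained)
  then show ?thesis using ties_nonempty_near[of p x'] assms by (auto simp: good_def pair_dist_def)
qed

lemma Im_L1: "Im (cnj L1 * u) = sqrt 3 * qc u"
  by (simp add: L1_def pt_def qc_def real_div_sqrt field_simps)

lemma Im_L2: "Im (cnj L2 * u) = - sqrt 3 * pc u"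
  by (simp add: L2_def pt_def pc_def field_simps)

text \<open>The reflection of u to l - u exchanges 0 and l and reduces this to
  \<open>escape\<close>.\<close>

lemma escape_right:
  fixes u l :: complex
  assumes "norm (u - l) \<le> norm u" "Im (cnj l * u) \<noteq> 0" "\<delta> > 0"
  obtains u' where "dist u' u < \<delta>" "norm (u - l) < norm (u' - l)" "norm (u - l) \<le> norm u'"
    "norm u' = norm (u - l) \<longleftrightarrow> norm u = norm (u - l)"
proof -
  have a: "norm (l - u) = norm (u - l)" "norm (l - u - l) = norm u" by (simp_all add: norm_minus_commute)
  have "Im (cnj l * (l - u)) \<noteq> 0" using assms(2) by (simp add: algebra_simps)
  then obtain v where v: "dist v (l - u) < \<delta>" "norm (l - u) < norm v" "norm (l - u) \<le> norm (v - l)"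
    "norm (v - l) = norm (l - u) \<longleftrightarrow> norm (l - u - l) = norm (l - u)"
    using escape[of "l - u" l \<delta>] assms a by metis
  have "norm (l - v - l) = norm v" "norm (l - v) = norm (v - l)" by (simp_all add: norm_minus_commute)
  moreover have "dist (l - v) u = dist v (l - u)" unfolding dist_norm by (simp add: norm_minus_commute algebra_simps)
  ultimately show ?thesis using v that[of "l - v"] unfolding a by simp
qed

text \<open>Indices 0 and 1 depend on u only, 2 and 3 on w only. It suffices to move that one vector
  by \<open>escape\<close>: the length i grows, its companion keeps its status, and the other two do
  not change.\<close>

lemma remove_tie:
  assumes p: "good p" and i: "i \<in> ties p" and ne: "ties p \<noteq> {i}" and \<rho>: "\<rho> > 0"
    and G: "\<And>q. dist q p < \<rho> \<Longrightarrow> good q"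
  shows "\<exists>q. dist q p < \<rho> \<and> ties q = ties p - {i}"
proof -
  have ex4: "i < 4 \<Longrightarrow> i = 0 \<or> i = 1 \<or> i = 2 \<or> i = (3::nat)" for i by auto
  have all4: "(\<forall>i<4. P i) \<longleftrightarrow> P 0 \<and> P 1 \<and> P 2 \<and> P (3::nat)" for P
    using ex4 by (auto dest!: ex4)
  have le: "pair_dist p \<le> len j p" for j by (rule pair_dist_le_len)
  have leni: "len i p = pair_dist p" "i < 4" using i by (auto simp: ties_def)
  have nz: "Im (cnj L1 * fst p) \<noteq> 0" "Im (cnj L2 * snd p) \<noteq> 0" using p by (simp_all only: Im_L1 Im_L2 good_def) simp_all
  note lens = len_simps[unfolded One_nat_def]
  have le4: "pair_dist p \<le> norm (fst p)" "pair_dist p \<le> norm (fst p - L1)" "pair_dist p \<le> norm (snd p)" "pair_dist p \<le> norm (snd p - L2)"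
    using le[of 0] le[of "Suc 0"] le[of 2] le[of 3] unfolding lens by simp_all
  have "\<exists>q. dist q p < \<rho> \<and> pair_dist p < len i q \<and> (\<forall>j<4. j \<noteq> i \<longrightarrow> pair_dist p \<le> len j q \<and> (len j q = pair_dist p \<longleftrightarrow> len j p = pair_dist p))"
  proof -
    consider "i = 0" | "i = Suc 0" | "i = 2" | "i = 3" using ex4[OF leni(2)] by force
    then show ?thesis
    proof cases
      case 1
      then have "norm (fst p) = pair_dist p" using leni by (simp add: lens)
      then obtain u' where "dist u' (fst p) < \<rho>" "pair_dist p < norm u'" "pair_dist p \<le> norm (u' - L1)"
        "norm (u' - L1) = pair_dist p \<longleftrightarrow> norm (fst p - L1) = pair_dist p"
        using escape[of "fst p" L1 \<rho>] le4 nz \<rho> by metis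
      then show ?thesis using le4 unfolding all4
        by (intro exI[of _ "(u', snd p)"]) (simp add: 1 lens dist_prod_def)
    next
      case 2
      then have "norm (fst p - L1) = pair_dist p" using leni by (simp add: lens)
      then obtain u' where "dist u' (fst p) < \<rho>" "pair_dist p < norm (u' - L1)" "pair_dist p \<le> norm u'"
        "norm u' = pair_dist p \<longleftrightarrow> norm (fst p) = pair_dist p"
        using escape_right[of "fst p" L1 \<rho>] le4 nz \<rho> by metis
      then show ?thesis using le4 unfolding all4
        by (intro exI[of _ "(u', snd p)"]) (simp add: 2 lens dist_prod_def)
    next
      case 3
      then have "norm (snd p) = pair_dist p" using leni by (simp add: lens)
      then obtain u' where "dist u' (snd p) < \<rho>" "pair_dist p < norm u'" "pair_dist p \<le> norm (u' - L2)"
        "norm (u' - L2) = pair_dist p \<longleftrightarrow> norm (snd p - L2) = pair_dist p"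
        using escape[of "snd p" L2 \<rho>] le4 nz \<rho> by metis
      then show ?thesis using le4 unfolding all4
        by (intro exI[of _ "(fst p, u')"]) (simp add: 3 lens dist_prod_def)
    next
      case 4
      then have "norm (snd p - L2) = pair_dist p" using leni by (simp add: lens)
      then obtain u' where "dist u' (snd p) < \<rho>" "pair_dist p < norm (u' - L2)" "pair_dist p \<le> norm u'"
        "norm u' = pair_dist p \<longleftrightarrow> norm (snd p) = pair_dist p"
        using escape_right[of "snd p" L2 \<rho>] le4 nz \<rho> by metis
      then show ?thesis using le4 unfolding all4
        by (intro exI[of _ "(fst p, u')"]) (simp add: 4 lens dist_prod_def)
    qed
  qed
  then obtain q where q: "dist q p < \<rho>" "pair_dist p < len i q"
    "\<And>j. j < 4 \<Longrightarrow> j \<noteq> i \<Longrightarrow> pair_dist p \<le> len j q \<and> (len j q = pair_dist p \<longleftrightarrow> len j p = pair_dist p)" by blast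
  \<comment> \<open>A second tie survives with its length unchanged, which prevents the minimum from
    rising.\<close>
  obtain k where k: "k \<in> ties p" "k \<noteq> i" using ne i by blast
  have "len k q = pair_dist p" using q(3)[of k] k by (auto simp: ties_def)
  then have "pair_dist q \<le> pair_dist p" using pair_dist_le_len[of q k] by simp
  moreover have "pair_dist p \<le> pair_dist q"
  proof -
    obtain j where j: "j \<in> ties q" using pair_dist_attained[OF G[OF q(1)]] by blast
    then have "pair_dist p \<le> len j q" using q(2) q(3)[of j] by (cases "j = i") (auto simp: ties_def)
    then show ?thesis using j by (simp add: ties_def)
  qed
  ultimately have "pair_dist q = pair_dist p" by simp
  then have "j \<in> ties q \<longleftrightarrow> j \<in> ties p - {i}" for j
    using q(2) q(3)[of j] leni(1) by (cases "j = i") (auto simp: ties_def)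
  then have "ties q = ties p - {i}" by blast
  then show ?thesis using q(1) by blast
qed

context tetra
begin

text \<open>Lift backwards from y: take the lift m of the midpoint nearest to y, then the lift of x
  nearest to m. The two halves add up to at least the whole, so equality holds and m is the
  Euclidean midpoint.\<close>

lemma geodesic_midpoint:
  assumes "min_geodesic T (F x) (F y) \<gamma>"
  shows "\<exists>x'. eqv x x' \<and> dist x' y = odist x y \<and> \<gamma> (1/2) = F (midpoint x' y)"
proof -
  have g: "\<gamma> 0 = F x" "\<gamma> 1 = F y" "\<gamma> (1/2) \<in> T"
    "idist T (\<gamma> 0) (\<gamma> (1/2)) = \<bar>0 - 1/2\<bar> * idist T (F x) (F y)"
    "idist T (\<gamma> (1/2)) (\<gamma> 1) = \<bar>1/2 - 1\<bar> * idist T (F x) (F y)"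
  proof -
    have h: "\<forall>u\<in>{0..1}. \<forall>t\<in>{0..1}. idist T (\<gamma> u) (\<gamma> t) = \<bar>u - t\<bar> * idist T (F x) (F y)"
      using assms unfolding min_geodesic_def by blast
    show "idist T (\<gamma> 0) (\<gamma> (1/2)) = \<bar>0 - 1/2\<bar> * idist T (F x) (F y)"
      "idist T (\<gamma> (1/2)) (\<gamma> 1) = \<bar>1/2 - 1\<bar> * idist T (F x) (F y)"
      by (rule h[rule_format]; simp)+
  qed (use assms in \<open>auto simp: min_geodesic_def\<close>)
  obtain m0 where m0: "\<gamma> (1/2) = F m0" using g(3) by (rule TE)
  obtain m where m: "eqv m0 m" "dist m y = odist m0 y" by (rule odist_attained)
  have Fm: "\<gamma> (1/2) = F m" using m0 m(1) by (simp add: F_eq_iff)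
  have d2: "dist m y = odist x y / 2"
    using g(5) s_pos m unfolding g(2) m0 idist_F by simp
  have d1: "odist x m = odist x y / 2" using g(4) s_pos unfolding g(1) Fm idist_F by simp
  obtain x' where x': "eqv x x'" "dist x' m = odist x m" by (rule odist_attained)
  have "odist x y \<le> dist x' y" using odist_le_dist[of x' y] odist_eqv[OF x'(1) eqv_refl[of y]] by simp
  moreover have "dist x' y \<le> dist x' m + dist m y" by (rule dist_triangle)
  ultimately have d3: "dist x' y = odist x y" using d1 d2 x' by simp
  then have "m = midpoint x' y" by (intro midpoint_of_dist[of x' m "odist x y" y]) (use d1 d2 x' in auto)
  then show ?thesis using x' d3 Fm by blast
qed

definition \<Phi> :: "complex \<times> complex \<Rightarrow> (real^3) \<times> (real^3)" where "\<Phi> p = (F (chx p), F (chy p))"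

text \<open>By continuity at time 1/2 the midpoint chosen at q is close to the one chosen at p,
  while midpoints with different indices stay \<eta> apart. So the index cannot change.\<close>

lemma choice_locally_constant:
  assumes adm: "admits_GMPR T E"
    and \<rho>: "\<And>p. dist p base < \<rho> \<Longrightarrow> good p"
    and sep: "\<And>i j p q. i < 4 \<Longrightarrow> j < 4 \<Longrightarrow> i \<noteq> j \<Longrightarrow> dist p base < \<rho> \<Longrightarrow> dist q base < \<rho> \<Longrightarrow> odist (mid i p) (mid j q) \<ge> \<eta>"
    and \<eta>: "\<eta> > 0" and p: "dist p base < \<rho>" "\<Phi> p \<in> E"
  shows "\<exists>i\<in>ties p. \<exists>\<delta>>0. \<forall>q. dist q base < \<rho> \<longrightarrow> dist q p < \<delta> \<longrightarrow> \<Phi> q \<in> E \<longrightarrow> i \<in> ties q"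
proof -
  obtain \<phi> where \<phi>: "GMPR T E \<phi>" using adm by (auto simp: admits_GMPR_def)
  have level: "\<exists>i\<in>ties q. \<phi> (\<Phi> q) (1/2) = F (mid i q)" if q: "dist q base < \<rho>" "\<Phi> q \<in> E" for q
  proof -
    have "min_geodesic T (F (chx q)) (F (chy q)) (\<phi> (\<Phi> q))"
      using \<phi> q(2) unfolding GMPR_def \<Phi>_def by fastforce
    then obtain x' where x': "eqv (chx q) x'" "dist x' (chy q) = odist (chx q) (chy q)" "\<phi> (\<Phi> q) (1/2) = F (midpoint x' (chy q))"
      using geodesic_midpoint by blast
    then obtain i where "i \<in> ties q" "x' = start i q"
      using ties_nonempty_near[of q x'] \<rho>[OF q(1)] by (auto simp: good_def pair_dist_def)
    then show ?thesis using x' by (auto simp: mid_def)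
  qed
  obtain i where i: "i \<in> ties p" "\<phi> (\<Phi> p) (1/2) = F (mid i p)" using level[OF p] by blast
  obtain d where d: "d > 0" "\<forall>q\<in>E. pdist T q (\<Phi> p) < d \<longrightarrow> (\<forall>t\<in>{0..1}. idist T (\<phi> q t) (\<phi> (\<Phi> p) t) < s * \<eta>)"
    using \<phi> p(2) s_pos \<eta> unfolding GMPR_def by (metis mult_pos_pos)
  have "i \<in> ties q" if q: "dist q base < \<rho>" "dist q p < d / (2 * s)" "\<Phi> q \<in> E" for q
  proof -
    obtain j where j: "j \<in> ties q" "\<phi> (\<Phi> q) (1/2) = F (mid j q)" using level q by blast
    have "pdist T (\<Phi> q) (\<Phi> p) \<le> idist T (F (chx q)) (F (chx p)) + idist T (F (chy q)) (F (chy p))"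
      unfolding pdist_def prod_dist_def \<Phi>_def by (simp add: sqrt_sum_squares_le_sum idist_F s_pos less_imp_le)
    also have "\<dots> \<le> s * dist (chx q) (chx p) + s * dist (chy q) (chy p)" by (intro add_mono idist_le)
    also have "\<dots> \<le> s * dist q p + s * dist q p"
      using ch_lipschitz[of q p] s_pos by (intro add_mono mult_left_mono) auto
    also have "\<dots> < d" using q(2) s_pos by (simp add: field_simps)
    finally have "idist T (\<phi> (\<Phi> q) (1/2)) (\<phi> (\<Phi> p) (1/2)) < s * \<eta>" using d(2) q(3) by auto
    then have "odist (mid j q) (mid i p) < \<eta>" using s_pos unfolding i j idist_F by simp
    then have "j = i" using sep[of j i q p] i j q p by (force simp: ties_def)
    then show ?thesis using j by simp
  qed
  moreover have "d / (2 * s) > 0" using d s_pos by simp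
  ultimately show ?thesis using i(1) by blast
qed

text \<open>The ties of the successive pairs decrease, so a set met before cannot occur again.\<close>
lemma many_sets:
  fixes k :: nat
  assumes cover: "T \<times> T \<subseteq> (\<Union>i\<le>k. E i)" and adm: "\<And>i. i \<le> k \<Longrightarrow> admits_GMPR T (E i)"
    and \<rho>: "\<And>p. dist p base < \<rho> \<Longrightarrow> good p"
    and sep: "\<And>i j p q. i < 4 \<Longrightarrow> j < 4 \<Longrightarrow> i \<noteq> j \<Longrightarrow> dist p base < \<rho> \<Longrightarrow> dist q base < \<rho> \<Longrightarrow> odist (mid i p) (mid j q) \<ge> \<eta>"
    and \<eta>: "\<eta> > 0"
  shows "dist p base < \<rho> \<Longrightarrow> \<delta> > 0 \<Longrightarrow> card (ties p) = n \<Longrightarrow>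
    \<exists>I\<subseteq>{..k}. card I = n \<and> (\<forall>j\<in>I. \<exists>r. dist r base < \<rho> \<and> dist r p < \<delta> \<and> \<Phi> r \<in> E j \<and> ties r \<subseteq> ties p)"
proof (induction n arbitrary: p \<delta>)
  case 0
  then show ?case by (intro exI[of _ "{}"]) auto
next
  case (Suc n)
  have "\<Phi> p \<in> T \<times> T" by (simp add: \<Phi>_def)
  then have "\<Phi> p \<in> (\<Union>i\<le>k. E i)" by (rule subsetD[OF cover])
  then obtain j where j: "j \<le> k" "\<Phi> p \<in> E j" by (elim UN_E) simp
  have "\<exists>i\<in>ties p. \<exists>d>0. \<forall>q. dist q base < \<rho> \<longrightarrow> dist q p < d \<longrightarrow> \<Phi> q \<in> E j \<longrightarrow> i \<in> ties q"
  proof (rule choice_locally_constant)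
    show "admits_GMPR T (E j)" by (rule adm[OF j(1)])
    show "good q" if "dist q base < \<rho>" for q using that by (rule \<rho>)
    show "\<eta> \<le> odist (mid i q) (mid i' r)"
      if "i < 4" "i' < 4" "i \<noteq> i'" "dist q base < \<rho>" "dist r base < \<rho>" for i i' q r using that by (rule sep)
  qed (fact \<eta> Suc.prems(1) j(2))+
  then obtain i d where i: "i \<in> ties p" and d: "d > 0"
    "\<forall>q. dist q base < \<rho> \<longrightarrow> dist q p < d \<longrightarrow> \<Phi> q \<in> E j \<longrightarrow> i \<in> ties q" by blast
  show ?case
  \<comment> \<open>When a single tie is left, \<open>remove_tie\<close> does not apply; the set
    containing p is then the only one to exhibit.\<close>
  proof (cases "n = 0")
    case True
    have "dist p base < \<rho> \<and> dist p p < \<delta> \<and> \<Phi> p \<in> E j \<and> ties p \<subseteq> ties p" using j Suc.prems by simp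
    then have "\<forall>j'\<in>{j}. \<exists>r. dist r base < \<rho> \<and> dist r p < \<delta> \<and> \<Phi> r \<in> E j' \<and> ties r \<subseteq> ties p" by blast
    then show ?thesis using j True by (intro exI[of _ "{j}"]) simp
  next
    case False
    \<comment> \<open>The halves allow two steps, from p to q and from q to r, within d and
      \<delta>; the last term keeps q in the ball of radius \<rho> about
      \<open>base\<close>.\<close>
    define e where "e = min (min d \<delta> / 2) (\<rho> - dist p base)"
    have e: "e > 0" "e \<le> d / 2" "e \<le> \<delta> / 2" "e \<le> \<rho> - dist p base" 
      using d(1) Suc.prems(1,2) unfolding e_def min_def by (auto split: if_splits)
    have near: "dist q base < \<rho>" if "dist q p < e" for q
    proof -
      have "dist q base \<le> dist q p + dist p base" by (rule dist_triangle)
      then show ?thesis using that e(4) by linarith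
    qed
    have ne: "ties p \<noteq> {i}" using Suc.prems(3) False by auto
    have "\<exists>q. dist q p < e \<and> ties q = ties p - {i}"
      by (rule remove_tie[OF \<rho>[OF Suc.prems(1)] i ne e(1)]) (rule \<rho>[OF near])
    then obtain q where q: "dist q p < e" "ties q = ties p - {i}" by blast
    have "card (ties q) = n" using q(2) i Suc.prems(3) by simp
    from Suc.IH[OF near[OF q(1)] e(1) this] obtain I where I: "I \<subseteq> {..k}" "card I = n"
      "\<forall>j\<in>I. \<exists>r. dist r base < \<rho> \<and> dist r q < e \<and> \<Phi> r \<in> E j \<and> ties r \<subseteq> ties q" by blast
    have close: "dist r p < d \<and> dist r p < \<delta>" if "dist r q < e" for r
    proof -
      have "dist r p \<le> dist r q + dist q p" by (rule dist_triangle)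
      then show ?thesis using that q(1) e by linarith
    qed
    have "j \<notin> I"
    proof
      assume "j \<in> I"
      then obtain r where "dist r base < \<rho>" "dist r q < e" "\<Phi> r \<in> E j" "ties r \<subseteq> ties q" using I by blast
      then show False using d(2) close q(2) by blast
    qed
    moreover have "finite I" by (rule finite_subset[OF I(1)]) simp
    ultimately have c: "card (insert j I) = Suc n" using I(2) by simp
    have w: "\<exists>r. dist r base < \<rho> \<and> dist r p < \<delta> \<and> \<Phi> r \<in> E j' \<and> ties r \<subseteq> ties p" if "j' \<in> insert j I" for j'
      using that
    proof
      assume "j' = j"
      have "dist p base < \<rho> \<and> dist p p < \<delta> \<and> \<Phi> p \<in> E j \<and> ties p \<subseteq> ties p" using j Suc.prems by simp
      then show ?thesis unfolding \<open>j' = j\<close> by blast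
    next
      assume "j' \<in> I"
      then obtain r where "dist r base < \<rho>" "dist r q < e" "\<Phi> r \<in> E j'" "ties r \<subseteq> ties q" using I by blast
      then show ?thesis using close q(2) by blast
    qed
    have "insert j I \<subseteq> {..k}" using I(1) j(1) by simp
    then show ?thesis using c w by blast
  qed
qed

theorem GC_lower:
  assumes "GC_partition T k" shows "k \<ge> 3"
proof -
  obtain E where E: "(\<Union>i\<le>k. E i) = T \<times> T" "\<And>i. i \<le> k \<Longrightarrow> admits_GMPR T (E i)"
    using assms unfolding GC_partition_def by auto
  obtain \<delta> where \<delta>: "\<delta> > 0" "\<And>p. dist p base < \<delta> \<Longrightarrow> good p" using good_near_base by blast
  define D where "D = (\<lambda>(i, j). odist (mid i base) (mid j base)) ` ({(i, j). i < 4 \<and> j < 4 \<and> i \<noteq> j})"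
  have sub: "{(i, j). i < 4 \<and> j < 4 \<and> i \<noteq> j} \<subseteq> {..<4} \<times> {..<4::nat}" by auto
  have fin: "finite D" unfolding D_def by (intro finite_imageI finite_subset[OF sub]) auto
  have positive: "odist (mid i base) (mid j base) > 0" if "i < 4" "j < 4" "i \<noteq> j" for i j
    using base_midpoints[OF that] odist_zero_iff[of "mid i base" "mid j base"] odist_nonneg[of "mid i base" "mid j base"]
    unfolding mid_def by (metis order_le_less)
  define \<eta> where "\<eta> = Min (insert 1 D)"
  have \<eta>: "\<eta> > 0" unfolding \<eta>_def using fin positive by (subst Min_gr_iff) (auto simp: D_def)
  \<comment> \<open>Two midpoints, each moving by less than \<eta>/4, keep at least half of their
    separation.\<close>
  define \<rho> where "\<rho> = min \<delta> (\<eta> / 4)"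
  have \<rho>: "\<rho> > 0" "\<rho> \<le> \<delta>" "\<rho> \<le> \<eta> / 4" using \<delta> \<eta> by (auto simp: \<rho>_def)
  have sep: "odist (mid i p) (mid j q) \<ge> \<eta> / 2" if h: "i < 4" "j < 4" "i \<noteq> j" "dist p base < \<rho>" "dist q base < \<rho>" for i j p q
  proof -
    have "\<eta> \<le> odist (mid i base) (mid j base)" unfolding \<eta>_def using fin h
      by (intro Min_le) (auto simp: D_def intro!: image_eqI[of _ _ "(i,j)"])
    also have "\<dots> \<le> odist (mid i p) (mid j q) + (dist (mid i base) (mid i p) + dist (mid j base) (mid j q))"
      using odist_lipschitz[of "mid i base" "mid j base" "mid i p" "mid j q"] by linarith
    also have "\<dots> \<le> odist (mid i p) (mid j q) + (dist p base + dist q base)"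
      using mid_lipschitz[of i base p] mid_lipschitz[of j base q] by (simp add: dist_commute)
    finally show ?thesis using h \<rho> by linarith
  qed
  have "\<exists>I\<subseteq>{..k}. card I = 4 \<and> (\<forall>j\<in>I. \<exists>r. dist r base < \<rho> \<and> dist r base < 1 \<and> \<Phi> r \<in> E j \<and> ties r \<subseteq> ties base)"
  proof (rule many_sets[where E = E and k = k and \<rho> = \<rho> and \<eta> = "\<eta> / 2"])
    show "T \<times> T \<subseteq> (\<Union>i\<le>k. E i)" using E(1) by simp
    show "good p" if "dist p base < \<rho>" for p using \<delta>(2)[of p] \<rho>(2) that by simp
    show "card (ties base) = 4" by (simp add: ties_base)
  qed (use E(2) sep \<eta> \<rho> in auto)
  then obtain I where "I \<subseteq> {..k}" "card I = 4" by blast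
  then have "4 \<le> card {..k}" using card_mono[of "{..k}" I] by simp
  then show ?thesis by simp
qed

end

section \<open>Stratification by the number of minimal geodesics\<close>

definition gpair :: "complex \<Rightarrow> complex \<Rightarrow> bool" where "gpair x y \<longleftrightarrow> grid x \<and> grid y"
text \<open>\<open>x + x \<in> lat\<close> says that x is the centre of a half-turn, that is, lies
  over a vertex.\<close>

definition vpair :: "complex \<Rightarrow> complex \<Rightarrow> bool" where "vpair x y \<longleftrightarrow> x + x \<in> lat \<or> y + y \<in> lat"
text \<open>Over a vertex the two labels of a geodesic have no preferred order, so pairs with a vertex
  and a single minimal geodesic are moved up one stratum.\<close>
definition level :: "complex \<Rightarrow> complex \<Rightarrow> nat" where
  "level x y = (if gpair x y then 4 else if ncount x y = 2 \<and> vpair x y then 2 else ncount x y - 1)"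

lemma double_lat_eqv: assumes "eqv x x'" shows "x + x \<in> lat \<longleftrightarrow> x' + x' \<in> lat"
proof -
  have *: "x' + x' \<in> lat" if "eqv x x'" "x + x \<in> lat" for x x'
    using that(1)
  proof (cases rule: eqv_cases)
    case (1 m)
    have "x' + x' = (x + x) + (m + m)" by (simp add: 1)
    then show ?thesis using lat_add[OF that(2) lat_add[OF 1(1) 1(1)]] by (simp only:)
  next
    case (2 m)
    have "x' + x' = (m + m) - (x + x)" by (simp add: 2)
    then show ?thesis using lat_diff[OF lat_add[OF 2(1) 2(1)] that(2)] by (simp only:)
  qed
  show ?thesis using *[OF assms] *[OF eqv_sym[OF assms]] by blast
qed

lemma level_eqv: assumes "eqv x x'" "eqv y y'" shows "level x' y' = level x y"
proof -
  have "gpair x' y' = gpair x y" unfolding gpair_def using assms grid_eqv eqv_sym by metis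
  moreover have "vpair x' y' = vpair x y" unfolding vpair_def using double_lat_eqv assms by blast
  ultimately show ?thesis unfolding level_def by (simp add: ncount_eqv[OF assms])
qed

text \<open>The half-turn about the vertex fixes that point and exchanges the two label sets. In
  particular the count at a vertex pair is even.\<close>

lemma card_vpair: assumes "vpair x y" shows "card (nu x y) = card (nw x y)"
  using card_ties_shift(3)[of "x + x" x y] card_ties_shift(7)[of "y + y" x y] assms unfolding vpair_def by fastforce

lemma ncount_le_4: assumes "\<not> gpair x y" shows "ncount x y \<le> 4"
  using card_le_2[of x y] assms unfolding gpair_def ncount_def by linarith

lemma level_le: "level x y \<le> 4" using ncount_le_4[of x y] by (auto simp: level_def)

lemma closed_double_lat: "closed {x. x + x \<in> lat}"
proof -
  have "{x. x + x \<in> lat} = (\<lambda>x. x + x) -` lat" by auto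
  then show ?thesis by (simp add: closed_vimage closed_lat continuous_intros)
qed

lemma closed_avoid: fixes S :: "complex set" assumes "closed S" "x \<notin> S"
  shows "\<exists>e>0. \<forall>x'. dist x' x < e \<longrightarrow> x' \<notin> S"
proof -
  have "open (- S)" "x \<in> - S" using assms by auto
  then show ?thesis unfolding open_dist by auto
qed

lemma gpair_avoid: assumes "\<not> gpair x y"
  shows "\<exists>e>0. \<forall>x' y'. dist x' x < e \<longrightarrow> dist y' y < e \<longrightarrow> \<not> gpair x' y'"
proof (cases "grid x")
  case True
  then have "y \<notin> {x. grid x}" using assms by (simp add: gpair_def)
  from closed_avoid[OF closed_grid this] show ?thesis unfolding gpair_def by blast
next
  case False
  then have "x \<notin> {x. grid x}" by simp
  from closed_avoid[OF closed_grid this] show ?thesis unfolding gpair_def by blast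
qed

lemma vpair_avoid: assumes "\<not> vpair x y"
  shows "\<exists>e>0. \<forall>x' y'. dist x' x < e \<longrightarrow> dist y' y < e \<longrightarrow> \<not> vpair x' y'"
proof -
  have n: "x \<notin> {x. x + x \<in> lat}" "y \<notin> {x. x + x \<in> lat}" using assms by (auto simp: vpair_def)
  obtain e1 where e1: "e1 > 0" "\<forall>x'. dist x' x < e1 \<longrightarrow> x' \<notin> {x. x + x \<in> lat}" using closed_avoid[OF closed_double_lat n(1)] by blast
  obtain e2 where e2: "e2 > 0" "\<forall>x'. dist x' y < e2 \<longrightarrow> x' \<notin> {x. x + x \<in> lat}" using closed_avoid[OF closed_double_lat n(2)] by blast
  show ?thesis using e1 e2 by (intro exI[of _ "min e1 e2"]) (auto simp: vpair_def)
qed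

text \<open>Counts can only drop nearby, and grid pairs and vertex pairs form closed sets. The
  delicate level is 2, which unites vertex pairs of count 2 with pairs of count 3; these two kinds
  do not meet locally.\<close>

lemma level_local:
  assumes "\<not> gpair x y"
  shows "\<exists>e>0. \<forall>x' y'. dist x' x < e \<longrightarrow> dist y' y < e \<longrightarrow>
    level x' y' \<le> level x y \<and> (level x' y' = level x y \<longrightarrow> nu x' y' = nu x y \<and> nw x' y' = nw x y)"
proof -
  obtain e1 where e1: "e1 > 0" "\<forall>x' y'. dist x' x < e1 \<longrightarrow> dist y' y < e1 \<longrightarrow> \<not> gpair x' y'"
    using gpair_avoid[OF assms] by blast
  obtain e2 where e2: "e2 > 0" "\<forall>x' y'. dist x' x < e2 \<longrightarrow> dist y' y < e2 \<longrightarrow>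
     ncount x' y' \<le> ncount x y \<and> (ncount x' y' = ncount x y \<longrightarrow> nu x' y' = nu x y \<and> nw x' y' = nw x y)"
    using ties_locally_eq[of x y] by (elim exE conjE)
  obtain e3 where e3: "e3 > 0" "\<forall>x' y'. dist x' x < e3 \<longrightarrow> dist y' y < e3 \<longrightarrow> vpair x' y' \<longrightarrow> vpair x y"
  proof (cases "vpair x y")
    case False
    then show ?thesis using vpair_avoid[OF False] that by blast
  qed (use that[of 1] in auto)
  show ?thesis
  proof (intro exI[of _ "min e1 (min e2 e3)"] conjI allI impI)
    show "min e1 (min e2 e3) > 0" using e1(1) e2(1) e3(1) by simp
    fix x' y' assume "dist x' x < min e1 (min e2 e3)" "dist y' y < min e1 (min e2 e3)"
    then have d: "dist x' x < e1" "dist y' y < e1" "dist x' x < e2" "dist y' y < e2" "dist x' x < e3" "dist y' y < e3"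
      by simp_all
    then have h: "\<not> gpair x' y'" "ncount x' y' \<le> ncount x y" "vpair x' y' \<Longrightarrow> vpair x y"
      and same: "ncount x' y' = ncount x y \<longrightarrow> nu x' y' = nu x y \<and> nw x' y' = nw x y"
      using e1(2)[rule_format, OF d(1,2)] e2(2)[rule_format, OF d(3,4)] e3(2)[rule_format, OF d(5,6)] by simp_all
    \<comment> \<open>By parity a pair of count 3 is no vertex pair, so no vertex pair, possibly of
      count 2 and equal level, lies near it.\<close>
    have n3: "ncount x y \<noteq> 3" if "vpair x y" using card_vpair[OF that] unfolding ncount_def by presburger
    have p: "ncount x' y' \<ge> 1" by (rule ncount_pos)
    show "level x' y' \<le> level x y" unfolding level_def using h assms by auto
    assume "level x' y' = level x y"
    then have "ncount x' y' = ncount x y" unfolding level_def using h assms n3 p by (auto split: if_splits)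
    then show "nu x' y' = nu x y" "nw x' y' = nw x y" using same by auto
  qed
qed

lemma nu_zero_iff: "0 \<in> nu x y \<longleftrightarrow> dist x y = odist x y"
  by (simp add: nu_def near_def dist_norm norm_minus_commute)

lemma ties_translate: assumes "m \<in> lat"
  shows "l \<in> nu (x + m) (y + m) \<longleftrightarrow> l \<in> nu x y" "l \<in> nw (x + m) (y + m) \<longleftrightarrow> l - (m + m) \<in> nw x y"
  by (simp_all add: ties_shift[OF assms] diff_diff_eq)

lemma ties_negate: "l \<in> nu (- x) (- y) \<longleftrightarrow> - l \<in> nu x y" "l \<in> nw (- x) (- y) \<longleftrightarrow> - l \<in> nw x y"
  using ties_shift(3)[OF lat_0, of l x "- y"] ties_shift(8)[OF lat_0, of l x y]
    ties_shift(4)[OF lat_0, of l x "- y"] ties_shift(7)[OF lat_0, of l x y] by simp_all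

lemma level_translate: "m \<in> lat \<Longrightarrow> level (x + m) (y + m) = level x y" "level (- x) (- y) = level x y"
  by (rule level_eqv; simp add: eqv_def)+

lemma minimal_cases:
  assumes "eqv x x''" "0 \<in> nu x'' y"
  obtains l where "x'' = x + l" "l \<in> nu x y" | l where "x'' = l - x" "l \<in> nw x y"
  using assms(1)
proof (cases rule: eqv_cases)
  case (1 m)
  then show ?thesis using assms(2) that(1)[of m] ties_shift(1)[OF 1(1), of 0 x y] by simp
next
  case (2 m)
  then show ?thesis using assms(2) that(2)[of m] ties_shift(3)[OF 2(1), of 0 x y] by simp
qed

section \<open>Signs of labels and orientation of triangles\<close>

definition positive :: "complex \<Rightarrow> bool" where "positive l \<longleftrightarrow> pc l > 0 \<or> (pc l = 0 \<and> qc l > 0)"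

lemma positive_minus: "l \<noteq> 0 \<Longrightarrow> positive (- l) \<longleftrightarrow> \<not> positive l"
  using coord_eqI[of l 0] unfolding positive_def coord_linear by linarith

text \<open>\<open>w\<close> lies in a triangle of \<^const>\<open>lat\<close> with the same orientation as 0, (2, 0), (0, 2).\<close>
definition upward :: "complex \<Rightarrow> bool" where
  "upward w \<longleftrightarrow> \<lfloor>(pc w + qc w) / 2\<rfloor> = \<lfloor>pc w / 2\<rfloor> + \<lfloor>qc w / 2\<rfloor>"

lemma upward_add_lat: assumes "m \<in> lat" shows "upward (w + m) \<longleftrightarrow> upward w"
proof -
  obtain i j :: int where ij: "pc m = 2 * of_int i" "qc m = 2 * of_int j" using assms by (rule latE)
  have "(pc (w + m) + qc (w + m)) / 2 = (pc w + qc w) / 2 + of_int (i + j)"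
    "pc (w + m) / 2 = pc w / 2 + of_int i" "qc (w + m) / 2 = qc w / 2 + of_int j"
    by (simp_all add: ij field_simps)
  then show ?thesis unfolding upward_def by (simp only: floor_add_int[symmetric]) simp
qed

text \<open>w lies on no line of the triangulation by \<open>lat\<close>; only across these lines
  can \<open>upward\<close> change.\<close>

definition generic :: "complex \<Rightarrow> bool" where
  "generic w \<longleftrightarrow> pc w / 2 \<notin> \<int> \<and> qc w / 2 \<notin> \<int> \<and> (pc w + qc w) / 2 \<notin> \<int>"

lemma floor_minus_nonint: fixes t :: real assumes "t \<notin> \<int>" shows "\<lfloor>- t\<rfloor> = - \<lfloor>t\<rfloor> - 1"
proof -
  have "t \<noteq> of_int \<lfloor>t\<rfloor>" using assms by (metis Ints_of_int)
  then have "of_int \<lfloor>t\<rfloor> < t" "t < of_int \<lfloor>t\<rfloor> + 1" using of_int_floor_le[of t] by linarith+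
  then show ?thesis by (intro floor_unique) (simp only: of_int_diff of_int_minus of_int_1, linarith)+
qed

text \<open>Negating a non-integer t turns its floor into \<open>- \<lfloor>t\<rfloor> - 1\<close>.
  With two floors on one side and one on the other, the two possible relations between them are
  exchanged.\<close>

lemma upward_minus: assumes "generic w" shows "upward (- w) \<longleftrightarrow> \<not> upward w"
proof -
  have e: "(pc (- w) + qc (- w)) / 2 = - ((pc w + qc w) / 2)" "pc (- w) / 2 = - (pc w / 2)" "qc (- w) / 2 = - (qc w / 2)"
    by (simp_all only: coord_linear minus_add_distrib minus_divide_left)
  have "\<lfloor>(pc w + qc w) / 2\<rfloor> = \<lfloor>pc w / 2\<rfloor> + \<lfloor>qc w / 2\<rfloor> \<or> \<lfloor>(pc w + qc w) / 2\<rfloor> = \<lfloor>pc w / 2\<rfloor> + \<lfloor>qc w / 2\<rfloor> + 1"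
    by (simp add: add_divide_distrib) linarith
  then show ?thesis unfolding upward_def e using assms by (auto simp: generic_def floor_minus_nonint)
qed

lemma floor_local: fixes t :: real assumes "t \<notin> \<int>"
  shows "\<exists>e>0. \<forall>t'. \<bar>t' - t\<bar> < e \<longrightarrow> \<lfloor>t'\<rfloor> = \<lfloor>t\<rfloor>"
proof -
  have "t \<noteq> of_int \<lfloor>t\<rfloor>" using assms by (metis Ints_of_int)
  then have h: "of_int \<lfloor>t\<rfloor> < t" "t < of_int \<lfloor>t\<rfloor> + 1" using of_int_floor_le[of t] by linarith+
  define e where "e = min (t - of_int \<lfloor>t\<rfloor>) (of_int \<lfloor>t\<rfloor> + 1 - t)"
  have "e > 0" using h by (simp add: e_def)
  moreover have "\<lfloor>t'\<rfloor> = \<lfloor>t\<rfloor>" if "\<bar>t' - t\<bar> < e" for t'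
    using that unfolding e_def by (intro floor_unique) linarith+
  ultimately show ?thesis by blast
qed

lemma upward_local: assumes "generic w" shows "\<exists>e>0. \<forall>w'. dist w' w < e \<longrightarrow> upward w' = upward w"
proof -
  obtain a where a: "a > 0" "\<forall>t'. \<bar>t' - pc w / 2\<bar> < a \<longrightarrow> \<lfloor>t'\<rfloor> = \<lfloor>pc w / 2\<rfloor>"
    using floor_local assms unfolding generic_def by blast
  obtain b where b: "b > 0" "\<forall>t'. \<bar>t' - qc w / 2\<bar> < b \<longrightarrow> \<lfloor>t'\<rfloor> = \<lfloor>qc w / 2\<rfloor>"
    using floor_local assms unfolding generic_def by blast
  obtain c where c: "c > 0" "\<forall>t'. \<bar>t' - (pc w + qc w) / 2\<bar> < c \<longrightarrow> \<lfloor>t'\<rfloor> = \<lfloor>(pc w + qc w) / 2\<rfloor>"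
    using floor_local assms unfolding generic_def by blast
  define e where "e = min a (min b c) / 2"
  have e: "e > 0" "2 * e \<le> a" "2 * e \<le> b" "2 * e \<le> c" using a(1) b(1) c(1) by (auto simp: e_def)
  have "upward w' = upward w" if "dist w' w < e" for w'
  proof -
    have n: "\<bar>pc w' - pc w\<bar> \<le> 2 * norm (w' - w)" "\<bar>qc w' - qc w\<bar> \<le> 2 * norm (w' - w)" "norm (w' - w) < e"
      using coord_le_norm[of "w' - w"] that by (simp_all add: dist_norm)
    have 1: "\<bar>pc w' / 2 - pc w / 2\<bar> < a" using n(1,3) e by linarith
    have 2: "\<bar>qc w' / 2 - qc w / 2\<bar> < b" using n(2,3) e by linarith
    have 3: "\<bar>(pc w' + qc w') / 2 - (pc w + qc w) / 2\<bar> < c"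
    proof -
      have "\<bar>(pc w' + qc w') / 2 - (pc w + qc w) / 2\<bar> = \<bar>(pc w' / 2 - pc w / 2) + (qc w' / 2 - qc w / 2)\<bar>"
        by (simp add: add_divide_distrib)
      moreover have "\<bar>pc w' / 2 - pc w / 2\<bar> < e" "\<bar>qc w' / 2 - qc w / 2\<bar> < e" using n by linarith+
      ultimately show ?thesis using abs_triangle_ineq[of "pc w' / 2 - pc w / 2" "qc w' / 2 - qc w / 2"] e(4) by linarith
    qed
    show ?thesis unfolding upward_def a(2)[rule_format, OF 1] b(2)[rule_format, OF 2] c(2)[rule_format, OF 3] ..
  qed
  then show ?thesis using e(1) by blast
qed

lemma nu_norm2:
  assumes "0 \<in> nu x y" "l \<in> nu x y" "l \<noteq> 0"
  shows "(pc l, qc l) \<in> {(2,0), (-2,0), (0,2), (0,-2), (2,-2), (-2,2)}" "norm l = 2"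
proof -
  have h: "hex (y - x)" using near_hex[OF odist_le_infdist(1)[of x y], of 0] assms(1) by (simp add: nu_def)
  show six: "(pc l, qc l) \<in> {(2,0), (-2,0), (0,2), (0,-2), (2,-2), (-2,2)}"
    by (rule hex_nearest_eq[OF h]) (use assms in \<open>auto simp: nu_def near_def\<close>)
  then have "(norm l)\<^sup>2 = 2\<^sup>2" unfolding norm_coord by auto
  then show "norm l = 2" by (rule power2_eq_imp_eq) auto
qed

text \<open>Two lattice points nearest to u are 2 apart, so u is at least 1 from each. This provides
  the radius needed in \<open>generic_sum\<close>.\<close>

lemma odist_ge_1: assumes "0 \<in> nu x y" "l \<in> nu x y" "l \<noteq> 0" shows "odist x y \<ge> 1"
proof -
  have "norm l \<le> norm (y - x) + norm (y - x - l)" using norm_triangle_ineq4[of "y - x" "y - x - l"] by simp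
  then show ?thesis using assms nu_norm2(2)[OF assms] by (simp add: nu_def near_def)
qed

text \<open>Unit discs about the lattice points cover all edges of the triangulation by \<^const>\<open>lat\<close>.\<close>
lemma generic_sum:
  assumes "odist x y \<ge> 1" "nw x y = {}" shows "generic (y + x)"
proof -
  have far: "norm (y + x - m) > 1" if "m \<in> lat" for m
    using odist_le(2)[OF that, of x y] assms that by (auto simp: nw_def near_def order_less_le)
  define w where "w = y + x"
  have near1: "\<bar>r\<bar> \<le> 1 \<Longrightarrow> r\<^sup>2 \<le> 1" for r :: real by (simp add: abs_square_le_1)
  have N: "norm z \<le> 1" if "(pc z)\<^sup>2 + pc z * qc z + (qc z)\<^sup>2 \<le> 1" for z
    using that unfolding norm_coord[symmetric] by (simp add: abs_square_le_1)
  have a: "pc w / 2 \<notin> \<int>"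
  proof
    assume "pc w / 2 \<in> \<int>"
    then obtain i :: int where "pc w / 2 = of_int i" by (auto elim: Ints_cases)
    moreover obtain j :: int where j: "\<bar>qc w - 2 * of_int j\<bar> \<le> 1" using tw_reduce by blast
    ultimately have "norm (w - pt (2 * of_int i) (2 * of_int j)) \<le> 1"
      by (intro N) (simp add: near1 field_simps)
    then show False using far[OF pt_lat[of i j]] by (simp add: w_def)
  qed
  have b: "qc w / 2 \<notin> \<int>"
  proof
    assume "qc w / 2 \<in> \<int>"
    then obtain i :: int where "qc w / 2 = of_int i" by (auto elim: Ints_cases)
    moreover obtain j :: int where j: "\<bar>pc w - 2 * of_int j\<bar> \<le> 1" using tw_reduce by blast
    ultimately have "norm (w - pt (2 * of_int j) (2 * of_int i)) \<le> 1"
      by (intro N) (simp add: near1 field_simps)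
    then show False using far[OF pt_lat[of j i]] by (simp add: w_def)
  qed
  have c: "(pc w + qc w) / 2 \<notin> \<int>"
  proof
    assume "(pc w + qc w) / 2 \<in> \<int>"
    then obtain i :: int where i: "(pc w + qc w) / 2 = of_int i" by (auto elim: Ints_cases)
    obtain j :: int where j: "\<bar>pc w - 2 * of_int j\<bar> \<le> 1" using tw_reduce by blast
    define r where "r = pc w - 2 * of_int j"
    have q: "qc w - 2 * of_int (i - j) = - r" "pc w - 2 * of_int j = r" using i by (simp_all add: r_def field_simps)
    have "norm (w - pt (2 * of_int j) (2 * of_int (i - j))) \<le> 1"
      by (intro N) (use near1[of r] j q in \<open>simp add: r_def[symmetric] power2_eq_square\<close>)
    then show False using far[OF pt_lat[of j "i - j"]] by (simp add: w_def)
  qed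
  show ?thesis using a b c by (simp add: generic_def w_def)
qed

lemma collinear_equal_norm:
  fixes u w :: complex
  assumes "norm u = norm w" "Im (cnj u * w) = 0" shows "w = u \<or> w = - u"
proof (cases "u = 0")
  case True
  then show ?thesis using assms(1) by simp
next
  case False
  define r where "r = Re (cnj u * w)"
  have c: "cnj u * w = of_real r" using assms(2) by (simp add: complex_eq_iff r_def)
  have "\<bar>r\<bar> = norm u * norm u" using arg_cong[OF c, of norm] assms(1) by (simp add: norm_mult)
  then have "r = norm u * norm u \<or> r = - (norm u * norm u)" by linarith
  moreover have "of_real (norm u * norm u) = cnj u * u" by (simp add: complex_norm_square[symmetric] power2_eq_square mult.commute flip: of_real_mult)
  ultimately have "cnj u * w = cnj u * u \<or> cnj u * w = cnj u * (- u)" using c by auto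
  then show ?thesis using False by (metis complex_cnj_zero_iff mult_left_cancel)
qed

lemma complex_eq_of_Re_norm:
  fixes a b :: complex
  assumes "norm a = norm b" "Re a = Re b" "Im a > 0" "Im b > 0" shows "a = b"
proof -
  have "(norm a)\<^sup>2 = (norm b)\<^sup>2" using assms(1) by simp
  then have "(Im a)\<^sup>2 = (Im b)\<^sup>2" unfolding cmod_power2 using assms(2) by simp
  then show ?thesis using assms by (simp add: complex_eq_iff power2_eq_iff)
qed

lemma bisector_Re:
  fixes v l :: complex
  assumes "norm (v - l) = norm v" shows "Re (cnj l * v) = (norm l)\<^sup>2 / 2"
proof -
  have "(norm (v - l))\<^sup>2 = (norm v)\<^sup>2" using assms by simp
  then show ?thesis unfolding cmod_power2 by (simp add: power2_eq_square algebra_simps)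
qed

lemma bisector_center:
  fixes v l :: complex
  assumes "norm (v - l) = norm v" "l \<noteq> 0" "Im (cnj l * v) = 0" shows "2 * v = l"
proof -
  have "cnj l * (2 * v) = cnj l * l"
    using bisector_Re[OF assms(1)] assms(3)
    by (simp add: complex_eq_iff cmod_power2) (simp add: power2_eq_square algebra_simps)
  then show ?thesis using assms(2) by simp
qed

section \<open>Selection rules on the strata\<close>

definition rule0 :: "complex \<Rightarrow> complex \<Rightarrow> bool" where
  "rule0 x y \<longleftrightarrow> level x y = 0 \<and> 0 \<in> nu x y"

text \<open>If both nearest points belong to \<open>u\<close>, reversing the roles of the two negates \<open>l\<close>, and the half-turn
  negates both \<open>l\<close> and \<open>w\<close>, so the triangle containing \<open>w\<close> decides.  If one belongs to \<open>u\<close> and one to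
  \<open>w\<close>, the sense of rotation from one to the other decides.\<close>
definition rule1 :: "complex \<Rightarrow> complex \<Rightarrow> bool" where
  "rule1 x y \<longleftrightarrow> level x y = 1 \<and> 0 \<in> nu x y \<and>
     ((\<exists>l\<in>nu x y. l \<noteq> 0 \<and> (positive l \<longleftrightarrow> upward (y + x))) \<or> (\<exists>l\<in>nw x y. Im (cnj (y - x) * (y + x - l)) < 0))"

text \<open>On this level some side has exactly one label, and that one is taken. At a vertex pair
  both sides have one, but the two labels name the same geodesic.\<close>

definition rule2 :: "complex \<Rightarrow> complex \<Rightarrow> bool" where
  "rule2 x y \<longleftrightarrow> level x y = 2 \<and> nu x y = {0}"

text \<open>The direction, up to sign, of one of the six shortest vectors.\<close>
definition kind :: "complex \<Rightarrow> nat" where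
  "kind l = (if qc l = 0 then 0 else if pc l = 0 then 1 else 2)"

text \<open>\<open>Im (cnj l * (y - x))\<close> vanishes exactly in the middle of an edge of the cell, and such pairs lie
  on the grid.\<close>
definition rule3 :: "complex \<Rightarrow> complex \<Rightarrow> bool" where
  "rule3 x y \<longleftrightarrow> level x y = 3 \<and> 0 \<in> nu x y \<and>
     (\<exists>l\<in>nu x y. l \<noteq> 0 \<and> Im (cnj l * (y - x)) > 0 \<and>
       (\<exists>m\<in>nw x y. \<exists>m'\<in>nw x y. m \<noteq> m' \<and> kind l \<le> kind (m - m')))"

lemma kind_minus [simp]: "kind (- l) = kind l" by (simp add: kind_def)

lemma two_elems: assumes "card S = 2" "a \<in> S" obtains b where "S = {a, b}" "b \<noteq> a"
  using assms unfolding card_2_iff by (metis doubleton_eq_iff insertE singletonD)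

lemma one_elem: assumes "card S = 1" "a \<in> S" shows "S = {a}"
  using assms by (metis card_1_singletonE singletonD)

lemma level_facts:
  "level x y = 0 \<Longrightarrow> ncount x y = 1 \<and> \<not> gpair x y"
  "level x y = 1 \<Longrightarrow> ncount x y = 2 \<and> \<not> vpair x y \<and> \<not> gpair x y"
  "level x y = 2 \<Longrightarrow> (ncount x y = 3 \<or> ncount x y = 2 \<and> vpair x y) \<and> \<not> gpair x y"
  "level x y = 3 \<Longrightarrow> ncount x y = 4 \<and> \<not> gpair x y"
  using ncount_pos[of x y] by (auto simp: level_def split: if_splits)

lemma card_pos: "l \<in> nu x y \<Longrightarrow> card (nu x y) \<ge> 1" "l \<in> nw x y \<Longrightarrow> card (nw x y) \<ge> 1"
  by (metis Suc_leI card_gt_0_iff empty_iff finite_ties One_nat_def)+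

lemma cards_3:
  assumes "level x y = 3" shows "card (nu x y) = 2" "card (nw x y) = 2"
  using level_facts(4)[OF assms] card_le_2[of x y] unfolding gpair_def ncount_def by linarith+

lemma rule1_cases:
  assumes "level x y = 1" "0 \<in> nu x y"
  obtains (two) l where "nu x y = {0, l}" "l \<noteq> 0" "nw x y = {}" | (one) l where "nu x y = {0}" "nw x y = {l}"
proof -
  have n: "card (nu x y) + card (nw x y) = 2" using level_facts(2)[OF assms(1)] by (simp add: ncount_def)
  show ?thesis
  proof (cases "card (nu x y) = 2")
    case True
    then have "nw x y = {}" using n by simp
    then show ?thesis using two_elems[OF True assms(2)] two by metis
  next
    case False
    then have "card (nu x y) = 1" "card (nw x y) = 1" using n card_pos(1)[OF assms(2)] by linarith+
    then show ?thesis using one_elem[OF _ assms(2)] one by (metis card_1_singletonE)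
  qed
qed

section \<open>Checking the rules for two and three labels\<close>

lemma rule1_core:
  assumes r: "rule1 x y" and r': "rule1 x'' y" and e: "eqv x x''"
  shows "x'' = x"
proof -
  have i: "level x y = 1" "0 \<in> nu x y" "0 \<in> nu x'' y" using r r' by (auto simp: rule1_def)
  show ?thesis
    using e i(3)
  proof (cases rule: minimal_cases)
    case (1 l)
    show ?thesis
    proof (rule ccontr)
      assume "x'' \<noteq> x"
      then have l: "l \<noteq> 0" "l \<in> lat" using 1 by (auto simp: nu_def near_def)
      have AB: "nu x y = {0, l}" "nw x y = {}"
      proof -
        have "nu x y = {0, l} \<and> nw x y = {}"
          using i(1,2)
        proof (cases rule: rule1_cases)
          case (two k)
          then show ?thesis using 1(2) l(1) by auto
        next
          case (one k)
          then show ?thesis using 1(2) l(1) by auto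
        qed
        then show "nu x y = {0, l}" "nw x y = {}" by simp_all
      qed
      have "nw x'' y = {}" using AB(2) ties_shift(2)[OF l(2), of _ x y] 1 by auto
      then obtain k where k: "k \<in> nu x'' y" "k \<noteq> 0" "positive k \<longleftrightarrow> upward (y + x'')"
        using r' unfolding rule1_def by blast
      have "k + l \<in> {0, l}" using ties_shift(1)[OF l(2), of k x y] 1 AB(1) k(1) by blast
      then have "k = - l" using k(2) by (auto simp: eq_neg_iff_add_eq_0)
      then have "positive (- l) \<longleftrightarrow> upward (y + x'')" using k(3) by simp
      moreover have "upward (y + x'') \<longleftrightarrow> upward (y + x)" using upward_add_lat[OF l(2), of "y + x"] by (simp add: 1 add.assoc)
      moreover have "positive l \<longleftrightarrow> upward (y + x)" using r unfolding rule1_def AB by blast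
      ultimately show False using positive_minus[OF l(1)] by blast
    qed
  next
    case (2 l)
    then have l: "l \<in> lat" by (auto simp: nw_def near_def)
    have AB: "nu x y = {0}" "nw x y = {l}"
    proof -
      have "nu x y = {0} \<and> nw x y = {l}"
        using i(1,2)
      proof (cases rule: rule1_cases)
        case (two k)
        then show ?thesis using 2(2) by auto
      next
        case (one k)
        then show ?thesis using 2(2) by auto
      qed
      then show "nu x y = {0}" "nw x y = {l}" by simp_all
    qed
    have a: "k = 0" if "k \<in> nu x'' y" for k using ties_shift(3)[OF l, of k x y] 2 AB(2) that by simp
    have b: "k = l" if "k \<in> nw x'' y" for k using ties_shift(4)[OF l, of k x y] 2 AB(1) that by simp
    have "Im (cnj (y - x'') * (y + x'' - l)) < 0" using r' a b unfolding rule1_def by blast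
    then have "Im (cnj (y + x - l) * (y - x)) < 0" by (simp add: 2 algebra_simps)
    moreover have "Im (cnj (y - x) * (y + x - l)) < 0" using r unfolding rule1_def AB by blast
    moreover have "Im (cnj a * b) = - Im (cnj b * a)" for a b by (simp add: algebra_simps)
    ultimately show ?thesis by (metis neg_0_less_iff_less not_less_iff_gr_or_eq)
  qed
qed

lemma rule1_ex:
  assumes i: "level x y = 1" and z: "0 \<in> nu x y"
  shows "\<exists>x'. eqv x x' \<and> rule1 x' y"
  using i z
proof (cases rule: rule1_cases)
  case (two l)
  show ?thesis
  proof (cases "positive l \<longleftrightarrow> upward (y + x)")
    case True
    then show ?thesis using i z two by (intro exI[of _ x]) (auto simp: rule1_def)
  next
    case False
    have l: "l \<in> nu x y" "l \<in> lat" using two by (auto simp: nu_def near_def)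
    have "0 \<in> nu (x + l) y" "- l \<in> nu (x + l) y" using l z ties_shift(1)[OF l(2)] by simp_all
    moreover have "upward (y + (x + l)) \<longleftrightarrow> upward (y + x)" using upward_add_lat[OF l(2), of "y + x"] by (simp add: add.assoc)
    moreover have e: "eqv x (x + l)" using l by (simp add: eqv_def)
    moreover have "level (x + l) y = 1" using i level_eqv[OF e eqv_refl] by simp
    ultimately have "rule1 (x + l) y" unfolding rule1_def using False positive_minus[OF two(2)] two(2)
      by (intro conjI disjI1 bexI[of _ "- l"]) auto
    then show ?thesis using e by blast
  qed
next
  case (one l)
  have l: "l \<in> nw x y" "l \<in> lat" using one by (auto simp: nw_def near_def)
  have n: "norm (y - x) = norm (y + x - l)" using l(1) z by (simp add: nu_def nw_def near_def)
  consider "Im (cnj (y - x) * (y + x - l)) < 0" | "Im (cnj (y - x) * (y + x - l)) = 0" | "Im (cnj (y - x) * (y + x - l)) > 0"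
    by linarith
  then show ?thesis
  proof cases
    case 1
    then show ?thesis using i z one by (intro exI[of _ x]) (auto simp: rule1_def)
  next
    case 2
    \<comment> \<open>Equal length and collinearity would make x or y a vertex, and vertex pairs are
      not on level 1.\<close>
    have "y + x - l = y - x \<or> y + x - l = - (y - x)" by (rule collinear_equal_norm[OF n 2])
    then have "x + x = l \<or> y + y = l" by (auto simp: algebra_simps)
    then have "vpair x y" using l(2) by (auto simp: vpair_def)
    then show ?thesis using level_facts(2)[OF i] by simp
  next
    case 3
    have "0 \<in> nu (l - x) y" "l \<in> nw (l - x) y" using l z ties_shift(3,4)[OF l(2)] by simp_all
    moreover have e: "eqv x (l - x)" using l by (simp add: eqv_def)
    moreover have "level (l - x) y = 1" using i level_eqv[OF e eqv_refl] by simp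
    moreover have "Im (cnj (y - (l - x)) * (y + (l - x) - l)) < 0" using 3 by (simp add: algebra_simps)
    ultimately have "rule1 (l - x) y" unfolding rule1_def by blast
    then show ?thesis using e by blast
  qed
qed

lemma rule1_translate:
  assumes "rule1 x y" "m \<in> lat" shows "rule1 (x + m) (y + m)"
proof -
  have u: "upward (y + m + (x + m)) \<longleftrightarrow> upward (y + x)"
    using upward_add_lat[OF lat_add[OF assms(2,2)], of "y + x"] by (simp add: algebra_simps)
  have v: "y + m + (x + m) - (l + (m + m)) = y + x - l" for l by simp
  have B: "l + (m + m) \<in> nw (x + m) (y + m)" if "l \<in> nw x y" for l using that ties_translate(2)[OF assms(2)] by simp
  show ?thesis using assms(1) unfolding rule1_def ties_translate(1)[OF assms(2)] level_translate(1)[OF assms(2)] u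
    using B v ties_translate(1)[OF assms(2), of _ x y] by (metis add_diff_cancel_right)
qed

lemma rule1_negate:
  assumes "rule1 x y" shows "rule1 (- x) (- y)"
proof -
  have i: "level x y = 1" "0 \<in> nu x y" using assms by (auto simp: rule1_def)
  have j: "level (- x) (- y) = 1" "0 \<in> nu (- x) (- y)" using i by (simp_all add: level_translate ties_negate)
  from i show ?thesis
  proof (cases rule: rule1_cases)
    case (two l)
    \<comment> \<open>A tie for u makes \<open>odist\<close> at least 1, and w has no label, so w
      avoids all edges; the half-turn then reverses its triangle together with the sign of
      l.\<close>
    have "generic (y + x)" by (rule generic_sum[OF odist_ge_1[OF i(2), of l] two(3)]) (use two in auto)
    then have "upward (- y + - x) \<longleftrightarrow> \<not> upward (y + x)" using upward_minus[of "y + x"] by simp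
    moreover have "positive l \<longleftrightarrow> upward (y + x)" using assms two by (auto simp: rule1_def)
    ultimately have "- l \<noteq> 0 \<and> (positive (- l) \<longleftrightarrow> upward (- y + - x))" using positive_minus[OF two(2)] two(2) by simp
    moreover have "- l \<in> nu (- x) (- y)" using two by (simp add: ties_negate)
    ultimately show ?thesis unfolding rule1_def using j by blast
  next
    case (one l)
    have "Im (cnj (y - x) * (y + x - l)) < 0" using assms one by (auto simp: rule1_def)
    then have "Im (cnj (- y - (- x)) * (- y + (- x) - (- l))) < 0" by (simp add: algebra_simps)
    moreover have "- l \<in> nw (- x) (- y)" using one by (simp add: ties_negate)
    ultimately show ?thesis unfolding rule1_def using j by blast
  qed
qed

text \<open>Two selected lifts can differ only at a vertex pair. If y is the vertex, they are
  exchanged by the half-turn about y and still fold to the same geodesic, which is the second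
  alternative.\<close>

lemma rule2_core:
  assumes r: "rule2 x y" and r': "rule2 x'' y" and e: "eqv x x''"
  shows "x'' = x \<or> (x + x'' = y + y \<and> y + y \<in> lat)"
proof -
  have A: "nu x y = {0}" and z: "0 \<in> nu x'' y" using r r' by (auto simp: rule2_def)
  from e z show ?thesis
  proof (cases rule: minimal_cases)
    case (1 l)
    then show ?thesis using A by simp
  next
    case (2 l)
    then have l: "l \<in> lat" by (auto simp: nw_def near_def)
    have "k \<in> nw x y \<longleftrightarrow> k = l" for k
      using ties_shift(3)[OF l, of "k - l" x y] 2 r' by (auto simp: rule2_def)
    then have "nw x y = {l}" by blast
    then have "ncount x y = 2" using A by (simp add: ncount_def)
    then have "vpair x y" using level_facts(3)[of x y] r by (simp add: rule2_def)
    then show ?thesis unfolding vpair_def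
    proof
      assume "x + x \<in> lat"
      then have "l - (x + x) \<in> nu x y"
        using ties_shift(3)[of "x + x" "l - (x + x)" x y] 2 by simp
      then show ?thesis using A 2 by simp
    next
      assume y: "y + y \<in> lat"
      then have "y + y - l \<in> nu x y" using ties_shift(7)[OF y, of "y + y - l" x y] 2 by simp
      then show ?thesis using A 2 y by simp
    qed
  qed
qed

text \<open>Either the counts 1 and 2 add up to 3, or a vertex pair has equal counts adding up to 2.
  In both cases one side has a single label, and a change of the lift of x moves it to 0 in
  \<open>nu\<close>.\<close>

lemma rule2_ex:
  assumes i: "level x y = 2"
  shows "\<exists>x'. eqv x x' \<and> rule2 x' y"
proof -
  have "card (nu x y) \<le> 2" "card (nw x y) \<le> 2" using card_le_2[of x y] level_facts(3)[OF i] by (auto simp: gpair_def)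
  moreover have "ncount x y = 3 \<or> ncount x y = 2 \<and> card (nu x y) = card (nw x y)"
    using level_facts(3)[OF i] card_vpair by blast
  ultimately have "card (nu x y) = 1 \<or> card (nw x y) = 1" unfolding ncount_def by linarith
  then show ?thesis
  proof
    assume "card (nu x y) = 1"
    then obtain l where l: "nu x y = {l}" by (rule card_1_singletonE)
    then have L: "l \<in> lat" by (auto simp: nu_def near_def)
    have "nu (x + l) y = {0}" using ties_shift(1)[OF L, of _ x y] l by auto
    moreover have e: "eqv x (x + l)" using L by (simp add: eqv_def)
    moreover have "level (x + l) y = 2" using i level_eqv[OF e eqv_refl] by simp
    ultimately show ?thesis unfolding rule2_def by blast
  next
    assume "card (nw x y) = 1"
    then obtain l where l: "nw x y = {l}" by (rule card_1_singletonE)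
    then have L: "l \<in> lat" by (auto simp: nw_def near_def)
    have "nu (l - x) y = {0}" using ties_shift(3)[OF L, of _ x y] l by auto
    moreover have e: "eqv x (l - x)" using L by (simp add: eqv_def)
    moreover have "level (l - x) y = 2" using i level_eqv[OF e eqv_refl] by simp
    ultimately show ?thesis unfolding rule2_def by blast
  qed
qed

section \<open>Checking the rule for four labels\<close>

lemma nu_norm_diff:
  assumes "0 \<in> nu x y" "l \<in> nu x y" shows "norm (y - x - l) = norm (y - x)"
  using assms by (simp add: nu_def near_def)

lemma six_kind:
  assumes "(pc l, qc l) \<in> {(2,0), (-2,0), (0,2), (0,-2), (2,-2), (-2,2)}"
    "(pc m, qc m) \<in> {(2,0), (-2,0), (0,2), (0,-2), (2,-2), (-2,2)}" "kind l = kind m"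
  shows "m = l \<or> m = - l"
proof -
  have "(pc m = pc l \<and> qc m = qc l) \<or> (pc m = - pc l \<and> qc m = - qc l)"
    using assms by (auto simp: kind_def split: if_splits)
  then show ?thesis using coord_eqI[of m l] coord_eqI[of m "- l"] by auto
qed

text \<open>The side whose two labels differ in the direction of smaller \<open>kind\<close> is
  preferred, and the sign of Im picks one of its labels. If both sides supply a selection, the kinds
  agree, and the conditions on Re, Im and norm force
  \<open>cnj l'' * (y - x'') = cnj l * (y - x)\<close>. Then either both lifts coincide or y is a
  vertex.\<close>

lemma rule3_core:
  assumes r: "rule3 x y" and r': "rule3 x'' y" and e: "eqv x x''"
  shows "x'' = x \<or> (x + x'' = y + y \<and> y + y \<in> lat)"
proof -
  have i: "level x y = 3" "0 \<in> nu x y" and z: "0 \<in> nu x'' y" using r r' by (auto simp: rule3_def)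
  obtain l where l: "l \<in> nu x y" "l \<noteq> 0" "Im (cnj l * (y - x)) > 0" 
    "\<exists>m\<in>nw x y. \<exists>m'\<in>nw x y. m \<noteq> m' \<and> kind l \<le> kind (m - m')" using r by (auto simp: rule3_def)
  have A: "nu x y = {0, l}" using two_elems[OF cards_3(1)[OF i(1)] i(2)] l(1,2) by auto
  obtain l'' where l'': "l'' \<in> nu x'' y" "l'' \<noteq> 0" "Im (cnj l'' * (y - x'')) > 0"
    "\<exists>m\<in>nw x'' y. \<exists>m'\<in>nw x'' y. m \<noteq> m' \<and> kind l'' \<le> kind (m - m')" using r' by (auto simp: rule3_def)
  from e z show ?thesis
  proof (cases rule: minimal_cases)
    case (1 k)
    then have k: "k \<in> lat" by (auto simp: nu_def near_def)
    show ?thesis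
    proof (rule ccontr)
      assume "\<not> ?thesis"
      then have "k = l" using 1 A by auto
      moreover have "l'' + k \<in> nu x y" using l''(1) ties_shift(1)[OF k, of l'' x y] 1 by simp
      ultimately have "l'' = - l" using A l''(2) by (auto simp: eq_neg_iff_add_eq_0)
      then have "Im (cnj (- l) * (y - (x + l))) > 0" using l''(3) 1 \<open>k = l\<close> by simp
      then show False using l(3) by (simp add: algebra_simps)
    qed
  next
    case (2 k)
    then have k: "k \<in> lat" by (auto simp: nw_def near_def)
    obtain k2 where B: "nw x y = {k, k2}" "k2 \<noteq> k" using two_elems[OF cards_3(2)[OF i(1)] 2(2)] .
    have "l'' + k \<in> nw x y" using l''(1) ties_shift(3)[OF k, of l'' x y] 2 by simp
    then have l2: "l'' = k2 - k" using B l''(2) by auto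
    \<comment> \<open>Seen from x'' the sides u and w have changed places, so the two selections
      compare the same kinds in opposite directions.\<close>
    have "kind l \<le> kind l''" using l(4) B kind_minus[of "k2 - k"] unfolding l2 by auto
    moreover have "kind l'' \<le> kind l"
    proof -
      obtain m m' where m: "m \<in> nw x'' y" "m' \<in> nw x'' y" "m \<noteq> m'" "kind l'' \<le> kind (m - m')" using l''(4) by blast
      have "m - k \<in> {0, l}" "m' - k \<in> {0, l}" using m(1,2) ties_shift(4)[OF k, of _ x y] 2 A by auto
      then have "m - m' = l \<or> m - m' = - l" using m(3) by (auto simp: algebra_simps)
      then show ?thesis using m(4) by auto
    qed
    ultimately have "l'' = l \<or> l'' = - l"
      using six_kind[OF nu_norm2(1)[OF i(2) l(1,2)] nu_norm2(1)[OF z l''(1,2)]] by simp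
    moreover have "norm (y - x) = norm (y - x'')"
      using i(2) z odist_eqv[OF e eqv_refl, of y] by (simp add: nu_def near_def)
    moreover have Re: "Re (cnj l * (y - x)) = (norm l)\<^sup>2 / 2" "Re (cnj l'' * (y - x'')) = (norm l'')\<^sup>2 / 2"
      by (rule bisector_Re, rule nu_norm_diff[OF i(2) l(1)], rule bisector_Re, rule nu_norm_diff[OF z l''(1)])
    ultimately have "cnj l'' * (y - x'') = cnj l * (y - x)"
      using l(3) l''(3) by (intro complex_eq_of_Re_norm) (auto simp: norm_mult)
    with \<open>l'' = l \<or> l'' = - l\<close> show ?thesis
    proof (elim disjE)
      assume "l'' = l" and eq: "cnj l'' * (y - x'') = cnj l * (y - x)"
      then have "y - x'' = y - x" using l(2) by simp
      then show ?thesis by simp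
    next
      assume "l'' = - l" and eq: "cnj l'' * (y - x'') = cnj l * (y - x)"
      then have "cnj l * (x'' - y) = cnj l * (y - x)" by (simp add: algebra_simps)
      then have "x'' - y = y - x" using l(2) by simp
      then have s: "x + x'' = y + y" by (simp add: algebra_simps)
      moreover have "x + x'' = k" by (simp add: 2)
      ultimately show ?thesis using k by simp
    qed
  qed
qed

text \<open>If u is the centre of a cell edge, the common minimum is 1. Two labels of w are 2 apart,
  so w is midway between them as well, and all coordinates of u and w are integers.\<close>

lemma center_gpair:
  assumes "0 \<in> nu x y" "l \<in> nu x y" "l \<noteq> 0" "Im (cnj l * (y - x)) = 0"
    and "m \<in> nw x y" "m' \<in> nw x y" "m \<noteq> m'"
  shows "gpair x y"
proof -
  have lat: "l \<in> lat" "m \<in> lat" "m' \<in> lat" using assms by (auto simp: nu_def nw_def near_def)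
  have u: "2 * (y - x) = l" using bisector_center[OF nu_norm_diff[OF assms(1,2)] assms(3,4)] .
  have "norm (2 * (y - x)) = 2" using nu_norm2(2)[OF assms(1-3)] unfolding u .
  then have "norm (y - x) = 1" unfolding norm_mult by simp
  then have D: "odist x y = 1" using assms(1) by (simp add: nu_def near_def)
  define x1 where "x1 = m - x"
  have m: "0 \<in> nu x1 y" "m' - m \<in> nu x1 y" unfolding x1_def using ties_shift(3)[OF lat(2)] assms by simp_all
  define v where "v = y - x1"
  define k where "k = m' - m"
  have k: "norm k = 2" unfolding k_def by (rule nu_norm2(2)[OF m]) (use assms in auto)
  have D1: "odist x1 y = 1" using D odist_shift(2)[OF lat(2)] by (simp add: x1_def)
  have nv: "norm v = 1" "norm (v - k) = norm v" using m D1 by (simp_all add: nu_def near_def v_def k_def)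
  have "norm (2 * v - k) = 0"
  proof -
    have "(norm (2 * v - k))\<^sup>2 = 4 * (norm v)\<^sup>2 + (norm k)\<^sup>2 - 4 * Re (cnj k * v)"
      unfolding cmod_power2 by (simp add: power2_eq_square algebra_simps)
    also have "\<dots> = 0" unfolding bisector_Re[OF nv(2)] using nv(1) k by simp
    finally show ?thesis by simp
  qed
  then have v: "2 * v = k" by simp
  have half: "3 * pc z \<in> \<int> \<and> 3 * qc z \<in> \<int>" if z: "2 * z = n" "n \<in> lat" for z n
  proof -
    obtain i j :: int where ij: "pc n = 2 * of_int i" "qc n = 2 * of_int j" using z(2) by (rule latE)
    have "pc n = 2 * pc z" "qc n = 2 * qc z" unfolding z(1)[symmetric] by (simp_all only: mult_2 coord_linear)
    then have "3 * pc z = of_int (3 * i)" "3 * qc z = of_int (3 * j)" using ij by simp_all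
    then show ?thesis by (metis Ints_of_int)
  qed
  have "2 * (y + x) = k + (m + m)" using v by (simp add: v_def x1_def algebra_simps)
  moreover have "k + (m + m) \<in> lat" using lat by (simp add: k_def lat_add lat_diff)
  ultimately have "3 * pc (y + x) \<in> \<int>" "3 * qc (y + x) \<in> \<int>" using half by blast+
  moreover have "3 * pc (y - x) \<in> \<int>" "3 * qc (y - x) \<in> \<int>" using half[OF u lat(1)] by blast+
  ultimately show ?thesis unfolding gpair_def by (intro grid_of_sum_diff)
qed

text \<open>Passing from one of the labels a, a' to the other negates the imaginary part. It is
  nonzero off the grid by \<open>center_gpair\<close>, so one of the two labels qualifies.\<close>

lemma rule3_ex_aux:
  assumes i: "level x y = 3" and A: "nu x y = {a, a'}" "a \<noteq> a'" and B: "nw x y = {b, b'}" "b \<noteq> b'"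
    and le: "kind (a' - a) \<le> kind (b' - b)"
  shows "\<exists>x'. eqv x x' \<and> rule3 x' y"
proof -
  have *: "rule3 (x + a) y \<or> Im (cnj (a' - a) * (y - x - a)) \<le> 0" 
    if A: "nu x y = {a, a'}" "a \<noteq> a'" and le: "kind (a' - a) \<le> kind (b' - b)" for a a'
  proof -
    have L: "a \<in> lat" "a' \<in> lat" using A by (auto simp: nu_def near_def)
    have A1: "0 \<in> nu (x + a) y" "a' - a \<in> nu (x + a) y" using ties_shift(1)[OF L(1)] A by simp_all
    have B1: "b + a \<in> nw (x + a) y" "b' + a \<in> nw (x + a) y" using ties_shift(2)[OF L(1)] B by simp_all
    have e: "eqv x (x + a)" using L by (simp add: eqv_def)
    have i1: "level (x + a) y = 3" using i level_eqv[OF e eqv_refl] by simp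
    have "rule3 (x + a) y" if I: "Im (cnj (a' - a) * (y - x - a)) > 0"
    proof -
      have "a' - a \<noteq> 0" "b' + a \<noteq> b + a" "kind (a' - a) \<le> kind (b' + a - (b + a))" using A(2) B(2) le by simp_all
      moreover have "Im (cnj (a' - a) * (y - (x + a))) > 0" using I by (simp only: diff_diff_eq)
      ultimately show ?thesis unfolding rule3_def using i1 A1 B1 by blast
    qed
    then show ?thesis using not_le by blast
  qed
  have L: "a \<in> lat" "a' \<in> lat" using A by (auto simp: nu_def near_def)
  have e: "eqv x (x + a)" "eqv x (x + a')" using L by (simp_all add: eqv_def)
  have ne: "Im (cnj (a' - a) * (y - x - a)) \<noteq> 0"
  proof
    assume "Im (cnj (a' - a) * (y - x - a)) = 0"
    then have I: "Im (cnj (a' - a) * (y - (x + a))) = 0" by (simp only: diff_diff_eq)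
    have A1: "0 \<in> nu (x + a) y" "a' - a \<in> nu (x + a) y" using ties_shift(1)[OF L(1)] A by simp_all
    have B1: "b + a \<in> nw (x + a) y" "b' + a \<in> nw (x + a) y" using ties_shift(2)[OF L(1)] B by simp_all
    have "gpair (x + a) y" by (rule center_gpair[OF A1 _ I B1]) (use A(2) B(2) in simp_all)
    then show False using level_facts(4)[OF i] level_eqv[OF e(1) eqv_refl, of y] i by (simp add: level_def)
  qed
  have "Im (cnj (a - a') * (y - x - a')) = - Im (cnj (a' - a) * (y - x - a))" by (simp add: algebra_simps)
  moreover have le': "kind (a - a') \<le> kind (b' - b)" using le kind_minus[of "a' - a"] by simp
  moreover have A': "nu x y = {a', a}" using A(1) by (simp add: insert_commute)
  ultimately have "rule3 (x + a) y \<or> rule3 (x + a') y"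
    using *[OF A le] *[OF A' A(2)[symmetric] le'] ne by linarith
  then show ?thesis using e by blast
qed

lemma rule3_ex:
  assumes i: "level x y = 3"
  shows "\<exists>x'. eqv x x' \<and> rule3 x' y"
proof -
  obtain a a' where A: "nu x y = {a, a'}" "a \<noteq> a'" using cards_3(1)[OF i] by (auto simp: card_2_iff)
  obtain b b' where B: "nw x y = {b, b'}" "b \<noteq> b'" using cards_3(2)[OF i] by (auto simp: card_2_iff)
  show ?thesis
  proof (cases "kind (a' - a) \<le> kind (b' - b)")
    case True
    show ?thesis by (rule rule3_ex_aux[OF i A B True])
  next
    case False
    \<comment> \<open>The half-turn about 0 exchanges the label sets and reverses the comparison of
      kinds.\<close>
    have e: "eqv x (- x)" by (simp add: eqv_def)
    have s: "nu (- x) y = nw x y" "nw (- x) y = nu x y" using ties_shift(3,4)[OF lat_0, of _ x y] by auto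
    have "level (- x) y = 3" using i level_eqv[OF e eqv_refl] by simp
    then obtain x' where "eqv (- x) x'" "rule3 x' y"
      using rule3_ex_aux[of "- x" y b b' a a'] A B s False by auto
    then show ?thesis using eqv_trans[OF e] by blast
  qed
qed

lemma rule3_translate:
  assumes "rule3 x y" "m \<in> lat" shows "rule3 (x + m) (y + m)"
proof -
  obtain l k k' where h: "level x y = 3" "0 \<in> nu x y" "l \<in> nu x y" "l \<noteq> 0" "Im (cnj l * (y - x)) > 0"
    "k \<in> nw x y" "k' \<in> nw x y" "k \<noteq> k'" "kind l \<le> kind (k - k')" using assms(1) unfolding rule3_def by blast
  have A: "0 \<in> nu (x + m) (y + m)" "l \<in> nu (x + m) (y + m)" using h ties_translate(1)[OF assms(2)] by simp_all
  have B: "k + (m + m) \<in> nw (x + m) (y + m)" "k' + (m + m) \<in> nw (x + m) (y + m)" using h ties_translate(2)[OF assms(2)] by simp_all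
  show ?thesis unfolding rule3_def
    by (intro conjI A(1) bexI[OF _ A(2)] bexI[OF _ B(1)] bexI[OF _ B(2)]) (use h level_translate(1)[OF assms(2)] in auto)
qed

lemma rule3_negate:
  assumes "rule3 x y" shows "rule3 (- x) (- y)"
proof -
  obtain l k k' where h: "level x y = 3" "0 \<in> nu x y" "l \<in> nu x y" "l \<noteq> 0" "Im (cnj l * (y - x)) > 0"
    "k \<in> nw x y" "k' \<in> nw x y" "k \<noteq> k'" "kind l \<le> kind (k - k')" using assms(1) unfolding rule3_def by blast
  have A: "0 \<in> nu (- x) (- y)" "- l \<in> nu (- x) (- y)" using h ties_negate by simp_all
  have B: "- k \<in> nw (- x) (- y)" "- k' \<in> nw (- x) (- y)" using h ties_negate by simp_all
  have "kind (- k - - k') = kind (k - k')" using kind_minus[of "k - k'"] by simp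
  moreover have "cnj (- l) * (- y - - x) = cnj l * (y - x)" by (simp add: algebra_simps)
  ultimately show ?thesis unfolding rule3_def
    by (intro conjI A(1) bexI[OF _ A(2)] bexI[OF _ B(1)] bexI[OF _ B(2)]) (use h level_translate(2) in auto)
qed

lemma rule2_translate: "rule2 x y \<Longrightarrow> m \<in> lat \<Longrightarrow> rule2 (x + m) (y + m)"
  unfolding rule2_def using ties_translate(1)[of m _ x y] level_translate(1)[of m x y] by auto

lemma rule2_negate: "rule2 x y \<Longrightarrow> rule2 (- x) (- y)"
  unfolding rule2_def using ties_negate(1)[of _ x y] level_translate(2)[of x y] by auto

section \<open>The upper bound\<close>

lemma negative_near:
  fixes f :: "complex \<times> complex \<Rightarrow> real"
  assumes "continuous_on UNIV f" "f (x, y) < 0"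
  shows "\<exists>e>0. \<forall>x' y'. dist x' x < e \<longrightarrow> dist y' y < e \<longrightarrow> f (x', y') < 0"
proof -
  have "open {p. f p < 0}" using assms(1) by (intro open_Collect_less) auto
  moreover have "(x, y) \<in> {p. f p < 0}" using assms(2) by simp
  ultimately obtain e where "e > 0" "\<forall>p. dist p (x, y) < e \<longrightarrow> p \<in> {p. f p < 0}"
    unfolding open_dist by blast
  then have e: "e > 0" "\<forall>p. dist p (x, y) < e \<longrightarrow> f p < 0" unfolding mem_Collect_eq by blast+
  have "f (x', y') < 0" if "dist x' x < e / 2" "dist y' y < e / 2" for x' y'
  proof -
    have "dist (x', y') (x, y) \<le> dist x' x + dist y' y"
      unfolding dist_Pair_Pair by (rule sqrt_sum_squares_le_sum) auto
    then have "dist (x', y') (x, y) < e" using that by linarith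
    then show ?thesis using e(2) by blast
  qed
  then show ?thesis using e(1) by (intro exI[of _ "e / 2"]) simp
qed

text \<open>Openness of R relative to the lifts of level k, in the form that
  \<open>GMPR_from_lifts\<close> takes as its continuity hypothesis.\<close>

definition stable :: "nat \<Rightarrow> (complex \<Rightarrow> complex \<Rightarrow> bool) \<Rightarrow> bool" where
  "stable k R \<longleftrightarrow> (\<forall>x y. R x y \<longrightarrow> (\<exists>e>0. \<forall>x' y'. dist x' x < e \<longrightarrow> dist y' y < e \<longrightarrow> level x' y' = k \<longrightarrow> R x' y'))"

text \<open>Off the grid, \<open>level_local\<close> freezes the label sets within a level, so only
  the other conditions of a rule have to be followed under perturbation.\<close>

lemma stableI:
  assumes "\<And>x y. R x y \<Longrightarrow> level x y = k \<and> \<not> gpair x y"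
    and "\<And>x y. R x y \<Longrightarrow> \<exists>e>0. \<forall>x' y'. dist x' x < e \<longrightarrow> dist y' y < e \<longrightarrow>
      level x' y' = k \<longrightarrow> nu x' y' = nu x y \<longrightarrow> nw x' y' = nw x y \<longrightarrow> R x' y'"
  shows "stable k R"
  unfolding stable_def
proof (intro allI impI)
  fix x y assume R: "R x y"
  obtain e1 where e1: "e1 > 0" "\<forall>x' y'. dist x' x < e1 \<longrightarrow> dist y' y < e1 \<longrightarrow>
    level x' y' \<le> level x y \<and> (level x' y' = level x y \<longrightarrow> nu x' y' = nu x y \<and> nw x' y' = nw x y)"
    using level_local[of x y] assms(1)[OF R] by blast
  obtain e2 where e2: "e2 > 0" "\<forall>x' y'. dist x' x < e2 \<longrightarrow> dist y' y < e2 \<longrightarrow>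
      level x' y' = k \<longrightarrow> nu x' y' = nu x y \<longrightarrow> nw x' y' = nw x y \<longrightarrow> R x' y'"
    using assms(2)[OF R] by blast
  have "R x' y'" if d: "dist x' x < min e1 e2" "dist y' y < min e1 e2" and i: "level x' y' = k" for x' y'
  proof -
    have d1: "dist x' x < e1" "dist y' y < e1" and d2: "dist x' x < e2" "dist y' y < e2" using d by simp_all
    have "level x' y' = level x y" using i assms(1)[OF R] by simp
    then have "nu x' y' = nu x y" "nw x' y' = nw x y" using e1(2)[rule_format, OF d1] by simp_all
    then show ?thesis using e2(2)[rule_format, OF d2 i] by blast
  qed
  then show "\<exists>e>0. \<forall>x' y'. dist x' x < e \<longrightarrow> dist y' y < e \<longrightarrow> level x' y' = k \<longrightarrow> R x' y'"
    using e1(1) e2(1) by (intro exI[of _ "min e1 e2"]) simp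
qed

lemma stable_rule0: "stable 0 rule0"
proof (rule stableI)
  show "level x y = 0 \<and> \<not> gpair x y" if "rule0 x y" for x y using that level_facts(1)[of x y] by (simp add: rule0_def)
  show "\<exists>e>0. \<forall>x' y'. dist x' x < e \<longrightarrow> dist y' y < e \<longrightarrow>
      level x' y' = 0 \<longrightarrow> nu x' y' = nu x y \<longrightarrow> nw x' y' = nw x y \<longrightarrow> rule0 x' y'" if "rule0 x y" for x y
    using that unfolding rule0_def by (intro exI[of _ 1]) simp
qed

lemma stable_rule2: "stable 2 rule2"
proof (rule stableI)
  show "level x y = 2 \<and> \<not> gpair x y" if "rule2 x y" for x y using that level_facts(3)[of x y] by (simp add: rule2_def)
  show "\<exists>e>0. \<forall>x' y'. dist x' x < e \<longrightarrow> dist y' y < e \<longrightarrow>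
      level x' y' = 2 \<longrightarrow> nu x' y' = nu x y \<longrightarrow> nw x' y' = nw x y \<longrightarrow> rule2 x' y'" if "rule2 x y" for x y
    using that unfolding rule2_def by (intro exI[of _ 1]) simp
qed

lemma stable_rule1: "stable 1 rule1"
proof (rule stableI)
  show "level x y = 1 \<and> \<not> gpair x y" if "rule1 x y" for x y using that level_facts(2)[of x y] by (simp add: rule1_def)
  fix x y assume r: "rule1 x y"
  have i: "level x y = 1" "0 \<in> nu x y" using r by (auto simp: rule1_def)
  show "\<exists>e>0. \<forall>x' y'. dist x' x < e \<longrightarrow> dist y' y < e \<longrightarrow>
      level x' y' = 1 \<longrightarrow> nu x' y' = nu x y \<longrightarrow> nw x' y' = nw x y \<longrightarrow> rule1 x' y'"
    using i
  proof (cases rule: rule1_cases)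
    case (two l)
    have "generic (y + x)" by (rule generic_sum[OF odist_ge_1[OF i(2), of l] two(3)]) (use two in auto)
    then obtain e where e: "e > 0" "\<forall>w'. dist w' (y + x) < e \<longrightarrow> upward w' = upward (y + x)" using upward_local by blast
    have p: "positive l \<longleftrightarrow> upward (y + x)" using r unfolding rule1_def two by blast
    have "rule1 x' y'" if d: "dist x' x < e / 2" "dist y' y < e / 2" and j: "level x' y' = 1"
      and A: "nu x' y' = nu x y" for x' y'
    proof -
      have "dist (y' + x') (y + x) \<le> dist y' y + dist x' x" by (rule dist_triangle_add)
      then have "dist (y' + x') (y + x) < e" using d by linarith
      then have "positive l \<longleftrightarrow> upward (y' + x')" using p e(2) by blast
      moreover have "l \<in> nu x' y'" "0 \<in> nu x' y'" using two A by simp_all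
      ultimately show ?thesis unfolding rule1_def using j two(2) by blast
    qed
    then show ?thesis using e(1) by (intro exI[of _ "e / 2"]) simp
  next
    case (one l)
    have "Im (cnj (y - x) * (y + x - l)) < 0" using r unfolding rule1_def one by blast
    then have "(\<lambda>p. Im (cnj (snd p - fst p) * (snd p + fst p - l))) (x, y) < 0" by simp
    moreover have "continuous_on UNIV (\<lambda>p. Im (cnj (snd p - fst p) * (snd p + fst p - l)))"
      by (intro continuous_intros)
    ultimately obtain e where e: "e > 0" "\<forall>x' y'. dist x' x < e \<longrightarrow> dist y' y < e \<longrightarrow> Im (cnj (y' - x') * (y' + x' - l)) < 0"
      using negative_near[of "\<lambda>p. Im (cnj (snd p - fst p) * (snd p + fst p - l))" x y]
      unfolding fst_conv snd_conv by blast
    have "rule1 x' y'" if d: "dist x' x < e" "dist y' y < e" and j: "level x' y' = 1"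
      and A: "nu x' y' = nu x y" "nw x' y' = nw x y" for x' y'
    proof -
      have "0 \<in> nu x' y'" "l \<in> nw x' y'" using one A by simp_all
      then show ?thesis unfolding rule1_def using j e(2)[rule_format, OF d] by blast
    qed
    then show ?thesis using e(1) by (intro exI[of _ e]) simp
  qed
qed

lemma stable_rule3: "stable 3 rule3"
proof (rule stableI)
  show "level x y = 3 \<and> \<not> gpair x y" if "rule3 x y" for x y using that level_facts(4)[of x y] by (simp add: rule3_def)
  fix x y assume r: "rule3 x y"
  obtain l where h: "0 \<in> nu x y" "l \<in> nu x y" "l \<noteq> 0" "Im (cnj l * (y - x)) > 0"
    "\<exists>k\<in>nw x y. \<exists>k'\<in>nw x y. k \<noteq> k' \<and> kind l \<le> kind (k - k')" using r unfolding rule3_def by blast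
  have "(\<lambda>p. - Im (cnj l * (snd p - fst p))) (x, y) < 0" using h(4) by simp
  moreover have "continuous_on UNIV (\<lambda>p. - Im (cnj l * (snd p - fst p)))"
    by (intro continuous_intros)
  ultimately obtain e where e: "e > 0" "\<forall>x' y'. dist x' x < e \<longrightarrow> dist y' y < e \<longrightarrow> - Im (cnj l * (y' - x')) < 0"
    using negative_near[of "\<lambda>p. - Im (cnj l * (snd p - fst p))" x y] unfolding fst_conv snd_conv by blast
  have "rule3 x' y'" if d: "dist x' x < e" "dist y' y < e" and j: "level x' y' = 3"
    and A: "nu x' y' = nu x y" "nw x' y' = nw x y" for x' y'
  proof -
    have "Im (cnj l * (y' - x')) > 0" using e(2)[rule_format, OF d] by linarith
    then show ?thesis unfolding rule3_def A using j h by blast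
  qed
  then show "\<exists>e>0. \<forall>x' y'. dist x' x < e \<longrightarrow> dist y' y < e \<longrightarrow>
      level x' y' = 3 \<longrightarrow> nu x' y' = nu x y \<longrightarrow> nw x' y' = nw x y \<longrightarrow> rule3 x' y'"
    using e(1) by (intro exI[of _ e]) simp
qed

section \<open>From rules on lifts to the partition\<close>

context tetra
begin

definition pairs :: "(complex \<Rightarrow> complex \<Rightarrow> bool) \<Rightarrow> ((real^3) \<times> (real^3)) set" where
  "pairs A = {(F x, F y) | x y. A x y}"

definition stratum :: "nat \<Rightarrow> ((real^3) \<times> (real^3)) set" where
  "stratum k = pairs (\<lambda>x y. level x y = k)"

lemma pairs_level_iff: "(F x, F y) \<in> pairs (\<lambda>x y. A (level x y)) \<longleftrightarrow> A (level x y)"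
proof
  assume "(F x, F y) \<in> pairs (\<lambda>x y. A (level x y))"
  then obtain x' y' where "F x = F x'" "F y = F y'" "A (level x' y')" unfolding pairs_def by blast
  then show "A (level x y)" using level_eqv[of x x' y y'] by (simp add: F_eq_iff)
qed (auto simp: pairs_def)

lemma stratum_iff: "(F x, F y) \<in> stratum k \<longleftrightarrow> level x y = k"
  unfolding stratum_def by (rule pairs_level_iff)

lemma stratum_cases: "(P, Q) \<in> stratum k \<Longrightarrow> \<exists>x y. P = F x \<and> Q = F y \<and> level x y = k"
  by (auto simp: stratum_def pairs_def)

text \<open>By \<open>tr\<close> and \<open>neg\<close> the rule is invariant under moving both
  points by the group. Two lifts of a pair may thus be given the same y, and only the comparison in
  \<open>core\<close> remains.\<close>

lemma admits_rule:
  assumes level: "\<And>x y. R x y \<Longrightarrow> level x y = k" and min: "\<And>x y. R x y \<Longrightarrow> 0 \<in> nu x y"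
    and ex: "\<And>x y. level x y = k \<Longrightarrow> \<exists>x'. eqv x x' \<and> R x' y"
    and tr: "\<And>x y m. R x y \<Longrightarrow> m \<in> lat \<Longrightarrow> R (x + m) (y + m)" and neg: "\<And>x y. R x y \<Longrightarrow> R (- x) (- y)"
    and core: "\<And>x y x''. R x y \<Longrightarrow> R x'' y \<Longrightarrow> eqv x x'' \<Longrightarrow> x'' = x \<or> (x + x'' = y + y \<and> y + y \<in> lat)"
    and st: "stable k R"
  shows "admits_GMPR T (stratum k)"
proof (rule GMPR_from_lifts[where R = R])
  show "\<exists>x y. F x = P \<and> F y = Q \<and> R x y" if PQ: "(P, Q) \<in> stratum k" for P Q
  proof -
    obtain x y where "P = F x" "Q = F y" "level x y = k" using stratum_cases[OF PQ] by blast
    moreover obtain x' where "eqv x x'" "R x' y" using ex[OF \<open>level x y = k\<close>] by blast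
    ultimately have "F x' = P \<and> F y = Q \<and> R x' y" using F_eq_iff[of x x'] by simp
    then show ?thesis by blast
  qed
  show "dist x y = odist x y" if "R x y" for x y using min[OF that] by (simp add: nu_zero_iff)
  have core2: "eqv (linepath x y t) (linepath x'' y t)" if "R x y" "R x'' y" "eqv x x''" for x y x'' t
    using core[OF that]
  proof
    \<comment> \<open>Here x and x'' are symmetric about y, and the half-turn about y belongs to the
      group, so it matches the two segments point by point.\<close>
    assume *: "x + x'' = y + y \<and> y + y \<in> lat"
    have "linepath x'' y t + linepath x y t = (1 - t) *\<^sub>R (x + x'') + t *\<^sub>R (y + y)"
      by (simp add: linepath_def algebra_simps)
    also have "\<dots> = y + y" using * by (simp add: scaleR_left_diff_distrib)
    finally show ?thesis using * by (simp add: eqv_def)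
  qed simp
  show "eqv (linepath x y t) (linepath x' y' t)" if R: "R x y" "R x' y'" and e: "eqv x x'" "eqv y y'" for x y x' y' t
    using e(2)
  proof (cases rule: eqv_cases)
    case (1 m)
    have "R (x' + - m) y" using tr[OF R(2) lat_minus[OF 1(1)]] by (simp add: 1)
    moreover have "eqv x' (x' + - m)" using 1 by (simp add: eqv_def)
    ultimately have "eqv (linepath x y t) (linepath (x' + - m) y t)" using core2 R(1) eqv_trans[OF e(1)] by blast
    moreover have "linepath x' y' t - linepath (x' + - m) y t = m" by (simp add: 1 linepath_def algebra_simps)
    then have "eqv (linepath (x' + - m) y t) (linepath x' y' t)" using 1 by (simp add: eqv_def)
    ultimately show ?thesis by (rule eqv_trans)
  next
    case (2 m)
    have "R (- x' + m) y" using tr[OF neg[OF R(2)] 2(1)] by (simp add: 2)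
    moreover have "eqv x' (- x' + m)" using 2 by (simp add: eqv_def)
    ultimately have "eqv (linepath x y t) (linepath (- x' + m) y t)" using core2 R(1) eqv_trans[OF e(1)] by blast
    moreover have "linepath x' y' t + linepath (- x' + m) y t = m" by (simp add: 2 linepath_def algebra_simps)
    then have "eqv (linepath (- x' + m) y t) (linepath x' y' t)" using 2 by (simp add: eqv_def)
    ultimately show ?thesis by (rule eqv_trans)
  qed
  show "\<exists>\<delta>>0. \<forall>x' y'. dist x' x < \<delta> \<longrightarrow> dist y' y < \<delta> \<longrightarrow> (F x', F y') \<in> stratum k \<longrightarrow> R x' y'" if "R x y" for x y
    using st that unfolding stable_def stratum_iff by blast
qed

lemma minimal_ex: "\<exists>x'. eqv x x' \<and> 0 \<in> nu x' y"
proof -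
  obtain x' where x': "eqv x x'" "dist x' y = odist x y" by (rule odist_attained)
  then have "0 \<in> nu x' y" using odist_eqv[OF x'(1) eqv_refl, of y] by (simp add: nu_zero_iff)
  then show ?thesis using x'(1) by blast
qed

lemma admits_0: "admits_GMPR T (stratum 0)"
proof (rule admits_rule[where R = rule0])
  show "\<exists>x'. eqv x x' \<and> rule0 x' y" if "level x y = 0" for x y
    using minimal_ex[of x y] level_eqv[of x _ y y] that unfolding rule0_def by (metis eqv_refl)
  show "x'' = x \<or> (x + x'' = y + y \<and> y + y \<in> lat)" if r: "rule0 x y" "rule0 x'' y" "eqv x x''" for x y x''
  proof -
    have z: "0 \<in> nu x y" "0 \<in> nu x'' y" and n: "card (nu x y) + card (nw x y) = 1"
      using r level_facts(1)[of x y] by (auto simp: rule0_def ncount_def)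
    have A: "card (nu x y) = 1" "card (nw x y) = 0" using n card_pos(1)[OF z(1)] by linarith+
    from r(3) z(2) show ?thesis
    proof (cases rule: minimal_cases)
      case (1 l)
      then show ?thesis using one_elem[OF A(1) z(1)] by simp
    next
      case (2 l)
      then show ?thesis using A(2) by simp
    qed
  qed
  show "rule0 (x + m) (y + m)" if "rule0 x y" "m \<in> lat" for x y m
    using that ties_translate(1)[of m] level_translate(1)[of m] by (simp add: rule0_def)
  show "rule0 (- x) (- y)" if "rule0 x y" for x y
    using that ties_negate(1) level_translate(2) by (simp add: rule0_def)
qed (simp_all add: rule0_def stable_rule0)

lemma admits_1: "admits_GMPR T (stratum 1)"
proof (rule admits_rule[where R = rule1])
  show "\<exists>x'. eqv x x' \<and> rule1 x' y" if i: "level x y = 1" for x y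
  proof -
    obtain x' where x': "eqv x x'" "0 \<in> nu x' y" using minimal_ex by blast
    have "level x' y = 1" using level_eqv[OF x'(1) eqv_refl] i by simp
    then obtain x'' where "eqv x' x''" "rule1 x'' y" using rule1_ex x'(2) by blast
    then show ?thesis using eqv_trans[OF x'(1)] by blast
  qed
  show "x'' = x \<or> (x + x'' = y + y \<and> y + y \<in> lat)" if "rule1 x y" "rule1 x'' y" "eqv x x''" for x y x''
    using rule1_core[OF that] by simp
qed (rule rule1_translate rule1_negate stable_rule1 | simp add: rule1_def)+

lemma admits_2: "admits_GMPR T (stratum 2)"
  by (rule admits_rule[where R = rule2])
    (rule rule2_translate rule2_negate stable_rule2 rule2_ex rule2_core | assumption | simp add: rule2_def)+

lemma admits_3: "admits_GMPR T (stratum 3)"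
  by (rule admits_rule[where R = rule3])
    (rule rule3_translate rule3_negate stable_rule3 rule3_ex rule3_core | assumption | simp add: rule3_def)+

lemma gpair_iff_level: "gpair x y \<longleftrightarrow> level x y = 4"
  using ncount_le_4[of x y] by (auto simp: level_def)

text \<open>Grid pairs are isolated from each other, so any choice of geodesics over them is
  continuous. \<open>SOME\<close> fixes one lift per pair, and uniqueness is immediate.\<close>

lemma admits_4: "admits_GMPR T (stratum 4)"
proof -
  define lift where "lift = (\<lambda>P Q. SOME p. F (fst p) = P \<and> F (snd p) = Q \<and> dist (fst p) (snd p) = odist (fst p) (snd p))"
  have lift: "F (fst (lift (F x) (F y))) = F x \<and> F (snd (lift (F x) (F y))) = F y \<and>
    dist (fst (lift (F x) (F y))) (snd (lift (F x) (F y))) = odist (fst (lift (F x) (F y))) (snd (lift (F x) (F y)))" for x y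
  proof -
    obtain x' where "eqv x x'" "0 \<in> nu x' y" using minimal_ex by blast
    then have "F (fst (x', y)) = F x \<and> F (snd (x', y)) = F y \<and> dist (fst (x', y)) (snd (x', y)) = odist (fst (x', y)) (snd (x', y))"
      using F_eq_iff[of x x'] by (simp add: nu_zero_iff)
    then show ?thesis unfolding lift_def by (rule someI)
  qed
  define R where "R x y \<longleftrightarrow> gpair x y \<and> lift (F x) (F y) = (x, y)" for x y
  show ?thesis
  proof (rule GMPR_from_lifts[where R = R])
    show "\<exists>x y. F x = P \<and> F y = Q \<and> R x y" if "(P, Q) \<in> stratum 4" for P Q
    proof -
      obtain x0 y0 where P: "P = F x0" "Q = F y0" "level x0 y0 = 4" using stratum_cases[OF \<open>(P, Q) \<in> stratum 4\<close>] by blast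
      obtain x y where xy: "lift P Q = (x, y)" by fastforce
      then have F: "F x = P" "F y = Q" using lift[of x0 y0] P by simp_all
      then have "(F x, F y) \<in> stratum 4" using that by simp
      then have "gpair x y" unfolding stratum_iff gpair_iff_level .
      then show ?thesis using F xy unfolding R_def by blast
    qed
    show "dist x y = odist x y" if "R x y" for x y using that lift[of x y] by (simp add: R_def)
    show "eqv (linepath x y t) (linepath x' y' t)" if "R x y" "R x' y'" "eqv x x'" "eqv y y'" for x y x' y' t
    proof -
      have "F x = F x'" "F y = F y'" using that(3,4) F_eq_iff by simp_all
      then have "(x', y') = (x, y)" using that(1,2) by (simp add: R_def)
      then show ?thesis by simp
    qed
    show "\<exists>\<delta>>0. \<forall>x' y'. dist x' x < \<delta> \<longrightarrow> dist y' y < \<delta> \<longrightarrow> (F x', F y') \<in> stratum 4 \<longrightarrow> R x' y'" if "R x y" for x y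
    proof (intro exI[of _ "1/12"] conjI allI impI)
      fix x' y' assume d: "dist x' x < 1/12" "dist y' y < 1/12" and "(F x', F y') \<in> stratum 4"
      then have g: "gpair x' y'" "gpair x y" using that by (simp_all add: stratum_iff gpair_iff_level[symmetric] R_def)
      then have "x' = x" "y' = y" using grid_discrete d by (auto simp: gpair_def)
      then show "R x' y'" using that by simp
    qed simp
  qed
qed

lemma open_level: "open {p. level (fst p) (snd p) \<le> k}"
  unfolding open_dist
proof
  fix p assume p: "p \<in> {p. level (fst p) (snd p) \<le> k}"
  obtain e where e: "e > 0" "\<forall>x' y'. dist x' (fst p) < e \<longrightarrow> dist y' (snd p) < e \<longrightarrow> level x' y' \<le> level (fst p) (snd p)"
  proof (cases "gpair (fst p) (snd p)")
    case True
    \<comment> \<open>Any radius will do, since 4 is the highest level.\<close>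
    then show ?thesis using that[of 1] level_le by (auto simp: gpair_iff_level)
  next
    case False
    then show ?thesis using level_local[OF False] that by blast
  qed
  have "q \<in> {p. level (fst p) (snd p) \<le> k}" if "dist q p < e" for q
  proof -
    have "dist (fst q) (fst p) < e" "dist (snd q) (snd p) < e"
      using dist_fst_le[of q p] dist_snd_le[of q p] that by linarith+
    then have "level (fst q) (snd q) \<le> level (fst p) (snd p)" using e(2) by blast
    then show ?thesis using p by simp
  qed
  then show "\<exists>e>0. \<forall>q. dist q p < e \<longrightarrow> q \<in> {p. level (fst p) (snd p) \<le> k}" using e(1) by blast
qed

text \<open>Upper semicontinuity of \<open>level\<close> makes the levels up to k open and the
  levels from k on closed; the stratum is their intersection.\<close>

lemma loc_compact_stratum: "loc_compact_sub T (stratum k)"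
proof -
  define V where "V = pairs (\<lambda>x y. level x y \<le> k)"
  define W where "W = pairs (\<lambda>x y. k \<le> level x y)"
  have mem: "(F x, F y) \<in> V \<longleftrightarrow> level x y \<le> k" "(F x, F y) \<in> W \<longleftrightarrow> k \<le> level x y" for x y
    unfolding V_def W_def by (rule pairs_level_iff)+
  have V: "lifts V = {p. level (fst p) (snd p) \<le> k}" and W: "lifts W = {p. k \<le> level (fst p) (snd p)}"
    by (simp_all add: lifts_def mem case_prod_unfold)
  have "lifts W = - {p. level (fst p) (snd p) < k}" unfolding W by auto
  moreover have "open {p. level (fst p) (snd p) < k}"
  proof (cases k)
    case (Suc j)
    then have "{p. level (fst p) (snd p) < k} = {p. level (fst p) (snd p) \<le> j}" by auto
    then show ?thesis using open_level by simp
  qed simp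
  ultimately have "closed (lifts W)" by (simp add: closed_def)
  moreover have "open (lifts V)" unfolding V by (rule open_level)
  moreover have "V \<subseteq> T \<times> T" "W \<subseteq> T \<times> T" by (auto simp: V_def W_def pairs_def)
  ultimately have "loc_compact_sub T (V \<inter> W)" by (intro loc_compact_lifts)
  moreover have "V \<inter> W = stratum k"
  proof (intro equalityI subsetI)
    fix p assume p: "p \<in> V \<inter> W"
    then obtain x y where xy: "p = (F x, F y)" unfolding V_def pairs_def by blast
    then have "level x y = k" using p mem[of x y] by simp
    then show "p \<in> stratum k" using xy stratum_iff by simp
  next
    fix p assume "p \<in> stratum k"
    then obtain x y where "p = (F x, F y)" "level x y = k" unfolding stratum_def pairs_def by blast
    then show "p \<in> V \<inter> W" using mem[of x y] by simp
  qed
  ultimately show ?thesis by simp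
qed

theorem GC_upper: "GC_partition T 4"
  unfolding GC_partition_def
proof (intro exI[of _ stratum] conjI allI impI)
  show "(\<Union>i\<le>4. stratum i) = T \<times> T"
  proof (intro equalityI subsetI)
    fix p assume "p \<in> (\<Union>i\<le>4. stratum i)"
    then show "p \<in> T \<times> T" by (auto simp: stratum_def pairs_def)
  next
    fix p assume "p \<in> T \<times> T"
    then have "fst p \<in> T" "snd p \<in> T" by auto
    then obtain x y where "fst p = F x" "snd p = F y" by (elim TE)
    then have "p = (F x, F y)" by (simp add: prod_eq_iff)
    then have "p \<in> stratum (level x y)" using stratum_iff[of x y "level x y"] by simp
    then show "p \<in> (\<Union>i\<le>4. stratum i)" using level_le[of x y] by blast
  qed
  show "disjoint_family_on stratum {..4}"
    unfolding disjoint_family_on_def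
  proof (intro ballI impI)
    fix m n :: nat assume "m \<noteq> n"
    show "stratum m \<inter> stratum n = {}"
    proof (rule ccontr)
      assume "stratum m \<inter> stratum n \<noteq> {}"
      then obtain P Q where "(P, Q) \<in> stratum m" "(P, Q) \<in> stratum n" by auto
      moreover then obtain x y where "P = F x" "Q = F y" using stratum_cases by blast
      ultimately show False using \<open>m \<noteq> n\<close> by (simp add: stratum_iff)
    qed
  qed
  fix i :: nat assume "i \<le> 4"
  show "loc_compact_sub T (stratum i)" by (rule loc_compact_stratum)
  have "i = 0 \<or> i = 1 \<or> i = 2 \<or> i = 3 \<or> i = 4" using \<open>i \<le> 4\<close> by linarith
  then show "admits_GMPR T (stratum i)" using admits_0 admits_1 admits_2 admits_3 admits_4 by blast
qed

end

theorem theorem1p1: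
  fixes a b c d :: "real^3"
  assumes "regular_tetra a b c d"
  shows "(\<exists>k. GC_partition (tetra_surface a b c d) k) \<and>
         (GC (tetra_surface a b c d) = 3 \<or> GC (tetra_surface a b c d) = 4)"
proof -
  obtain s where "s > 0" "dist a b = s" "dist a c = s" "dist a d = s" "dist b c = s" "dist b d = s" "dist c d = s"
    using assms unfolding regular_tetra_def by blast
  then interpret tetra a b c d s by unfold_locales
  have upward: "GC_partition (tetra_surface a b c d) 4" using GC_upper unfolding T_def .
  \<comment> \<open>The value of \<open>LEAST\<close> is itself the size of a partition only because
    some partition exists; the upper bound supplies it.\<close>
  have "GC_partition (tetra_surface a b c d) (GC (tetra_surface a b c d))"
    unfolding GC_def using upward by (rule LeastI)
  then have "3 \<le> GC (tetra_surface a b c d)" using GC_lower unfolding T_def by blast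
  moreover have "GC (tetra_surface a b c d) \<le> 4" unfolding GC_def using upward by (rule Least_le)
  ultimately show ?thesis using upward by (metis le_antisym not_less_eq_eq numeral_3_eq_3 eval_nat_numeral(2) semiring_norm(26,27,28))
qed

end
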